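(* Let $(X_n)_{n\in\mathbb{N}}$ be a (mean-zero) Gaussian process with covariance matrix $\Sigma$, satisfying the following: 1. There exist constants $c$ and $C$ such that for every finite $A\subseteq\mathbb{N}$, $$0<c<\lambda_i(\Sigma_A)<C\quad\text{for all } i.$$ 2. There exists a function $g_0(i,j)$ with $|\mathrm{Cov}(X_i,X_j)|\le g_0(i,j)$ for all $i,j\in\mathbb{N}$ such that, if we recursively define $$g_{n+1}(i,j)=g_n(i,j)+\sum_{k=1}^\infty g_n(i,k)\,g_n(k,j),$$ then for $n\le 4$, $g_n(i,j)$ exists and is finite (for all $i,j$), and moreover $$\sum_{k=1}^\infty g_n(i,k)\,k^{\epsilon}<\infty$$ for some $\epsilon>0$ and all $i$. Then $(X_n)_{n\in\mathbb{N}}$ satisfies the infinite intersection property (IIP) and the decorrelation property (DCP), and hence the ternary relation $\cdot\perp\!\!\!\perp_X\cdot\mid\cdot$ satisfies (P5* ).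
   Context: A Gaussian process is a collection of random variables such that every finite subcollection is multivariate normal; all variables are assumed to have mean zero. For $A\subseteq\mathbb{N}$, $X_A=(X_a)_{a\in A}$, and for finite $A$, $\Sigma_A$ is the covariance matrix of $X_A$; $\lambda_i(M)$ is the $i$-th largest eigenvalue of $M$. Conditional independence: for $A,B,C\subseteq\mathbb{N}$, $X_A\perp\!\!\!\perp X_B\mid X_C$ (also written $A\perp\!\!\!\perp_X B\mid C$) means $\mathbb{P}(E_1\mid\sigma(X_C))\mathbb{P}(E_2\mid\sigma(X_C))=\mathbb{P}(E_1\cap E_2\mid\sigma(X_C))$ a.s. for all $E_1\in\sigma(X_A)$, $E_2\in\sigma(X_B)$. (IIP): for any (possibly infinite) $D\subseteq\mathbb{N}$ and any finite pairwise disjoint $A,B,C\subseteq\mathbb{N}\setminus D$, if $X_A\perp\!\!\!\perp X_B\mid (X_C,X_D)$ and $X_A\perp\!\!\!\perp X_C\mid (X_B,X_D)$, then $X_A\perp\!\!\!\perp(X_B,X_C)\mid X_D$. (DCP): for any (possibly infinite) $D\subseteq\mathbb{N}$ and any event $E\in\bigcap_n\sigma(X_D,X_n,X_{n+1},X_{n+2},\dots)$ there exists $E'\in\sigma(X_D)$ with $\mathbb{P}(E\,\Delta\,E')=0$. (P5* ): for all (possibly infinite) $X,Y,Z\subseteq\mathbb{N}$ and any partition $X=\bigcup_kX_k$ into finite subsets, if $X_k\perp\!\!\!\perp_X Y\mid Z\cup\left(\bigcup_{j\ne k}X_j\right)$ for all $k$, then $X\perp\!\!\!\perp_X Y\mid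 Z$. *)

theory Defs
  imports "HOL-Probability.Probability" "Jordan_Normal_Form.Char_Poly"
begin

text \<open>The index set of the processes is the set of positive integers, represented by the
  subset \<open>{1..}\<close> of the type \<^typ>\<open>nat\<close>; the value \<open>X 0\<close> of a process \<open>X\<close> plays no role.\<close>

section \<open>Gaussian processes\<close>

text \<open>Normal laws on the real line include the degenerate ones (variance 0).\<close>

definition normal_rv :: "'a measure \<Rightarrow> ('a \<Rightarrow> real) \<Rightarrow> bool" where
  "normal_rv M Y \<longleftrightarrow>
     (\<exists>\<mu> \<sigma>. \<sigma> > 0 \<and> distributed M lborel Y (normal_density \<mu> \<sigma>)) \<or>
     (Y \<in> borel_measurable M \<and> (\<exists>\<mu>. AE \<omega> in M. Y \<omega> = \<mu>))"

text \<open>A finite random vector is multivariate normal iff all its linear combinations are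
  (possibly degenerate) normal.\<close>

definition multivariate_normal :: "'a measure \<Rightarrow> nat set \<Rightarrow> (nat \<Rightarrow> 'a \<Rightarrow> real) \<Rightarrow> bool" where
  "multivariate_normal M A X \<longleftrightarrow>
     finite A \<and> (\<forall>a\<in>A. X a \<in> borel_measurable M) \<and>
     (\<forall>t :: nat \<Rightarrow> real. normal_rv M (\<lambda>\<omega>. \<Sum>a\<in>A. t a * X a \<omega>))"

definition centered_gaussian_process :: "'a measure \<Rightarrow> (nat \<Rightarrow> 'a \<Rightarrow> real) \<Rightarrow> bool" where
  "centered_gaussian_process M X \<longleftrightarrow>
     prob_space M \<and>
     (\<forall>A. finite A \<and> A \<subseteq> {1..} \<longrightarrow> multivariate_normal M A X) \<and>
     (\<forall>n\<ge>1. integral\<^sup>L M (X n) = 0)"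

definition covariance :: "'a measure \<Rightarrow> ('a \<Rightarrow> real) \<Rightarrow> ('a \<Rightarrow> real) \<Rightarrow> real" where
  "covariance M Y Z =
     integral\<^sup>L M (\<lambda>\<omega>. (Y \<omega> - integral\<^sup>L M Y) * (Z \<omega> - integral\<^sup>L M Z))"

definition cov_matrix :: "'a measure \<Rightarrow> (nat \<Rightarrow> 'a \<Rightarrow> real) \<Rightarrow> nat set \<Rightarrow> real mat" where
  "cov_matrix M X A =
     Matrix.mat (card A) (card A)
       (\<lambda>(i, j). covariance M (X (sorted_list_of_set A ! i)) (X (sorted_list_of_set A ! j)))"

text \<open>The \<open>i\<close>-th largest real eigenvalue, \<open>1 \<le> i \<le> n\<close>, counted with algebraic multiplicity.
  (A real symmetric matrix of size \<open>n\<close>, in particular a covariance matrix, has exactly \<open>n\<close> of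
  them.)\<close>

definition nth_eigenvalue :: "nat \<Rightarrow> real mat \<Rightarrow> real" where
  "nth_eigenvalue i B = rev (sorted_list_of_multiset (proots (char_poly B))) ! (i - 1)"

lemma set_proots_char_poly:
  assumes "B \<in> carrier_mat n n"
  shows "set (sorted_list_of_multiset (proots (char_poly (B :: real mat)))) = Collect (eigenvalue B)"
proof -
  have "char_poly B \<noteq> 0"
    using degree_monic_char_poly[OF assms] by auto
  then show ?thesis
    using eigenvalue_root_char_poly[OF assms] by (auto simp: set_count_proots)
qed


section \<open>Conditional independence\<close>

text \<open>\<open>\<sigma>(X\<^sub>A)\<close> for the random vector \<open>X\<^sub>A = (X\<^sub>a)\<^sub>a\<^sub>\<in>\<^sub>A\<close>, \<open>A\<close> possibly infinite or empty.\<close>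

definition sigma_gen :: "'a measure \<Rightarrow> (nat \<Rightarrow> 'a \<Rightarrow> real) \<Rightarrow> nat set \<Rightarrow> 'a measure" where
  "sigma_gen M X A =
     vimage_algebra (space M) (\<lambda>\<omega>. \<lambda>a\<in>A. X a \<omega>) (\<Pi>\<^sub>M a\<in>A. (borel :: real measure))"

definition cond_indep ::
    "'a measure \<Rightarrow> (nat \<Rightarrow> 'a \<Rightarrow> real) \<Rightarrow> nat set \<Rightarrow> nat set \<Rightarrow> nat set \<Rightarrow> bool" where
  "cond_indep M X A B C \<longleftrightarrow>
     (\<forall>E1 \<in> sets (sigma_gen M X A). \<forall>E2 \<in> sets (sigma_gen M X B).
        AE \<omega> in M.
          real_cond_exp M (sigma_gen M X C) (indicator E1) \<omega> *
          real_cond_exp M (sigma_gen M X C) (indicator E2) \<omega> =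
          real_cond_exp M (sigma_gen M X C) (indicator (E1 \<inter> E2)) \<omega>)"

definition IIP :: "'a measure \<Rightarrow> (nat \<Rightarrow> 'a \<Rightarrow> real) \<Rightarrow> bool" where
  "IIP M X \<longleftrightarrow>
     (\<forall>D A B C.
        D \<subseteq> {1..} \<and> A \<subseteq> {1..} - D \<and> B \<subseteq> {1..} - D \<and> C \<subseteq> {1..} - D \<and>
        finite A \<and> finite B \<and> finite C \<and>
        A \<inter> B = {} \<and> A \<inter> C = {} \<and> B \<inter> C = {} \<and>
        cond_indep M X A B (C \<union> D) \<and> cond_indep M X A C (B \<union> D)
        \<longrightarrow> cond_indep M X A (B \<union> C) D)"

definition DCP :: "'a measure \<Rightarrow> (nat \<Rightarrow> 'a \<Rightarrow> real) \<Rightarrow> bool" where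
  "DCP M X \<longleftrightarrow>
     (\<forall>D E. D \<subseteq> {1..} \<and> E \<in> (\<Inter>n\<in>{1..}. sets (sigma_gen M X (D \<union> {n..})))
        \<longrightarrow> (\<exists>E' \<in> sets (sigma_gen M X D). measure M (sym_diff E E') = 0))"

definition P5star :: "(nat set \<Rightarrow> nat set \<Rightarrow> nat set \<Rightarrow> bool) \<Rightarrow> bool" where
  "P5star R \<longleftrightarrow>
     (\<forall>S T Z P.
        S \<subseteq> {1..} \<and> T \<subseteq> {1..} \<and> Z \<subseteq> {1..} \<and>
        partition_on S P \<and> (\<forall>K\<in>P. finite K) \<and>
        (\<forall>K\<in>P. R K T (Z \<union> \<Union>(P - {K})))
        \<longrightarrow> R S T Z)"


section \<open>Iterated covariance bounds\<close>

text \<open>All terms are nonnegative, so the sums are formed in \<^typ>\<open>ennreal\<close>, and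
  ``exists and is finite'' becomes \<open>< \<infinity>\<close>. The summation index \<open>Suc k\<close> ranges over the
  positive integers.\<close>

fun iterated_bound :: "(nat \<Rightarrow> nat \<Rightarrow> ennreal) \<Rightarrow> nat \<Rightarrow> nat \<Rightarrow> nat \<Rightarrow> ennreal" where
  "iterated_bound g0 0 i j = g0 i j"
| "iterated_bound g0 (Suc n) i j =
     iterated_bound g0 n i j +
     (\<Sum>k. iterated_bound g0 n i (Suc k) * iterated_bound g0 n (Suc k) j)"

end

theory Submission
  imports Defs
begin

text \<open>The eigenvalue bounds say that \<open>(X\<^sub>n)\<close> is a Riesz sequence in \<open>L\<^sup>2\<close>:
  \<open>c * \<Sum>t\<^sub>a\<^sup>2 \<le> E (\<Sum>t\<^sub>a X\<^sub>a)\<^sup>2 \<le> C * \<Sum>t\<^sub>a\<^sup>2\<close>. Hence each element of a closed span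
  has unique coefficients, and the closed span of \<open>X\<^sub>A\<close> turns intersections of index sets \<open>A\<close>, also
  infinite ones, into intersections of subspaces. For Gaussian variables, \<open>X\<^sub>A\<close> and \<open>X\<^sub>B\<close> are
  independent given \<open>X\<^sub>C\<close> iff the projection of every \<open>X\<^sub>a\<close>, \<open>a \<in> A\<close>, onto the closed span of
  \<open>X\<^sub>B\<^sub>\<union>\<^sub>C\<close> lies in the closed span of \<open>X\<^sub>C\<close>. Both intersection properties then follow from uniqueness
  of projections. For the decorrelation property, projections onto the closed spans of
  \<open>D \<union> {n..}\<close> converge to the projection onto their intersection, which is the closed span of \<open>D\<close>;
  so an event \<open>E\<close> of the tail \<open>\<sigma>\<close>-algebra satisfies \<open>E[cos (Y + \<theta>) (1\<^sub>E - P(E | X\<^sub>D))] = 0\<close> for all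
  finite combinations \<open>Y\<close>, whence \<open>1\<^sub>E = P(E | X\<^sub>D)\<close> almost surely.\<close>

section \<open>Square-integrable random variables\<close>

text \<open>Projections of Gaussian variables are linear algebra, whereas \<open>IIP\<close>,
  \<open>DCP\<close> and \<open>P5star\<close> speak of events. The bridge is
  \<open>expectation_cos_projection\<close>: against a bounded \<sigma>(X_D)-measurable function,
  \<open>cos (Y + \<theta>)\<close> may be replaced by a constant times
  \<open>cos (Z + \<theta>)\<close>, where Z is the projection of Y. Cosines are bounded with
  explicit expectations, and the phase \<open>- pi / 2\<close> yields sines, so real integrals do
  the work of characteristic functions.

  The eigenvalue bounds enter through \<open>cspan_Inter\<close>. If X_1 = X_2 is not almost surely
  0, it lies in the closed spans of {1} and of {2}, but not in that of their intersection; the lower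
  bound excludes such dependence, also in the limit. \<open>P5star\<close> is read off from
  projections just as \<open>IIP\<close> is, with a possibly infinite family of index sets in place
  of two; decreasing limits of projections occur only for \<open>DCP\<close>.

  Random variables are functions here, not classes modulo null sets. Uniqueness therefore means
  \<open>sqdist\<close> zero, and measurability for \<sigma>(X_A) is regained by passing to an
  almost surely equal version.\<close>

definition L2 :: "'a measure \<Rightarrow> ('a \<Rightarrow> real) set" where
  "L2 M = {Y. Y \<in> borel_measurable M \<and> integrable M (\<lambda>\<omega>. (Y \<omega>)\<^sup>2)}"

definition ip :: "'a measure \<Rightarrow> ('a \<Rightarrow> real) \<Rightarrow> ('a \<Rightarrow> real) \<Rightarrow> real" where
  "ip M Y Z = (\<integral>\<omega>. Y \<omega> * Z \<omega> \<partial>M)"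

text \<open>Squared distances are kept throughout; \<open>ip_triangle\<close>, with its factor 2,
  stands in for the triangle inequality of the norm.\<close>

abbreviation sqdist :: "'a measure \<Rightarrow> ('a \<Rightarrow> real) \<Rightarrow> ('a \<Rightarrow> real) \<Rightarrow> real" where
  "sqdist M Y Z \<equiv> ip M (\<lambda>\<omega>. Y \<omega> - Z \<omega>) (\<lambda>\<omega>. Y \<omega> - Z \<omega>)"

lemma L2_measurable: "Y \<in> L2 M \<Longrightarrow> Y \<in> borel_measurable M"
  by (simp add: L2_def)

lemma L2_mult_integrable:
  assumes "Y \<in> L2 M" "Z \<in> L2 M"
  shows "integrable M (\<lambda>\<omega>. Y \<omega> * Z \<omega>)"
proof (rule Bochner_Integration.integrable_bound)
  show "integrable M (\<lambda>\<omega>. (Y \<omega>)\<^sup>2 + (Z \<omega>)\<^sup>2)"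
    using assms by (auto simp: L2_def)
  show "(\<lambda>\<omega>. Y \<omega> * Z \<omega>) \<in> borel_measurable M"
    using assms by (auto simp: L2_def)
  have "\<bar>y * z\<bar> \<le> y\<^sup>2 + z\<^sup>2" for y z :: real
  proof -
    have "2 * \<bar>y\<bar> * \<bar>z\<bar> \<le> y\<^sup>2 + z\<^sup>2"
      using sum_squares_bound[of "\<bar>y\<bar>" "\<bar>z\<bar>"] by simp
    moreover have "0 \<le> \<bar>y\<bar> * \<bar>z\<bar>" by simp
    ultimately show ?thesis unfolding abs_mult by linarith
  qed
  then show "AE \<omega> in M. norm (Y \<omega> * Z \<omega>) \<le> norm ((Y \<omega>)\<^sup>2 + (Z \<omega>)\<^sup>2)"
    by (auto intro: order_trans)
qed

lemma ip_self: "ip M Y Y = (\<integral>\<omega>. (Y \<omega>)\<^sup>2 \<partial>M)"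
  by (simp add: ip_def power2_eq_square)

lemma ip_self_nonneg: "0 \<le> ip M Y Y"
  by (simp add: ip_def)

lemma ip_commute: "ip M Y Z = ip M Z Y"
  by (simp add: ip_def mult.commute)

lemma ip_cmult_left: "ip M (\<lambda>\<omega>. c * Y \<omega>) Z = c * ip M Y Z"
  by (simp add: ip_def mult.assoc)

lemma ip_cmult_right: "ip M Z (\<lambda>\<omega>. c * Y \<omega>) = c * ip M Z Y"
  using ip_cmult_left[of M c Y Z] by (simp add: ip_commute)

lemma L2_cmult: "Y \<in> L2 M \<Longrightarrow> (\<lambda>\<omega>. c * Y \<omega>) \<in> L2 M"
  by (auto simp: L2_def power_mult_distrib)

lemma L2_add:
  assumes "Y \<in> L2 M" "Z \<in> L2 M"
  shows "(\<lambda>\<omega>. Y \<omega> + Z \<omega>) \<in> L2 M"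
  using assms L2_mult_integrable[OF assms] by (auto simp: L2_def power2_sum mult.assoc)

lemma L2_diff:
  assumes "Y \<in> L2 M" "Z \<in> L2 M"
  shows "(\<lambda>\<omega>. Y \<omega> - Z \<omega>) \<in> L2 M"
  using L2_add[OF assms(1) L2_cmult[OF assms(2), of "-1"]] by simp

lemma L2_zero: "(\<lambda>\<omega>. 0) \<in> L2 M"
  by (simp add: L2_def)

lemma L2_sum: "(\<And>i. i \<in> F \<Longrightarrow> Y i \<in> L2 M) \<Longrightarrow> (\<lambda>\<omega>. \<Sum>i\<in>F. Y i \<omega>) \<in> L2 M"
  by (induction F rule: infinite_finite_induct) (auto intro: L2_zero L2_add)

lemma ip_add_left:
  assumes "Y \<in> L2 M" "Z \<in> L2 M" "W \<in> L2 M"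
  shows "ip M (\<lambda>\<omega>. Y \<omega> + Z \<omega>) W = ip M Y W + ip M Z W"
  using assms by (simp add: ip_def distrib_right L2_mult_integrable)

lemma ip_add_right:
  assumes "Y \<in> L2 M" "Z \<in> L2 M" "W \<in> L2 M"
  shows "ip M W (\<lambda>\<omega>. Y \<omega> + Z \<omega>) = ip M W Y + ip M W Z"
  using ip_add_left[OF assms] by (simp add: ip_commute)

lemma ip_diff_left:
  assumes "Y \<in> L2 M" "Z \<in> L2 M" "W \<in> L2 M"
  shows "ip M (\<lambda>\<omega>. Y \<omega> - Z \<omega>) W = ip M Y W - ip M Z W"
  using assms by (simp add: ip_def left_diff_distrib L2_mult_integrable)

lemma ip_diff_right:
  assumes "Y \<in> L2 M" "Z \<in> L2 M" "W \<in> L2 M"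
  shows "ip M W (\<lambda>\<omega>. Y \<omega> - Z \<omega>) = ip M W Y - ip M W Z"
  using ip_diff_left[OF assms] by (simp add: ip_commute)

lemma ip_sum_left:
  assumes "\<And>i. i \<in> F \<Longrightarrow> Y i \<in> L2 M" "W \<in> L2 M"
  shows "ip M (\<lambda>\<omega>. \<Sum>i\<in>F. Y i \<omega>) W = (\<Sum>i\<in>F. ip M (Y i) W)"
  using assms by (simp add: ip_def sum_distrib_right L2_mult_integrable)

lemma ip_add_self:
  assumes "Y \<in> L2 M" "Z \<in> L2 M"
  shows "ip M (\<lambda>\<omega>. Y \<omega> + Z \<omega>) (\<lambda>\<omega>. Y \<omega> + Z \<omega>) = ip M Y Y + 2 * ip M Y Z + ip M Z Z"
  using assms by (simp add: ip_add_left ip_add_right L2_add ip_commute[of M Z Y])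

lemma ip_diff_self:
  assumes "Y \<in> L2 M" "Z \<in> L2 M"
  shows "sqdist M Y Z = ip M Y Y - 2 * ip M Y Z + ip M Z Z"
  using assms by (simp add: ip_diff_left ip_diff_right L2_diff ip_commute[of M Z Y])

lemma ip_diff_swap: 
  "sqdist M Y Z = sqdist M Z Y"
  unfolding ip_self by (simp add: power2_commute)

text \<open>The parallelogram law with the term for Y - Z dropped.\<close>

lemma ip_add_self_le:
  assumes "Y \<in> L2 M" "Z \<in> L2 M"
  shows "ip M (\<lambda>\<omega>. Y \<omega> + Z \<omega>) (\<lambda>\<omega>. Y \<omega> + Z \<omega>) \<le> 2 * (ip M Y Y + ip M Z Z)"
proof -
  have "a + 2 * b + c \<le> 2 * (a + c)" if "0 \<le> a - 2 * b + c" for a b c :: real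
    using that by (simp add: algebra_simps)
  from this[of "ip M Y Y" "ip M Y Z" "ip M Z Z"] show ?thesis
    using ip_self_nonneg[of M "\<lambda>\<omega>. Y \<omega> - Z \<omega>"]
    unfolding ip_add_self[OF assms] ip_diff_self[OF assms] by blast
qed

lemma ip_triangle:
  assumes "Y \<in> L2 M" "Z \<in> L2 M" "W \<in> L2 M"
  shows "sqdist M Y W
    \<le> 2 * (sqdist M Y Z + sqdist M Z W)"
  using ip_add_self_le[OF L2_diff[OF assms(1,2)] L2_diff[OF assms(2,3)]] by simp

text \<open>Near s = 0 the linear term dominates and takes both signs unless b = 0. This is the
  first-variation argument behind both the projection theorem and the eigenvector equation.\<close>

lemma linear_coeff_zero_if_quadratic_nonneg:
  fixes a b :: real
  assumes "\<And>s. 0 \<le> s\<^sup>2 * a + 2 * s * b"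
  shows "b = 0"
proof (rule ccontr)
  assume "b \<noteq> 0"
  define k where "k = \<bar>a\<bar> + 1"
  have "k > 0" "a < k" by (auto simp: k_def)
  have "0 \<le> (- b / k)\<^sup>2 * a + 2 * (- b / k) * b" by (rule assms)
  also have "\<dots> = (b\<^sup>2 / k\<^sup>2) * (a - 2 * k)"
    using \<open>k > 0\<close> by (simp add: field_simps power2_eq_square)
  finally have "0 \<le> (b\<^sup>2 / k\<^sup>2) * (a - 2 * k)" .
  moreover have "b\<^sup>2 / k\<^sup>2 > 0" using \<open>b \<noteq> 0\<close> \<open>k > 0\<close> by simp
  ultimately have "0 \<le> a - 2 * k"
    using zero_le_mult_iff[of "b\<^sup>2 / k\<^sup>2" "a - 2 * k"] by linarith
  with \<open>a < k\<close> \<open>k > 0\<close> show False by linarith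
qed

lemma ip_Cauchy_Schwarz:
  assumes "Y \<in> L2 M" "Z \<in> L2 M"
  shows "(ip M Y Z)\<^sup>2 \<le> ip M Y Y * ip M Z Z"
proof -
  have q: "0 \<le> s\<^sup>2 * ip M Z Z + 2 * s * ip M Y Z + ip M Y Y" for s
    using ip_add_self[OF assms(1) L2_cmult[OF assms(2), of s]]
      ip_self_nonneg[of M "\<lambda>\<omega>. Y \<omega> + s * Z \<omega>"]
    by (simp add: ip_cmult_left ip_cmult_right power2_eq_square algebra_simps)
  show ?thesis
  proof (cases "ip M Z Z = 0")
    case True
    have "ip M Y Z = 0"
    proof (rule ccontr)
      assume nz: "ip M Y Z \<noteq> 0"
      \<comment> \<open>With \<open>ip M Z Z = 0\<close> the form is affine in s; this s makes it
        equal to -1.\<close>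
      have "0 \<le> 2 * (- (ip M Y Y + 1) / (2 * ip M Y Z)) * ip M Y Z + ip M Y Y"
        using q[of "- (ip M Y Y + 1) / (2 * ip M Y Z)"] True by simp
      also have "\<dots> = - 1" using nz by (simp add: field_simps)
      finally show False by simp
    qed
    then show ?thesis using True by simp
  next
    case False
    then have "ip M Z Z > 0" using ip_self_nonneg[of M Z] by linarith
    \<comment> \<open>The minimiser of the quadratic in s.\<close>
    have "0 \<le> (- ip M Y Z / ip M Z Z)\<^sup>2 * ip M Z Z + 2 * (- ip M Y Z / ip M Z Z) * ip M Y Z + ip M Y Y"
      by (rule q)
    also have "\<dots> = ip M Y Y - (ip M Y Z)\<^sup>2 / ip M Z Z"
      using False by (simp add: field_simps power2_eq_square)
    finally show ?thesis using \<open>ip M Z Z > 0\<close> by (simp add: field_simps)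
  qed
qed

lemma ip_tendsto_left:
  assumes Y: "\<And>n. Y n \<in> L2 M" "L \<in> L2 M" "W \<in> L2 M"
    and lim: "(\<lambda>n. sqdist M (Y n) L) \<longlonglongrightarrow> 0"
  shows "(\<lambda>n. ip M (Y n) W) \<longlonglongrightarrow> ip M L W"
proof -
  have "(\<lambda>n. (ip M (\<lambda>\<omega>. Y n \<omega> - L \<omega>) W)\<^sup>2) \<longlonglongrightarrow> 0"
  proof (rule tendsto_sandwich[where f = "\<lambda>_. 0"])
    show "\<forall>\<^sub>F n in sequentially. (ip M (\<lambda>\<omega>. Y n \<omega> - L \<omega>) W)\<^sup>2
       \<le> sqdist M (Y n) L * ip M W W"
      by (intro always_eventually allI ip_Cauchy_Schwarz L2_diff Y)
    show "(\<lambda>n. sqdist M (Y n) L * ip M W W) \<longlonglongrightarrow> 0"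
      using tendsto_mult_right[OF lim, of "ip M W W"] by simp
  qed auto
  then have "(\<lambda>n. ip M (\<lambda>\<omega>. Y n \<omega> - L \<omega>) W) \<longlonglongrightarrow> 0"
    by (simp add: power_tendsto_0_iff)
  then have "(\<lambda>n. ip M (Y n) W - ip M L W) \<longlonglongrightarrow> 0"
    using Y by (simp add: ip_diff_left)
  then show ?thesis by (simp add: LIM_zero_iff)
qed

lemma ip_self_tendsto:
  assumes Y: "\<And>n. Y n \<in> L2 M" "L \<in> L2 M"
    and lim: "(\<lambda>n. sqdist M (Y n) L) \<longlonglongrightarrow> 0"
  shows "(\<lambda>n. ip M (Y n) (Y n)) \<longlonglongrightarrow> ip M L L"
proof -
  \<comment> \<open>The quadratic term is traded for the vanishing distance and a term linear in
    \<open>Y n\<close>.\<close>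
  have "ip M (Y n) (Y n) = sqdist M (Y n) L + 2 * ip M (Y n) L - ip M L L" for n
    using Y by (simp add: ip_diff_self)
  moreover have "(\<lambda>n. sqdist M (Y n) L + 2 * ip M (Y n) L - ip M L L)
    \<longlonglongrightarrow> 0 + 2 * ip M L L - ip M L L"
    by (intro tendsto_intros lim ip_tendsto_left Y)
  ultimately show ?thesis by simp
qed

lemma ip_zero_AE:
  assumes "Y \<in> L2 M" "ip M Y Y = 0"
  shows "AE \<omega> in M. Y \<omega> = 0"
  using assms integral_nonneg_eq_0_iff_AE[of M "\<lambda>\<omega>. (Y \<omega>)\<^sup>2"] by (simp add: ip_self L2_def)

section \<open>Completeness of mean-square convergence\<close>

context prob_space
begin

lemma L2_const: "(\<lambda>\<omega>. c) \<in> L2 M"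
  by (simp add: L2_def)

lemma L2_integrable: "Y \<in> L2 M \<Longrightarrow> integrable M Y"
  using L2_mult_integrable[OF _ L2_const[of 1]] by simp

lemma abs_expectation_le_L2:
  assumes "Y \<in> L2 M"
  shows "expectation (\<lambda>\<omega>. \<bar>Y \<omega>\<bar>) \<le> sqrt (ip M Y Y)"
proof -
  have "(\<lambda>\<omega>. \<bar>Y \<omega>\<bar>) \<in> L2 M" using assms by (auto simp: L2_def)
  from ip_Cauchy_Schwarz[OF this L2_const[of 1]]
  have "(expectation (\<lambda>\<omega>. \<bar>Y \<omega>\<bar>))\<^sup>2 \<le> ip M Y Y"
    by (simp add: ip_def prob_space)
  then show ?thesis by (simp add: real_le_rsqrt)
qed

text \<open>The core of the completeness of \<open>L\<^sup>2\<close>: summable increments force almost sure convergence,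
  and Fatou's lemma turns this into convergence in mean square.\<close>

lemma L2_rapid_Cauchy:
  assumes Y: "\<And>n. Y n \<in> L2 M"
    and rapid: "\<And>n. sqdist M (Y (Suc n)) (Y n) \<le> (1/4)^n"
  shows "AE \<omega> in M. convergent (\<lambda>n. Y n \<omega>)"
proof -
  have D: "(\<lambda>\<omega>. Y (Suc n) \<omega> - Y n \<omega>) \<in> L2 M" for n
    by (intro L2_diff Y)
  have [measurable]: "Y n \<in> borel_measurable M" for n using Y by (simp add: L2_measurable)
  have int: "integrable M (\<lambda>\<omega>. \<bar>Y (Suc n) \<omega> - Y n \<omega>\<bar>)" for n
    using L2_integrable[OF D] by simp
  \<comment> \<open>The rate 1/4 for squared distances is chosen so that its square root still sums
    to a finite value.\<close>
  have half: "expectation (\<lambda>\<omega>. \<bar>Y (Suc n) \<omega> - Y n \<omega>\<bar>) \<le> (1/2)^n" for n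
  proof -
    have "sqrt (sqdist M (Y (Suc n)) (Y n)) \<le> sqrt ((1/4)^n)"
      using rapid by simp
    also have "(1/4::real)^n = ((1/2)^n)\<^sup>2"
      by (simp add: power_mult_distrib[symmetric] power2_eq_square)
    finally show ?thesis using abs_expectation_le_L2[OF D, of n] by simp
  qed
  have "(\<integral>\<^sup>+\<omega>. (\<Sum>n. ennreal \<bar>Y (Suc n) \<omega> - Y n \<omega>\<bar>) \<partial>M) = (\<Sum>n. \<integral>\<^sup>+\<omega>. ennreal \<bar>Y (Suc n) \<omega> - Y n \<omega>\<bar> \<partial>M)"
    by (rule nn_integral_suminf) measurable
  also have "\<dots> = (\<Sum>n. ennreal (expectation (\<lambda>\<omega>. \<bar>Y (Suc n) \<omega> - Y n \<omega>\<bar>)))"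
    by (intro suminf_cong nn_integral_eq_integral int) auto
  also have "\<dots> \<le> (\<Sum>n. ennreal ((1/2)^n))"
    by (intro suminf_le ennreal_leI half) auto
  also have "\<dots> = ennreal (\<Sum>n. (1/2)^n)"
    by (intro suminf_ennreal2) auto
  also have "\<dots> < \<infinity>" by simp
  finally have "(\<integral>\<^sup>+\<omega>. (\<Sum>n. ennreal \<bar>Y (Suc n) \<omega> - Y n \<omega>\<bar>) \<partial>M) \<noteq> \<infinity>" by auto
  then have "AE \<omega> in M. (\<Sum>n. ennreal \<bar>Y (Suc n) \<omega> - Y n \<omega>\<bar>) \<noteq> \<infinity>"
    by (intro nn_integral_PInf_AE) auto
  then show ?thesis
  proof eventually_elim
    case (elim \<omega>)
    have "summable (\<lambda>n. \<bar>Y (Suc n) \<omega> - Y n \<omega>\<bar>)"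
      by (rule summable_suminf_not_top) (use elim in auto)
    then have "summable (\<lambda>n. Y (Suc n) \<omega> - Y n \<omega>)"
      by (rule summable_rabs_cancel)
    then have "convergent (\<lambda>n. \<Sum>i<n. Y (Suc i) \<omega> - Y i \<omega>)"
      by (simp add: summable_iff_convergent)
    then have "convergent (\<lambda>n. Y n \<omega> - Y 0 \<omega>)"
      using sum_lessThan_telescope[of "\<lambda>n. Y n \<omega>"] by simp
    then show ?case
      by (simp add: convergent_diff_const_right_iff)
  qed
qed

text \<open>The constant 4 reproduces itself: peeling off the first increment turns it into 2 * (4 *
  1/4 + 1) = 4. The rate 1/4 thus absorbs the factor 2 of \<open>ip_triangle\<close>.\<close>

lemma ip_le_if_rapid:
  assumes Y: "\<And>n. Y n \<in> L2 M"
    and rapid: "\<And>n. sqdist M (Y (Suc n)) (Y n) \<le> (1/4)^n"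
  shows "sqdist M (Y (n + k)) (Y n) \<le> 4 * (1/4)^n"
proof (induction k arbitrary: n)
  case 0
  then show ?case by (simp add: ip_def)
next
  case (Suc k)
  have "sqdist M (Y (Suc n + k)) (Y n)
    \<le> 2 * (sqdist M (Y (Suc n + k)) (Y (Suc n)) + 
         sqdist M (Y (Suc n)) (Y n))"
    by (rule ip_triangle) (rule Y)+
  also have "\<dots> \<le> 2 * (4 * (1/4)^(Suc n) + (1/4)^n)"
    using Suc.IH[of "Suc n"] rapid[of n] by simp
  also have "\<dots> \<le> 4 * (1/4)^n" by simp
  finally show ?case by simp
qed

text \<open>The limit is the pointwise \<open>lim\<close>, a total function, so it is measurable for
  every sub-\<sigma>-algebra for which all \<open>Y n\<close> are;
  \<open>cspan_sigma_gen_version\<close> relies on this.\<close>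

lemma L2_rapid_limit:
  assumes Y: "\<And>n. Y n \<in> L2 M"
    and rapid: "\<And>n. sqdist M (Y (Suc n)) (Y n) \<le> (1/4)^n"
  defines "L \<equiv> \<lambda>\<omega>. lim (\<lambda>n. Y n \<omega>)"
  shows "L \<in> L2 M" and "sqdist M (Y n) L \<le> 4 * (1/4)^n"
proof -
  have [measurable]: "Y n \<in> borel_measurable M" for n using Y by (simp add: L2_measurable)
  have L[measurable]: "L \<in> borel_measurable M" unfolding L_def by measurable
  have conv: "AE \<omega> in M. (\<lambda>n. Y n \<omega>) \<longlonglongrightarrow> L \<omega>"
    using L2_rapid_Cauchy[OF Y rapid] by eventually_elim (simp add: L_def convergent_LIMSEQ_iff)
  have bound: "(\<integral>\<^sup>+\<omega>. ennreal ((Y n \<omega> - L \<omega>)\<^sup>2) \<partial>M) \<le> ennreal (4 * (1/4)^n)" for n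
  proof -
    have "(\<integral>\<^sup>+\<omega>. ennreal ((Y n \<omega> - L \<omega>)\<^sup>2) \<partial>M)
      = (\<integral>\<^sup>+\<omega>. liminf (\<lambda>k. ennreal ((Y (n + k) \<omega> - Y n \<omega>)\<^sup>2)) \<partial>M)"
    proof (rule nn_integral_cong_AE, use conv in eventually_elim)
      case (elim \<omega>)
      have "(\<lambda>k. Y (n + k) \<omega>) \<longlonglongrightarrow> L \<omega>"
        using LIMSEQ_ignore_initial_segment[OF elim, of n] by (simp add: add.commute)
      then have "(\<lambda>k. ennreal ((Y (n + k) \<omega> - Y n \<omega>)\<^sup>2)) \<longlonglongrightarrow> ennreal ((L \<omega> - Y n \<omega>)\<^sup>2)"
        by (intro tendsto_intros)
      from lim_imp_Liminf[OF _ this] show ?case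
        by (simp add: power2_commute[of "L \<omega>"])
    qed
    also have "\<dots> \<le> liminf (\<lambda>k. \<integral>\<^sup>+\<omega>. ennreal ((Y (n + k) \<omega> - Y n \<omega>)\<^sup>2) \<partial>M)"
      by (rule nn_integral_liminf) measurable
    also have "\<dots> \<le> liminf (\<lambda>k. ennreal (4 * (1/4)^n))"
    proof (intro Liminf_mono always_eventually allI)
      fix k
      have "(\<integral>\<^sup>+\<omega>. ennreal ((Y (n + k) \<omega> - Y n \<omega>)\<^sup>2) \<partial>M)
         = ennreal (sqdist M (Y (n + k)) (Y n))"
        unfolding ip_self using L2_diff[OF Y Y] by (intro nn_integral_eq_integral) (auto simp: L2_def)
      also have "\<dots> \<le> ennreal (4 * (1/4)^n)"
        by (intro ennreal_leI ip_le_if_rapid Y rapid)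
      finally show "(\<integral>\<^sup>+\<omega>. ennreal ((Y (n + k) \<omega> - Y n \<omega>)\<^sup>2) \<partial>M) \<le> ennreal (4 * (1/4)^n)" .
    qed
    finally show ?thesis by (simp add: Liminf_const)
  qed
  have D: "(\<lambda>\<omega>. Y n \<omega> - L \<omega>) \<in> L2 M" for n
    unfolding L2_def
    by (auto intro!: integrableI_bounded order.strict_trans1[OF bound])
  show "L \<in> L2 M"
    using L2_diff[OF Y[of 0] D[of 0]] by simp
  have "ennreal (sqdist M (Y n) L) \<le> ennreal (4 * (1/4)^n)"
    unfolding ip_self using bound[of n] D[of n]
    by (subst nn_integral_eq_integral[symmetric]) (auto simp: L2_def)
  then show "sqdist M (Y n) L \<le> 4 * (1/4)^n"
    by (subst (asm) ennreal_le_iff) auto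
qed

end

section \<open>The closed linear span of a Gaussian family\<close>

text \<open>The formula is the real part of e^(i\<theta>) times the characteristic function of Y,
  which is real because Y is centred. The phases 0 and \<open>- pi / 2\<close> cover cosine and sine
  at once.\<close>

lemma (in prob_space) normal_rv_L2_cos:
  assumes "normal_rv M Y" "expectation Y = 0"
  shows "Y \<in> L2 M" and "expectation (\<lambda>\<omega>. cos (Y \<omega> + \<theta>)) = cos \<theta> * exp (- ip M Y Y / 2)"
proof -
  have "Y \<in> L2 M \<and> expectation (\<lambda>\<omega>. cos (Y \<omega> + \<theta>)) = cos \<theta> * exp (- ip M Y Y / 2)"
    using assms(1) unfolding normal_rv_def
  proof (elim disjE exE conjE)
    fix \<mu> \<sigma> :: real
    assume \<sigma>: "\<sigma> > 0" and D: "distributed M lborel Y (normal_density \<mu> \<sigma>)"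
    have \<mu>: "\<mu> = 0" using normal_distributed_expectation[OF \<sigma> D] assms(2) by simp
    define N where "N = (\<lambda>\<omega>. Y \<omega> / \<sigma>)"
    have Y: "Y = (\<lambda>\<omega>. \<sigma> * N \<omega>)" using \<sigma> by (simp add: N_def)
    have DN: "distributed M lborel N std_normal_density"
      using D normal_standard_normal_convert[OF \<sigma>, of Y \<mu>] by (simp add: \<mu> N_def)
    have [measurable]: "N \<in> borel_measurable M"
      using distributed_measurable[OF DN] by simp
    have "integrable M (\<lambda>\<omega>. (N \<omega>)\<^sup>2)"
      using distributed_integrable[OF DN, of "\<lambda>x. x\<^sup>2"] integrable_std_normal_moment[of 2] by simp
    then have N: "N \<in> L2 M" by (simp add: L2_def)
    then have "Y \<in> L2 M" unfolding Y by (rule L2_cmult)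
    have ipY: "ip M Y Y = \<sigma>\<^sup>2"
      using normal_distributed_variance[OF \<sigma> D] assms(2) by (simp add: ip_self)
    have "expectation (\<lambda>\<omega>. iexp (\<sigma> * N \<omega>)) = (CLINT x|distr M lborel N. iexp (\<sigma> * x))"
      by (subst integral_distr) auto
    also have "distr M lborel N = std_normal_distribution"
      using DN by (rule distributed_distr_eq_density)
    also have "(CLINT x|std_normal_distribution. iexp (\<sigma> * x)) = complex_of_real (exp (- \<sigma>\<^sup>2 / 2))"
      using fun_cong[OF char_std_normal_distribution, of \<sigma>] by (simp add: char_def)
    finally have E: "expectation (\<lambda>\<omega>. iexp (Y \<omega>)) = complex_of_real (exp (- \<sigma>\<^sup>2 / 2))"
      by (simp add: Y)
    have int: "integrable M (\<lambda>\<omega>. iexp \<theta> * iexp (Y \<omega>))"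
      using L2_measurable[OF \<open>Y \<in> L2 M\<close>]
      by (intro integrable_mult_right integrable_const_bound[where B = 1]) auto
    have "expectation (\<lambda>\<omega>. cos (Y \<omega> + \<theta>)) = expectation (\<lambda>\<omega>. Re (iexp \<theta> * iexp (Y \<omega>)))"
      by (simp add: cos_add Re_exp Im_exp mult.commute)
    also have "\<dots> = Re (expectation (\<lambda>\<omega>. iexp \<theta> * iexp (Y \<omega>)))"
      using int by (rule integral_Re)
    also have "\<dots> = cos \<theta> * exp (- ip M Y Y / 2)"
      by (simp add: E ipY Re_exp)
    finally show ?thesis using \<open>Y \<in> L2 M\<close> by simp
  next
    \<comment> \<open>Degenerate law: the mean forces the constant to be 0, so both sides equal
      \<open>cos \<theta>\<close>.\<close>
    fix \<mu> assume [measurable]: "Y \<in> borel_measurable M" and "AE \<omega> in M. Y \<omega> = \<mu>"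
    then have "expectation Y = expectation (\<lambda>\<omega>. \<mu>)" by (intro integral_cong_AE) auto
    then have "\<mu> = 0" using assms(2) by (simp add: prob_space)
    with \<open>AE \<omega> in M. Y \<omega> = \<mu>\<close> have AE: "AE \<omega> in M. Y \<omega> = 0" by simp
    have "integrable M (\<lambda>\<omega>. (Y \<omega>)\<^sup>2) \<longleftrightarrow> integrable M (\<lambda>\<omega>. 0 :: real)"
      by (rule integrable_cong_AE) (use AE in auto)
    then have "Y \<in> L2 M" by (simp add: L2_def)
    have "ip M Y Y = (\<integral>\<omega>. 0 \<partial>M)" unfolding ip_self
      by (rule integral_cong_AE) (use AE in auto)
    moreover have "expectation (\<lambda>\<omega>. cos (Y \<omega> + \<theta>)) = expectation (\<lambda>\<omega>. cos \<theta>)"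
      by (rule integral_cong_AE) (use AE in auto)
    ultimately show ?thesis using \<open>Y \<in> L2 M\<close> by (simp add: prob_space)
  qed
  then show "Y \<in> L2 M" and "expectation (\<lambda>\<omega>. cos (Y \<omega> + \<theta>)) = cos \<theta> * exp (- ip M Y Y / 2)"
    by auto
qed

text \<open>The cosine is 1-Lipschitz, so mean-square convergence of the arguments gives L1
  convergence of the cosines, and a bounded weight preserves it.\<close>

lemma (in prob_space) expectation_cos_tendsto:
  assumes Y: "\<And>n. Y n \<in> L2 M" "L \<in> L2 M"
    and lim: "(\<lambda>n. sqdist M (Y n) L) \<longlonglongrightarrow> 0"
    and W: "W \<in> borel_measurable M" "\<And>\<omega>. \<bar>W \<omega>\<bar> \<le> K"
  shows "(\<lambda>n. expectation (\<lambda>\<omega>. cos (Y n \<omega> + \<theta>) * W \<omega>)) \<longlonglongrightarrow> expectation (\<lambda>\<omega>. cos (L \<omega> + \<theta>) * W \<omega>)"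
proof -
  have [measurable]: "Y n \<in> borel_measurable M" "L \<in> borel_measurable M" "W \<in> borel_measurable M" for n
    using Y W by (simp_all add: L2_measurable)
  have "0 \<le> K" using abs_ge_zero W(2) by (rule order_trans)
  have int: "integrable M (\<lambda>\<omega>. cos (Z \<omega> + \<theta>) * W \<omega>)" if [measurable]: "Z \<in> borel_measurable M" for Z
  proof (rule integrable_const_bound[where B = K])
    have "\<bar>cos (Z \<omega> + \<theta>)\<bar> * \<bar>W \<omega>\<bar> \<le> 1 * K" for \<omega>
      by (intro mult_mono W) auto
    then show "AE \<omega> in M. norm (cos (Z \<omega> + \<theta>) * W \<omega>) \<le> K" by (simp add: abs_mult)
  qed measurable
  have cos_lip: "\<bar>cos a - cos b\<bar> \<le> \<bar>a - b\<bar>" for a b :: real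
  proof -
    have "\<bar>sin ((a + b) / 2)\<bar> * \<bar>sin ((b - a) / 2)\<bar> \<le> 1 * \<bar>(b - a) / 2\<bar>"
      by (rule mult_mono[OF _ abs_sin_x_le_abs_x]) auto
    then show ?thesis unfolding cos_diff_cos by (simp add: abs_mult)
  qed
  have bound: "\<bar>expectation (\<lambda>\<omega>. cos (Y n \<omega> + \<theta>) * W \<omega>) - expectation (\<lambda>\<omega>. cos (L \<omega> + \<theta>) * W \<omega>)\<bar>
     \<le> K * sqrt (sqdist M (Y n) L)" for n
  proof -
    have D: "(\<lambda>\<omega>. Y n \<omega> - L \<omega>) \<in> L2 M" by (intro L2_diff Y)
    have "\<bar>expectation (\<lambda>\<omega>. cos (Y n \<omega> + \<theta>) * W \<omega>) - expectation (\<lambda>\<omega>. cos (L \<omega> + \<theta>) * W \<omega>)\<bar>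
      = \<bar>expectation (\<lambda>\<omega>. cos (Y n \<omega> + \<theta>) * W \<omega> - cos (L \<omega> + \<theta>) * W \<omega>)\<bar>"
      by (simp add: int)
    also have "\<dots> \<le> expectation (\<lambda>\<omega>. \<bar>cos (Y n \<omega> + \<theta>) * W \<omega> - cos (L \<omega> + \<theta>) * W \<omega>\<bar>)"
      by (rule integral_abs_bound)
    also have "\<dots> \<le> expectation (\<lambda>\<omega>. K * \<bar>Y n \<omega> - L \<omega>\<bar>)"
    proof (rule integral_mono)
      show "integrable M (\<lambda>\<omega>. K * \<bar>Y n \<omega> - L \<omega>\<bar>)"
        using L2_integrable[OF D] by simp
      fix \<omega>
      have "\<bar>cos (Y n \<omega> + \<theta>) - cos (L \<omega> + \<theta>)\<bar> * \<bar>W \<omega>\<bar> \<le> \<bar>Y n \<omega> - L \<omega>\<bar> * K"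
        using cos_lip[of "Y n \<omega> + \<theta>" "L \<omega> + \<theta>"] by (intro mult_mono W) auto
      then show "\<bar>cos (Y n \<omega> + \<theta>) * W \<omega> - cos (L \<omega> + \<theta>) * W \<omega>\<bar> \<le> K * \<bar>Y n \<omega> - L \<omega>\<bar>"
        unfolding left_diff_distrib[symmetric] abs_mult by (simp add: mult.commute)
    qed (auto intro!: integrable_abs int Bochner_Integration.integrable_diff)
    also have "\<dots> \<le> K * sqrt (sqdist M (Y n) L)"
      using abs_expectation_le_L2[OF D] \<open>0 \<le> K\<close> by (auto intro: mult_left_mono)
    finally show ?thesis .
  qed
  have lim0: "(\<lambda>n. K * sqrt (sqdist M (Y n) L)) \<longlonglongrightarrow> 0"
    using tendsto_mult_left[OF tendsto_real_sqrt[OF lim], of K] by simp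
  have "(\<lambda>n. expectation (\<lambda>\<omega>. cos (Y n \<omega> + \<theta>) * W \<omega>) - expectation (\<lambda>\<omega>. cos (L \<omega> + \<theta>) * W \<omega>)) \<longlonglongrightarrow> 0"
    by (rule Lim_null_comparison[OF always_eventually lim0]) (simp only: real_norm_def bound simp_thms)
  then show ?thesis by (simp add: LIM_zero_iff)
qed

section \<open>Finite linear combinations and their mean-square closure\<close>

locale gaussian_family = prob_space M for M :: "'a measure" +
  fixes X :: "nat \<Rightarrow> 'a \<Rightarrow> real"
  assumes rv_borel: "\<And>n. n \<ge> 1 \<Longrightarrow> X n \<in> borel_measurable M"
    and lincomb_normal: "\<And>F t. finite F \<Longrightarrow> F \<subseteq> {1..} \<Longrightarrow> normal_rv M (\<lambda>\<omega>. \<Sum>a\<in>F. t a * X a \<omega>)"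
    and centered: "\<And>n. n \<ge> 1 \<Longrightarrow> expectation (X n) = 0"
begin

definition lincomb :: "(nat \<Rightarrow> real) \<Rightarrow> nat set \<Rightarrow> 'a \<Rightarrow> real" where
  "lincomb t F \<omega> = (\<Sum>a\<in>F. t a * X a \<omega>)"

text \<open>The closure is encoded by approximation, so it is stable under almost sure equality
  within \<open>L2 M\<close>; for A = {} it consists of the almost surely vanishing
  functions.\<close>

definition cspan :: "nat set \<Rightarrow> ('a \<Rightarrow> real) set" where
  "cspan A = {Z \<in> L2 M. \<forall>e>0. \<exists>F t. finite F \<and> F \<subseteq> A \<and> sqdist M Z (lincomb t F) < e}"

lemma X_L2: "n \<ge> 1 \<Longrightarrow> X n \<in> L2 M"
  using normal_rv_L2_cos(1)[of "X n"] lincomb_normal[of "{n}" "\<lambda>_. 1"] centered[of n] by simp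

lemma lincomb_L2: "F \<subseteq> {1..} \<Longrightarrow> lincomb t F \<in> L2 M"
  unfolding lincomb_def by (intro L2_sum L2_cmult X_L2) auto

lemma lincomb_expand:
  assumes "finite G" "F \<subseteq> G"
  shows "lincomb t F = lincomb (\<lambda>a. if a \<in> F then t a else 0) G"
  unfolding lincomb_def
  by (rule ext, rule sum.mono_neutral_cong_left) (use assms in auto)

lemma lincomb_add:
  "finite G \<Longrightarrow> (\<lambda>\<omega>. lincomb t G \<omega> + lincomb s G \<omega>) = lincomb (\<lambda>a. t a + s a) G"
  unfolding lincomb_def by (simp add: sum.distrib distrib_right fun_eq_iff)

lemma lincomb_diff:
  "finite G \<Longrightarrow> (\<lambda>\<omega>. lincomb t G \<omega> - lincomb s G \<omega>) = lincomb (\<lambda>a. t a - s a) G"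
  unfolding lincomb_def by (simp add: sum_subtractf left_diff_distrib fun_eq_iff)

lemma lincomb_cmult: "(\<lambda>\<omega>. c * lincomb t G \<omega>) = lincomb (\<lambda>a. c * t a) G"
  unfolding lincomb_def by (simp add: sum_distrib_left mult.assoc)

lemma cspan_L2: "Z \<in> cspan A \<Longrightarrow> Z \<in> L2 M"
  by (simp add: cspan_def)

lemma cspan_mono: "A \<subseteq> B \<Longrightarrow> cspan A \<subseteq> cspan B"
  unfolding cspan_def by (fast dest: order_trans)

lemma lincomb_cspan: "finite F \<Longrightarrow> F \<subseteq> A \<Longrightarrow> A \<subseteq> {1..} \<Longrightarrow> lincomb t F \<in> cspan A"
proof -
  assume *: "finite F" "F \<subseteq> A" "A \<subseteq> {1..}"
  have "sqdist M (lincomb t F) (lincomb t F) = 0" by (simp add: ip_def)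
  then have "\<exists>G s. finite G \<and> G \<subseteq> A \<and> sqdist M (lincomb t F) (lincomb s G) < e" if "e > 0" for e
    using that *(1,2) by (intro exI[of _ F] exI[of _ t]) simp
  then show ?thesis
    unfolding cspan_def using * lincomb_L2[of F t] by blast
qed

lemma X_cspan: "a \<in> A \<Longrightarrow> A \<subseteq> {1..} \<Longrightarrow> X a \<in> cspan A"
  using lincomb_cspan[of "{a}" A "\<lambda>_. 1"] by (simp add: lincomb_def[abs_def])

lemma cspan_closed:
  assumes Z: "Z \<in> L2 M" and A: "A \<subseteq> {1..}" and app: "\<And>e. e > 0 \<Longrightarrow> \<exists>Y\<in>cspan A. sqdist M Z Y < e"
  shows "Z \<in> cspan A"
  unfolding cspan_def
proof (intro CollectI conjI Z allI impI)
  fix e :: real assume "e > 0"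
  \<comment> \<open>Two errors below e / 4, doubled by \<open>ip_triangle\<close>, stay below
    e.\<close>
  then obtain Y where Y: "Y \<in> cspan A" "sqdist M Z Y < e / 4"
    using app[of "e / 4"] by auto
  have "e / 4 > 0" using \<open>e > 0\<close> by simp
  with Y(1) obtain F t where F: "finite F" "F \<subseteq> A" "sqdist M Y (lincomb t F) < e / 4"
    unfolding cspan_def by blast
  have "sqdist M Z (lincomb t F) \<le> 2 * (sqdist M Z Y + sqdist M Y (lincomb t F))"
    by (rule ip_triangle[OF Z cspan_L2[OF Y(1)] lincomb_L2]) (use F A in auto)
  with Y F have "sqdist M Z (lincomb t F) < e" by argo
  with F show "\<exists>F t. finite F \<and> F \<subseteq> A \<and> sqdist M Z (lincomb t F) < e" by blast
qed

lemma cspan_add: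
  assumes Y: "Y \<in> cspan A" and Z: "Z \<in> cspan A" and A: "A \<subseteq> {1..}"
  shows "(\<lambda>\<omega>. Y \<omega> + Z \<omega>) \<in> cspan A"
proof (rule cspan_closed[OF _ A])
  show "(\<lambda>\<omega>. Y \<omega> + Z \<omega>) \<in> L2 M" by (rule L2_add[OF cspan_L2[OF Y] cspan_L2[OF Z]])
  fix e :: real assume "e > 0"
  then have "e / 4 > 0" by simp
  obtain F t where F: "finite F" "F \<subseteq> A" "sqdist M Y (lincomb t F) < e / 4"
    using Y \<open>e / 4 > 0\<close> unfolding cspan_def by blast
  obtain G s where G: "finite G" "G \<subseteq> A" "sqdist M Z (lincomb s G) < e / 4"
    using Z \<open>e / 4 > 0\<close> unfolding cspan_def by blast
  define W where "W = (\<lambda>\<omega>. lincomb t F \<omega> + lincomb s G \<omega>)"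
  have "W \<in> cspan A"
    unfolding W_def using F G A
    by (subst lincomb_expand[of "F \<union> G" F], simp, simp, subst lincomb_expand[of "F \<union> G" G], simp, simp,
        subst lincomb_add) (auto intro!: lincomb_cspan)
  moreover have "sqdist M (\<lambda>\<omega>. Y \<omega> + Z \<omega>) W \<le> 2 * (sqdist M Y (lincomb t F) + sqdist M Z (lincomb s G))"
  proof -
    have "(\<lambda>\<omega>. Y \<omega> + Z \<omega> - W \<omega>) = (\<lambda>\<omega>. (Y \<omega> - lincomb t F \<omega>) + (Z \<omega> - lincomb s G \<omega>))"
      by (simp add: W_def algebra_simps)
    then show ?thesis
      using ip_add_self_le[OF L2_diff[OF cspan_L2[OF Y] lincomb_L2] L2_diff[OF cspan_L2[OF Z] lincomb_L2], of F G t s]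
        F G A by auto
  qed
  ultimately show "\<exists>W\<in>cspan A. sqdist M (\<lambda>\<omega>. Y \<omega> + Z \<omega>) W < e"
    using F G by (intro bexI[of _ W]) argo+
qed

lemma cspan_cmult:
  assumes Y: "Y \<in> cspan A" and A: "A \<subseteq> {1..}"
  shows "(\<lambda>\<omega>. c * Y \<omega>) \<in> cspan A"
proof (rule cspan_closed[OF L2_cmult[OF cspan_L2[OF Y]] A])
  fix e :: real assume "e > 0"
  \<comment> \<open>The summand 1 avoids a separate case for c = 0.\<close>
  then have "e / (c\<^sup>2 + 1) > 0" by (simp add: add_nonneg_pos)
  then obtain F t where F: "finite F" "F \<subseteq> A" "sqdist M Y (lincomb t F) < e / (c\<^sup>2 + 1)"
    using Y unfolding cspan_def by blast
  have "sqdist M (\<lambda>\<omega>. c * Y \<omega>) (lincomb (\<lambda>a. c * t a) F) = c\<^sup>2 * sqdist M Y (lincomb t F)"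
    unfolding lincomb_cmult[symmetric] right_diff_distrib[symmetric]
    by (simp add: ip_cmult_left ip_cmult_right power2_eq_square)
  also have "\<dots> \<le> (c\<^sup>2 + 1) * sqdist M Y (lincomb t F)"
    by (intro mult_right_mono ip_self_nonneg) simp
  also have "\<dots> < e"
    using F(3) pos_less_divide_eq[of "c\<^sup>2 + 1"] by (simp add: add_nonneg_pos mult.commute)
  finally show "\<exists>W\<in>cspan A. sqdist M (\<lambda>\<omega>. c * Y \<omega>) W < e"
    using lincomb_cspan[OF F(1,2) A] by blast
qed

lemma cspan_diff:
  assumes "Y \<in> cspan A" "Z \<in> cspan A" "A \<subseteq> {1..}"
  shows "(\<lambda>\<omega>. Y \<omega> - Z \<omega>) \<in> cspan A"
  using cspan_add[OF assms(1) cspan_cmult[OF assms(2,3), of "-1"] assms(3)] by simp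

lemma cspan_zero: "(\<lambda>\<omega>. 0) \<in> cspan A"
proof -
  have "lincomb (\<lambda>_. 0) {} = (\<lambda>\<omega>. 0)" by (simp add: lincomb_def fun_eq_iff)
  moreover have "lincomb (\<lambda>_. 0) {} \<in> cspan {}" by (rule lincomb_cspan) auto
  ultimately show ?thesis using cspan_mono[of "{}" A] by auto
qed

lemma cspan_sum:
  assumes "\<And>i. i \<in> F \<Longrightarrow> Y i \<in> cspan A" "A \<subseteq> {1..}"
  shows "(\<lambda>\<omega>. \<Sum>i\<in>F. Y i \<omega>) \<in> cspan A"
  using assms(1)
proof (induction F rule: infinite_finite_induct)
  case (insert x F)
  have "(\<lambda>\<omega>. Y x \<omega> + (\<Sum>i\<in>F. Y i \<omega>)) \<in> cspan A"
    by (rule cspan_add[OF _ _ assms(2)]) (use insert in simp_all)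
  then show ?case using insert.hyps by simp
qed (simp_all add: cspan_zero)

text \<open>The exponent \<open>Suc n\<close> leaves room for \<open>ip_triangle\<close>:
  consecutive approximants are then within the \<open>(1/4)^n\<close> that
  \<open>L2_rapid_limit\<close> asks for.\<close>

lemma cspan_approx:
  assumes "Z \<in> cspan A" "A \<subseteq> {1..}"
  obtains F t where "\<And>n. finite (F n)" "\<And>n. F n \<subseteq> A" "\<And>n. sqdist M Z (lincomb (t n) (F n)) < (1/4)^(Suc n)"
proof -
  have "\<exists>F t. finite F \<and> F \<subseteq> A \<and> sqdist M Z (lincomb t F) < (1/4)^(Suc n)" for n
  proof -
    have "(0::real) < (1/4)^(Suc n)" by simp
    then show ?thesis using assms(1) unfolding cspan_def by blast
  qed
  then have "\<exists>F. \<forall>n. \<exists>t. finite (F n) \<and> F n \<subseteq> A \<and> sqdist M Z (lincomb t (F n)) < (1/4)^(Suc n)"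
    by (intro choice) blast
  then obtain F where "\<forall>n. \<exists>t. finite (F n) \<and> F n \<subseteq> A \<and> sqdist M Z (lincomb t (F n)) < (1/4)^(Suc n)"
    by blast
  from choice[OF this] show ?thesis using that by blast
qed

lemma quarter_power_tendsto: "(\<lambda>n. c * (1/4::real)^n) \<longlonglongrightarrow> 0"
  by (rule tendsto_mult_right_zero, rule LIMSEQ_power_zero) simp

lemma sqdist_tendsto_if_geometric:
  assumes "\<And>n. sqdist M (Z n) L \<le> c * (1/4)^n"
  shows "(\<lambda>n. sqdist M (Z n) L) \<longlonglongrightarrow> 0"
proof (rule tendsto_sandwich)
  show "\<forall>\<^sub>F n in sequentially. 0 \<le> sqdist M (Z n) L"
    by (intro always_eventually allI ip_self_nonneg)
  show "\<forall>\<^sub>F n in sequentially. sqdist M (Z n) L \<le> c * (1/4)^n"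
    by (intro always_eventually allI assms)
qed (rule tendsto_const quarter_power_tendsto)+

lemma cspan_approx_lim:
  assumes "Z \<in> cspan A" "A \<subseteq> {1..}"
  obtains F t where "\<And>n. finite (F n)" "\<And>n. F n \<subseteq> A" "(\<lambda>n. sqdist M (lincomb (t n) (F n)) Z) \<longlonglongrightarrow> 0"
proof -
  obtain F t where F: "\<And>n. finite (F n)" "\<And>n. F n \<subseteq> A" "\<And>n. sqdist M Z (lincomb (t n) (F n)) < (1/4)^(Suc n)"
    using cspan_approx[OF assms] by blast
  have "sqdist M (lincomb (t n) (F n)) Z \<le> (1/4) * (1/4)^n" for n
    using F(3)[of n] by (subst ip_diff_swap) simp
  from sqdist_tendsto_if_geometric[OF this] that F show ?thesis by blast
qed

text \<open>Both sides are continuous for \<open>sqdist\<close> and agree on finite combinations; so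
  every element of a closed span still behaves as a centred normal variable.\<close>

lemma cspan_cos:
  assumes "Z \<in> cspan A" "A \<subseteq> {1..}"
  shows "expectation (\<lambda>\<omega>. cos (Z \<omega> + \<theta>)) = cos \<theta> * exp (- ip M Z Z / 2)"
proof -
  obtain F t where F: "\<And>n. finite (F n)" "\<And>n. F n \<subseteq> A"
    and lim: "(\<lambda>n. sqdist M (lincomb (t n) (F n)) Z) \<longlonglongrightarrow> 0"
    using cspan_approx_lim[OF assms] by blast
  have F1: "F n \<subseteq> {1..}" for n using F assms by auto
  have L: "lincomb (t n) (F n) \<in> L2 M" for n by (rule lincomb_L2[OF F1])
  have zero: "expectation (lincomb (t n) (F n)) = 0" for n
    unfolding lincomb_def[abs_def] using F1[of n]
    by (subst Bochner_Integration.integral_sum)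
       (auto intro!: sum.neutral L2_integrable X_L2 simp: centered subset_iff)
  \<comment> \<open>The factor 1 is the weight W in \<open>expectation_cos_tendsto\<close>.\<close>
  have E: "expectation (\<lambda>\<omega>. cos (lincomb (t n) (F n) \<omega> + \<theta>) * 1)
     = cos \<theta> * exp (- ip M (lincomb (t n) (F n)) (lincomb (t n) (F n)) / 2)" for n
    using normal_rv_L2_cos(2)[OF _ zero[of n]] lincomb_normal[OF F(1)[of n] F1[of n], of "t n"]
    by (simp add: lincomb_def[abs_def])
  have "(\<lambda>n. expectation (\<lambda>\<omega>. cos (lincomb (t n) (F n) \<omega> + \<theta>) * 1)) \<longlonglongrightarrow> expectation (\<lambda>\<omega>. cos (Z \<omega> + \<theta>) * 1)"
    by (rule expectation_cos_tendsto[OF L cspan_L2[OF assms(1)] lim, where K = 1]) auto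
  moreover have "(\<lambda>n. cos \<theta> * exp (- ip M (lincomb (t n) (F n)) (lincomb (t n) (F n)) / 2))
     \<longlonglongrightarrow> cos \<theta> * exp (- ip M Z Z / 2)"
    by (intro tendsto_intros ip_self_tendsto[OF L cspan_L2[OF assms(1)] lim]) auto
  ultimately show ?thesis unfolding E by (simp add: LIMSEQ_unique)
qed

lemma perp_cspan:
  assumes Y: "Y \<in> L2 M" and D: "D \<subseteq> {1..}" and perp: "\<And>d. d \<in> D \<Longrightarrow> ip M Y (X d) = 0"
    and Z: "Z \<in> cspan D"
  shows "ip M Y Z = 0"
proof -
  obtain F t where F: "\<And>n. finite (F n)" "\<And>n. F n \<subseteq> D"
    and lim: "(\<lambda>n. sqdist M (lincomb (t n) (F n)) Z) \<longlonglongrightarrow> 0"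
    using cspan_approx_lim[OF Z D] by blast
  have F1: "F n \<subseteq> {1..}" for n using F D by auto
  have "ip M (lincomb (t n) (F n)) Y = 0" for n
    unfolding lincomb_def[abs_def] using F1[of n] F(2)[of n] perp
    by (subst ip_sum_left)
       (auto intro!: sum.neutral L2_cmult X_L2 Y simp: ip_cmult_left ip_commute[of M _ Y] subset_iff)
  moreover have "(\<lambda>n. ip M (lincomb (t n) (F n)) Y) \<longlonglongrightarrow> ip M Z Y"
    by (rule ip_tendsto_left[OF lincomb_L2[OF F1] cspan_L2[OF Z] Y lim])
  ultimately show ?thesis by (simp add: ip_commute LIMSEQ_const_iff)
qed

section \<open>Generated \<sigma>-algebras and measurable versions of span elements\<close>

lemma sigma_gen_space [simp]: "space (sigma_gen M X A) = space M"
  by (simp add: sigma_gen_def)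

lemma sigma_gen_component:
  assumes "a \<in> A"
  shows "X a \<in> borel_measurable (sigma_gen M X A)"
proof -
  have "(\<lambda>\<omega>. \<lambda>a\<in>A. X a \<omega>) \<in> sigma_gen M X A \<rightarrow>\<^sub>M (\<Pi>\<^sub>M a\<in>A. borel)"
    unfolding sigma_gen_def by (rule measurable_vimage_algebra1) (auto simp: space_PiM)
  from measurable_compose[OF this measurable_component_singleton[OF assms]]
  show ?thesis using assms by simp
qed

lemma sigma_gen_subset:
  assumes "space N = space M" "\<And>a. a \<in> A \<Longrightarrow> X a \<in> borel_measurable N"
  shows "sets (sigma_gen M X A) \<subseteq> sets N"
proof -
  have "(\<lambda>\<omega>. \<lambda>a\<in>A. X a \<omega>) \<in> N \<rightarrow>\<^sub>M (\<Pi>\<^sub>M a\<in>A. borel)"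
    by (rule measurable_restrict) (rule assms)
  then have "(\<lambda>\<omega>. \<lambda>a\<in>A. X a \<omega>) -` B \<inter> space N \<in> sets N" if "B \<in> sets (\<Pi>\<^sub>M a\<in>A. borel)" for B
    using that by (rule measurable_sets)
  then show ?thesis
    unfolding sigma_gen_def sets_vimage_algebra assms(1)[symmetric]
    by (intro sets.sigma_sets_subset) auto
qed

lemma sigma_gen_mono: "A \<subseteq> B \<Longrightarrow> sets (sigma_gen M X A) \<subseteq> sets (sigma_gen M X B)"
  by (rule sigma_gen_subset) (auto intro: sigma_gen_component)

lemma subalgebra_sigma_gen: "A \<subseteq> {1..} \<Longrightarrow> subalgebra M (sigma_gen M X A)"
  unfolding subalgebra_def using sigma_gen_subset[of M A] rv_borel by (auto simp: subset_iff)

lemma sigma_gen_borel_mono: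
  "f \<in> borel_measurable (sigma_gen M X A) \<Longrightarrow> A \<subseteq> B \<Longrightarrow> f \<in> borel_measurable (sigma_gen M X B)"
  using sigma_gen_mono[of A B] by (auto simp: measurable_def)

lemma sigma_gen_borel_M:
  "f \<in> borel_measurable (sigma_gen M X A) \<Longrightarrow> A \<subseteq> {1..} \<Longrightarrow> f \<in> borel_measurable M"
  using subalgebra_sigma_gen measurable_from_subalg by blast

text \<open>An element of the closed span is only a mean-square limit and need not itself be
  \<sigma>(X_A)-measurable. Rapidly converging finite combinations converge almost surely, and their
  pointwise \<open>lim\<close> is measurable.\<close>

lemma cspan_sigma_gen_version:
  assumes Z: "Z \<in> cspan A" and A: "A \<subseteq> {1..}"
  obtains Z' where "Z' \<in> borel_measurable (sigma_gen M X A)" "AE \<omega> in M. Z \<omega> = Z' \<omega>"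
proof -
  obtain F t where F: "\<And>n. finite (F n)" "\<And>n. F n \<subseteq> A" "\<And>n. sqdist M Z (lincomb (t n) (F n)) < (1/4)^(Suc n)"
    using cspan_approx[OF assms] by blast
  define Y where "Y n = lincomb (t n) (F n)" for n
  have Y: "Y n \<in> L2 M" for n
    unfolding Y_def by (rule lincomb_L2[OF order_trans[OF F(2) A]])
  have rapid: "sqdist M (Y (Suc n)) (Y n) \<le> (1/4)^n" for n
  proof -
    have "sqdist M (Y (Suc n)) (Y n) \<le> 2 * (sqdist M (Y (Suc n)) Z + sqdist M Z (Y n))"
      by (rule ip_triangle[OF Y cspan_L2[OF Z] Y])
    also have "sqdist M (Y (Suc n)) Z < (1/4)^(Suc (Suc n))"
      using F(3)[of "Suc n"] unfolding Y_def by (subst ip_diff_swap)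
    also have "sqdist M Z (Y n) < (1/4)^(Suc n)"
      using F(3)[of n] unfolding Y_def .
    finally show ?thesis by (simp add: field_simps)
  qed
  define L where "L = (\<lambda>\<omega>. lim (\<lambda>n. Y n \<omega>))"
  have L: "L \<in> L2 M" "sqdist M (Y n) L \<le> 4 * (1/4)^n" for n
    unfolding L_def using L2_rapid_limit[OF Y rapid] by auto
  \<comment> \<open>The triangle inequality yields the factor 2 * (1/4 + 4) = 8.5; its size is
    immaterial, since n is arbitrary.\<close>
  have "sqdist M Z L \<le> 10 * (1/4)^n" for n
  proof -
    have "sqdist M Z L \<le> 2 * (sqdist M Z (Y n) + sqdist M (Y n) L)"
      by (rule ip_triangle[OF cspan_L2[OF Z] Y L(1)])
    also have "\<dots> \<le> 2 * ((1/4)^(Suc n) + 4 * (1/4)^n)"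
      using F(3)[of n] L(2)[of n] unfolding Y_def by simp
    also have "\<dots> \<le> 10 * (1/4)^n" by simp
    finally show ?thesis .
  qed
  then have "sqdist M Z L \<le> 0"
    by (intro LIMSEQ_le_const[OF quarter_power_tendsto[of 10]]) auto
  then have "sqdist M Z L = 0" by (rule antisym[OF _ ip_self_nonneg])
  then have "AE \<omega> in M. Z \<omega> = L \<omega>"
    using ip_zero_AE[OF L2_diff[OF cspan_L2[OF Z] L(1)]] by simp
  moreover have "L \<in> borel_measurable (sigma_gen M X A)"
  proof -
    have [measurable]: "Y n \<in> borel_measurable (sigma_gen M X A)" for n
      unfolding Y_def lincomb_def[abs_def] using F(2)[of n]
      by (intro borel_measurable_sum borel_measurable_times borel_measurable_const sigma_gen_component) auto
    show ?thesis unfolding L_def by measurable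
  qed
  ultimately show ?thesis using that by blast
qed

section \<open>Orthogonal projection onto closed spans\<close>

lemma cspan_limit:
  assumes A: "A \<subseteq> {1..}" and Y: "\<And>n. Y n \<in> cspan A" and L: "L \<in> L2 M"
    and lim: "(\<lambda>n. sqdist M (Y n) L) \<longlonglongrightarrow> 0"
  shows "L \<in> cspan A"
proof (rule cspan_closed[OF L A])
  fix e :: real assume "e > 0"
  with lim have "\<forall>\<^sub>F n in sequentially. sqdist M (Y n) L < e" by (rule order_tendstoD)
  then obtain n where "sqdist M (Y n) L < e" by (auto simp: eventually_sequentially)
  with Y[of n] show "\<exists>Y\<in>cspan A. sqdist M L Y < e"
    by (subst ip_diff_swap) blast
qed

text \<open>The projection theorem: the parallelogram law makes a minimising sequence Cauchy, and
  completeness supplies the minimiser.\<close>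

lemma cspan_projection:
  assumes Y: "Y \<in> L2 M" and A: "A \<subseteq> {1..}"
  obtains Z where "Z \<in> cspan A" "\<And>W. W \<in> cspan A \<Longrightarrow> ip M (\<lambda>\<omega>. Y \<omega> - Z \<omega>) W = 0"
proof -
  define S where "S = (\<lambda>W. sqdist M Y W) ` cspan A"
  define d where "d = Inf S"
  have "S \<noteq> {}" unfolding S_def using cspan_zero by auto
  have bdd: "bdd_below S" unfolding S_def by (intro bdd_belowI2[of _ 0] ip_self_nonneg)
  have d_le: "d \<le> sqdist M Y W" if "W \<in> cspan A" for W
    unfolding d_def using that by (intro cInf_lower bdd) (auto simp: S_def)
  have "\<exists>W\<in>cspan A. sqdist M Y W < d + (1/4)^(Suc n)" for n
    using cInf_lessD[OF \<open>S \<noteq> {}\<close>, of "d + (1/4)^(Suc n)"] by (auto simp: S_def d_def)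
  then obtain W where W: "\<And>n. W n \<in> cspan A" "\<And>n. sqdist M Y (W n) < d + (1/4)^(Suc n)"
    by metis
  have W2: "W n \<in> L2 M" for n by (rule cspan_L2[OF W(1)])
  have rapid: "sqdist M (W (Suc n)) (W n) \<le> (1/4)^n" for n
  proof -
    \<comment> \<open>The midpoint of two approximants lies in the span, so its squared distance to
      Y is at least d; in the parallelogram law this leaves only the two small excesses for their
      mutual distance.\<close>
    define H where "H = (\<lambda>\<omega>. (1/2) * (W (Suc n) \<omega> + W n \<omega>))"
    have H: "H \<in> cspan A" unfolding H_def by (intro cspan_cmult cspan_add W A)
    define P where "P = (\<lambda>\<omega>. Y \<omega> - W n \<omega>)"
    define Q where "Q = (\<lambda>\<omega>. Y \<omega> - W (Suc n) \<omega>)"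
    have PQ: "P \<in> L2 M" "Q \<in> L2 M" unfolding P_def Q_def by (auto intro!: L2_diff Y W2)
    have "sqdist M (W (Suc n)) (W n) = ip M P P - 2 * ip M P Q + ip M Q Q"
      using ip_diff_self[OF PQ] by (simp add: P_def Q_def)
    moreover have "4 * sqdist M Y H = ip M P P + 2 * ip M P Q + ip M Q Q"
    proof -
      have "(\<lambda>\<omega>. P \<omega> + Q \<omega>) = (\<lambda>\<omega>. 2 * (Y \<omega> - H \<omega>))"
        by (simp add: P_def Q_def H_def fun_eq_iff algebra_simps)
      then show ?thesis
        using ip_add_self[OF PQ] by (simp only: ip_cmult_left ip_cmult_right)
    qed
    moreover have "d \<le> sqdist M Y H" by (rule d_le[OF H])
    moreover have "ip M P P < d + (1/4)^(Suc n)" unfolding P_def by (rule W)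
    moreover have "ip M Q Q < d + (1/4)^(Suc (Suc n))" unfolding Q_def by (rule W)
    ultimately have "sqdist M (W (Suc n)) (W n) \<le> 2 * (1/4)^(Suc n) + 2 * (1/4)^(Suc (Suc n))"
      by argo
    also have "\<dots> \<le> (1/4)^n" by simp
    finally show ?thesis .
  qed
  define Z where "Z = (\<lambda>\<omega>. lim (\<lambda>n. W n \<omega>))"
  have Z: "Z \<in> L2 M" "\<And>n. sqdist M (W n) Z \<le> 4 * (1/4)^n"
    unfolding Z_def using L2_rapid_limit[OF W2 rapid] by auto
  have lim: "(\<lambda>n. sqdist M (W n) Z) \<longlonglongrightarrow> 0"
    by (rule sqdist_tendsto_if_geometric[OF Z(2)])
  have ZA: "Z \<in> cspan A" by (rule cspan_limit[OF A W(1) Z(1) lim])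
  have "sqdist M Y Z \<le> d"
  proof (rule LIMSEQ_le)
    have "(\<lambda>n. sqdist M (\<lambda>\<omega>. W n \<omega> - Y \<omega>) (\<lambda>\<omega>. Z \<omega> - Y \<omega>)) \<longlonglongrightarrow> 0"
      using lim by simp
    from ip_self_tendsto[OF _ _ this] show "(\<lambda>n. sqdist M Y (W n)) \<longlonglongrightarrow> sqdist M Y Z"
      using Z Y W2 by (simp add: L2_diff ip_diff_swap[of M Y])
    show "(\<lambda>n. d + (1/4) * (1/4)^n) \<longlonglongrightarrow> d"
      using tendsto_add[OF tendsto_const quarter_power_tendsto, of d "1/4"] by simp
    show "\<exists>N. \<forall>n\<ge>N. sqdist M Y (W n) \<le> d + (1/4) * (1/4)^n"
      using W(2) by (auto intro: less_imp_le)
  qed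
  \<comment> \<open>First variation: moving the minimiser Z by - s V cannot decrease the distance,
    for any s.\<close>
  have "ip M (\<lambda>\<omega>. Y \<omega> - Z \<omega>) V = 0" if V: "V \<in> cspan A" for V
  proof (rule linear_coeff_zero_if_quadratic_nonneg[where a = "ip M V V"])
    fix s
    have V2: "V \<in> L2 M" by (rule cspan_L2[OF V])
    have "sqdist M Y Z \<le> sqdist M Y (\<lambda>\<omega>. Z \<omega> + - s * V \<omega>)"
      using \<open>sqdist M Y Z \<le> d\<close> d_le[OF cspan_add[OF ZA cspan_cmult[OF V A, of "- s"] A]] by (rule order_trans)
    also have "\<dots> = ip M (\<lambda>\<omega>. (Y \<omega> - Z \<omega>) + s * V \<omega>) (\<lambda>\<omega>. (Y \<omega> - Z \<omega>) + s * V \<omega>)"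
      by (simp add: algebra_simps)
    also have "\<dots> = sqdist M Y Z + 2 * ip M (\<lambda>\<omega>. Y \<omega> - Z \<omega>) (\<lambda>\<omega>. s * V \<omega>) + ip M (\<lambda>\<omega>. s * V \<omega>) (\<lambda>\<omega>. s * V \<omega>)"
      by (rule ip_add_self[OF L2_diff[OF Y Z(1)] L2_cmult[OF V2]])
    finally show "0 \<le> s\<^sup>2 * ip M V V + 2 * s * ip M (\<lambda>\<omega>. Y \<omega> - Z \<omega>) V"
      by (simp add: ip_cmult_left ip_cmult_right power2_eq_square algebra_simps)
  qed
  with ZA that show ?thesis by blast
qed

end

section \<open>Testing against trigonometric functions\<close>

context prob_space
begin

lemma integrable_bounded:
  assumes "f \<in> borel_measurable M" "\<And>\<omega>. \<bar>f \<omega> :: real\<bar> \<le> K"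
  shows "integrable M f"
  by (rule integrable_const_bound[where B = K]) (use assms in auto)

text \<open>Tilting \<open>M\<close> by the density \<open>1 + W / (K + 1)\<close> does not change the characteristic function of \<open>Z\<close>,
  hence does not change its law.\<close>

lemma cos_orthogonal_imp_indicator_orthogonal:
  fixes Z W :: "'a \<Rightarrow> real"
  assumes Z[measurable]: "Z \<in> borel_measurable M" and W[measurable]: "W \<in> borel_measurable M"
    and K: "\<And>\<omega>. \<bar>W \<omega>\<bar> \<le> K"
    and orth: "\<And>s \<theta>. expectation (\<lambda>\<omega>. cos (s * Z \<omega> + \<theta>) * W \<omega>) = 0"
    and B[measurable]: "B \<in> sets borel"
  shows "expectation (\<lambda>\<omega>. indicator B (Z \<omega>) * W \<omega>) = 0"
proof -
  \<comment> \<open>Small enough for 1 + c W to be nonnegative; adding 1 to K keeps the quotient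
    meaningful for K = 0.\<close>
  define c where "c = 1 / (K + 1)"
  have "0 \<le> K" using abs_ge_zero K by (rule order_trans)
  then have c: "c > 0" "c * K \<le> 1" by (auto simp: c_def field_simps)
  have pos: "0 \<le> 1 + c * W \<omega>" for \<omega>
  proof -
    have "c * (- K) \<le> c * W \<omega>" using c K[of \<omega>] by (intro mult_left_mono) auto
    then show ?thesis using c by simp
  qed
  have intW: "integrable M W" by (rule integrable_bounded[OF W K])
  define D where "D = density M (\<lambda>\<omega>. 1 + c * W \<omega>)"
  have EW: "expectation W = 0" using orth[of 0 0] by simp
  have "emeasure D (space D) = (\<integral>\<^sup>+\<omega>. ennreal (1 + c * W \<omega>) * indicator (space M) \<omega> \<partial>M)"
    unfolding D_def by (subst emeasure_density) auto
  also have "\<dots> = (\<integral>\<^sup>+\<omega>. ennreal (1 + c * W \<omega>) \<partial>M)"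
    by (rule nn_integral_cong) simp
  also have "\<dots> = ennreal (expectation (\<lambda>\<omega>. 1 + c * W \<omega>))"
    using intW by (intro nn_integral_eq_integral) (auto simp: pos)
  also have "expectation (\<lambda>\<omega>. 1 + c * W \<omega>) = 1"
    using intW by (simp add: EW prob_space)
  finally interpret D: prob_space D by (intro prob_spaceI) simp
  have [measurable]: "Z \<in> borel_measurable D" unfolding D_def by measurable
  have intD: "integral\<^sup>L D f = expectation (\<lambda>\<omega>. (1 + c * W \<omega>) *\<^sub>R f \<omega>)"
    if "f \<in> borel_measurable M" for f :: "'a \<Rightarrow> 'b::{banach, second_countable_topology}"
    unfolding D_def using that pos by (intro integral_density) auto
  have "char (distr D borel Z) t = char (distr M borel Z) t" for t
  proof -
    have i1: "integrable M (\<lambda>\<omega>. iexp (t * Z \<omega>))"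
      by (rule integrable_const_bound[where B = 1]) auto
    have i2: "integrable M (\<lambda>\<omega>. W \<omega> *\<^sub>R iexp (t * Z \<omega>))"
      by (rule integrable_const_bound[where B = K]) (auto simp: K)
    have "expectation (\<lambda>\<omega>. W \<omega> *\<^sub>R iexp (t * Z \<omega>)) = 0"
    proof (rule complex_eqI)
      have "Re (expectation (\<lambda>\<omega>. W \<omega> *\<^sub>R iexp (t * Z \<omega>))) = expectation (\<lambda>\<omega>. Re (W \<omega> *\<^sub>R iexp (t * Z \<omega>)))"
        using i2 by (rule integral_Re[symmetric])
      also have "\<dots> = 0"
        using orth[of t 0] by (simp add: Re_exp mult.commute)
      finally show "Re (expectation (\<lambda>\<omega>. W \<omega> *\<^sub>R iexp (t * Z \<omega>))) = Re 0" by simp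
      have "Im (expectation (\<lambda>\<omega>. W \<omega> *\<^sub>R iexp (t * Z \<omega>))) = expectation (\<lambda>\<omega>. Im (W \<omega> *\<^sub>R iexp (t * Z \<omega>)))"
        using i2 by (rule integral_Im[symmetric])
      \<comment> \<open>The phase \<open>- pi / 2\<close> turns the hypothesis on cosines into one
        on sines.\<close>
      also have "\<dots> = expectation (\<lambda>\<omega>. cos (t * Z \<omega> + (- pi / 2)) * W \<omega>)"
        by (simp add: Im_exp cos_diff mult.commute)
      also have "\<dots> = 0" by (rule orth)
      finally show "Im (expectation (\<lambda>\<omega>. W \<omega> *\<^sub>R iexp (t * Z \<omega>))) = Im 0" by simp
    qed
    then have "expectation (\<lambda>\<omega>. iexp (t * Z \<omega>) + c *\<^sub>R (W \<omega> *\<^sub>R iexp (t * Z \<omega>))) = expectation (\<lambda>\<omega>. iexp (t * Z \<omega>))"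
      by (subst Bochner_Integration.integral_add[OF i1 integrable_scaleR_right[OF i2]])
         (simp only: integral_scaleR_right scaleR_zero_right add_0_right)
    moreover have "char (distr D borel Z) t = expectation (\<lambda>\<omega>. (1 + c * W \<omega>) *\<^sub>R iexp (t * Z \<omega>))"
      unfolding char_def by (subst integral_distr, simp, simp, rule intD) measurable
    moreover have "char (distr M borel Z) t = expectation (\<lambda>\<omega>. iexp (t * Z \<omega>))"
      unfolding char_def by (subst integral_distr) auto
    ultimately show ?thesis by (simp add: scaleR_add_left)
  qed
  then have eq: "distr D borel Z = distr M borel Z"
    by (intro Levy_uniqueness D.real_distribution_distr real_distribution_distr) auto
  have "expectation (\<lambda>\<omega>. (1 + c * W \<omega>) *\<^sub>R (indicator B (Z \<omega>) :: real)) = (\<integral>\<omega>. indicator B (Z \<omega>) \<partial>D)"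
    by (subst intD) auto
  also have "\<dots> = (\<integral>x. indicator B x \<partial>distr D borel Z)"
    by (subst integral_distr) auto
  also have "\<dots> = expectation (\<lambda>\<omega>. indicator B (Z \<omega>))"
    unfolding eq by (subst integral_distr) auto
  finally have "expectation (\<lambda>\<omega>. indicator B (Z \<omega>) + c * (indicator B (Z \<omega>) * W \<omega>)) = expectation (\<lambda>\<omega>. indicator B (Z \<omega>))"
    unfolding real_scaleR_def by (simp add: algebra_simps)
  moreover have "integrable M (\<lambda>\<omega>. indicator B (Z \<omega>) :: real)"
    by (rule integrable_bounded[where K = 1]) (auto simp: indicator_def)
  moreover have "integrable M (\<lambda>\<omega>. indicator B (Z \<omega>) * W \<omega>)"
    by (rule integrable_bounded[where K = K]) (auto simp: indicator_def K \<open>0 \<le> K\<close>)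
  ultimately show ?thesis using c by simp
qed

text \<open>One coordinate at a time is passed from cosines to indicators. By the product-to-sum
  formula, W times a cosine of \<open>Z b\<close> is still orthogonal to the cosines over G, so the
  induction hypothesis, general in W, applies to it. The resulting product of indicators, times W,
  is orthogonal to all cosines of \<open>Z b\<close>, which is the one-dimensional case.\<close>

lemma cos_orthogonal_imp_box_orthogonal:
  fixes Z :: "'i \<Rightarrow> 'a \<Rightarrow> real"
  assumes "finite G" "\<And>b. b \<in> G \<Longrightarrow> Z b \<in> borel_measurable M" "\<And>b. b \<in> G \<Longrightarrow> I b \<in> sets borel"
    and "W \<in> borel_measurable M" "\<And>\<omega>. \<bar>W \<omega>\<bar> \<le> K"
    and "\<And>t \<theta>. expectation (\<lambda>\<omega>. cos ((\<Sum>b\<in>G. t b * Z b \<omega>) + \<theta>) * W \<omega>) = 0"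
  shows "expectation (\<lambda>\<omega>. (\<Prod>b\<in>G. indicator (I b) (Z b \<omega>)) * W \<omega>) = 0"
  using assms
proof (induction G arbitrary: W rule: finite_induct)
  case empty
  from empty.prems(5)[of _ 0] show ?case by simp
next
  case (insert b G)
  note W[measurable] = insert.prems(3) and K = insert.prems(4)
  have Zb[measurable]: "Z b \<in> borel_measurable M" using insert.prems(1) by simp
  have ZG: "Z a \<in> borel_measurable M" if "a \<in> G" for a using insert.prems(1) that by simp
  have IG: "I a \<in> sets borel" if "a \<in> G" for a using insert.prems(2) that by simp
  have SG[measurable]: "(\<lambda>\<omega>. \<Sum>a\<in>G. t a * Z a \<omega>) \<in> borel_measurable M" for t
    by (intro borel_measurable_sum borel_measurable_times ZG) auto
  have PG[measurable]: "(\<lambda>\<omega>. \<Prod>a\<in>G. indicator (I a) (Z a \<omega>) :: real) \<in> borel_measurable M"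
    by (intro borel_measurable_prod measurable_compose[OF ZG]) (auto intro: borel_measurable_indicator IG)
  have "0 \<le> K" using abs_ge_zero K by (rule order_trans)
  have bcos: "\<bar>cos x * W \<omega>\<bar> \<le> K" for x :: real and \<omega>
    using mult_mono[OF abs_cos_le_one[of x] K[of \<omega>]] by (simp add: abs_mult)
  have Pbound: "\<bar>(\<Prod>a\<in>G. indicator (I a) (Z a \<omega>) :: real) * W \<omega>\<bar> \<le> K" for \<omega>
  proof -
    have "\<bar>\<Prod>a\<in>G. indicator (I a) (Z a \<omega>) :: real\<bar> \<le> 1"
      unfolding abs_prod by (intro prod_le_1) (auto simp: indicator_def)
    from mult_mono[OF this K] show ?thesis by (simp add: abs_mult)
  qed
  have "expectation (\<lambda>\<omega>. (\<Prod>a\<in>G. indicator (I a) (Z a \<omega>)) * (cos (s * Z b \<omega> + \<phi>) * W \<omega>)) = 0" for s \<phi>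
  proof (rule insert.IH)
    fix t \<theta>
    have int: "integrable M (\<lambda>\<omega>. cos ((\<Sum>a\<in>G. t a * Z a \<omega>) + u * Z b \<omega> + v) * W \<omega>)" for u v
      by (rule integrable_bounded[where K = K]) (auto intro: bcos)
    have z: "expectation (\<lambda>\<omega>. cos ((\<Sum>a\<in>G. t a * Z a \<omega>) + u * Z b \<omega> + v) * W \<omega>) = 0" for u v
    proof -
      \<comment> \<open>The hypothesis for \<open>insert b G\<close>, taken at
        \<open>t(b := u)\<close>, leaves the coefficient u of the new coordinate free.\<close>
      have "(\<Sum>a\<in>insert b G. (t(b := u)) a * Z a \<omega>) = u * Z b \<omega> + (\<Sum>a\<in>G. t a * Z a \<omega>)" for \<omega>
        using insert.hyps by (simp cong: sum.cong) (intro sum.cong, auto)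
      then show ?thesis using insert.prems(5)[of "t(b := u)" v] by (simp add: add_ac)
    qed
    have "cos ((\<Sum>a\<in>G. t a * Z a \<omega>) + \<theta>) * (cos (s * Z b \<omega> + \<phi>) * W \<omega>) =
      (1/2) * (cos ((\<Sum>a\<in>G. t a * Z a \<omega>) + s * Z b \<omega> + (\<theta> + \<phi>)) * W \<omega>
            + cos ((\<Sum>a\<in>G. t a * Z a \<omega>) + (- s) * Z b \<omega> + (\<theta> - \<phi>)) * W \<omega>)" for \<omega>
    proof -
      have "cos x * cos y = (1/2) * (cos (x + y) + cos (x - y))" for x y :: real
        by (simp add: cos_add cos_diff)
      from this[of "(\<Sum>a\<in>G. t a * Z a \<omega>) + \<theta>" "s * Z b \<omega> + \<phi>"] show ?thesis
        by (simp add: algebra_simps)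
    qed
    then show "expectation (\<lambda>\<omega>. cos ((\<Sum>a\<in>G. t a * Z a \<omega>) + \<theta>) * (cos (s * Z b \<omega> + \<phi>) * W \<omega>)) = 0"
      using int z by (simp only: integral_mult_right_zero Bochner_Integration.integral_add) simp
  qed (use ZG IG bcos in auto)
  then have "expectation (\<lambda>\<omega>. cos (s * Z b \<omega> + \<phi>) * ((\<Prod>a\<in>G. indicator (I a) (Z a \<omega>)) * W \<omega>)) = 0" for s \<phi>
    by (simp add: mult_ac)
  from cos_orthogonal_imp_indicator_orthogonal[OF Zb _ Pbound this, of "I b"] insert.prems(2)
  have "expectation (\<lambda>\<omega>. indicator (I b) (Z b \<omega>) * ((\<Prod>a\<in>G. indicator (I a) (Z a \<omega>)) * W \<omega>)) = 0"
    by simp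
  then show ?case using insert.hyps by (simp add: mult.assoc)
qed

text \<open>Orthogonality to all events of F says that the conditional expectation of W given F
  vanishes almost surely; a bounded F-measurable f does not distinguish W from it.\<close>

lemma orthogonal_to_bounded:
  fixes f W :: "'a \<Rightarrow> real"
  assumes F: "subalgebra M F" and W[measurable]: "W \<in> borel_measurable M" and K: "\<And>\<omega>. \<bar>W \<omega>\<bar> \<le> K"
    and orth: "\<And>E. E \<in> sets F \<Longrightarrow> expectation (\<lambda>\<omega>. indicator E \<omega> * W \<omega>) = 0"
    and f: "f \<in> borel_measurable F" and L: "\<And>\<omega>. \<bar>f \<omega>\<bar> \<le> L"
  shows "expectation (\<lambda>\<omega>. f \<omega> * W \<omega>) = 0"
proof -
  interpret finite_measure_subalgebra M F
    by unfold_locales (rule F)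
  have fM[measurable]: "f \<in> borel_measurable M" using measurable_from_subalg[OF F f] .
  have "AE \<omega> in M. real_cond_exp M F W \<omega> = 0"
    by (rule real_cond_exp_charact)
       (auto simp: set_lebesgue_integral_def orth integrable_bounded[OF W K])
  then have "expectation (\<lambda>\<omega>. f \<omega> * real_cond_exp M F W \<omega>) = expectation (\<lambda>\<omega>. 0)"
    by (intro integral_cong_AE) auto
  moreover have "integrable M (\<lambda>\<omega>. f \<omega> * W \<omega>)"
  proof (rule integrable_bounded)
    show "\<bar>f \<omega> * W \<omega>\<bar> \<le> L * K" for \<omega>
      unfolding abs_mult by (rule mult_mono[OF L K order_trans[OF abs_ge_zero L]]) simp
  qed measurable
  ultimately show ?thesis using real_cond_exp_intg(2)[OF _ f W] by simp
qed

end

section \<open>From finite combinations to the \<sigma>-algebra of an infinite family\<close>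

context gaussian_family
begin

lemma cspan_borel: "Z \<in> cspan A \<Longrightarrow> Z \<in> borel_measurable M"
  using cspan_L2 L2_measurable by blast

text \<open>The tilting argument again, now for the law of the whole vector X_A on the product
  space. The box lemma shows that the tilted and the original law agree on finite-dimensional
  cylinders; hence they agree on every measurable set, even for infinite A, and every event of
  \<sigma>(X_A) is the preimage of such a set.\<close>

lemma cos_orthogonal_imp_sigma_gen_orthogonal:
  assumes A: "A \<subseteq> {1..}" and W[measurable]: "W \<in> borel_measurable M" and K: "\<And>\<omega>. \<bar>W \<omega>\<bar> \<le> K"
    and orth: "\<And>F t \<theta>. finite F \<Longrightarrow> F \<subseteq> A \<Longrightarrow> expectation (\<lambda>\<omega>. cos (lincomb t F \<omega> + \<theta>) * W \<omega>) = 0"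
    and f: "f \<in> borel_measurable (sigma_gen M X A)" and L: "\<And>\<omega>. \<bar>f \<omega>\<bar> \<le> L"
  shows "expectation (\<lambda>\<omega>. f \<omega> * W \<omega>) = 0"
proof (rule orthogonal_to_bounded[OF subalgebra_sigma_gen[OF A] W K _ f L])
  fix E assume E: "E \<in> sets (sigma_gen M X A)"
  let ?P = "\<Pi>\<^sub>M a\<in>A. (borel :: real measure)"
  let ?f = "\<lambda>\<omega>. \<lambda>a\<in>A. X a \<omega>"
  have XA: "X a \<in> borel_measurable M" if "a \<in> A" for a using A that rv_borel by auto
  have fm[measurable]: "?f \<in> M \<rightarrow>\<^sub>M ?P"
    by (rule measurable_restrict) (rule XA)
  obtain B where B[measurable]: "B \<in> sets ?P" and EB: "E = ?f -` B \<inter> space M"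
    using E unfolding sigma_gen_def by (subst (asm) sets_vimage_algebra2) (auto simp: space_PiM)
  define c where "c = 1 / (K + 1)"
  have "0 \<le> K" using abs_ge_zero K by (rule order_trans)
  then have c: "c > 0" "c * K \<le> 1" by (auto simp: c_def field_simps)
  have pos: "0 \<le> 1 + c * W \<omega>" for \<omega>
  proof -
    have "c * (- K) \<le> c * W \<omega>" using c K[of \<omega>] by (intro mult_left_mono) auto
    then show ?thesis using c by simp
  qed
  have intW: "integrable M W" by (rule integrable_bounded[OF W K])
  define D where "D = density M (\<lambda>\<omega>. 1 + c * W \<omega>)"
  have [measurable]: "?f \<in> D \<rightarrow>\<^sub>M ?P" unfolding D_def by measurable
  have em: "emeasure (distr D ?P ?f) S = ennreal (expectation (\<lambda>\<omega>. indicator S (?f \<omega>) * (1 + c * W \<omega>)))"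
    if S[measurable]: "S \<in> sets ?P" for S
  proof -
    have "emeasure (distr D ?P ?f) S = (\<integral>\<^sup>+\<omega>. ennreal (1 + c * W \<omega>) * indicator (?f -` S \<inter> space M) \<omega> \<partial>M)"
      by (subst emeasure_distr, simp, simp, unfold D_def, subst emeasure_density) auto
    also have "\<dots> = (\<integral>\<^sup>+\<omega>. ennreal (indicator S (?f \<omega>) * (1 + c * W \<omega>)) \<partial>M)"
      by (intro nn_integral_cong) (auto simp: indicator_def)
    also have "\<dots> = ennreal (expectation (\<lambda>\<omega>. indicator S (?f \<omega>) * (1 + c * W \<omega>)))"
    proof (rule nn_integral_eq_integral)
      show "integrable M (\<lambda>\<omega>. indicator S (?f \<omega>) * (1 + c * W \<omega>))"
      proof (rule integrable_bounded)
        have "(\<lambda>\<omega>. indicator S (?f \<omega>) :: real) \<in> borel_measurable M"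
          using measurable_compose[OF fm borel_measurable_indicator[OF S]] .
        then show "(\<lambda>\<omega>. indicator S (?f \<omega>) * (1 + c * W \<omega>)) \<in> borel_measurable M"
          by (intro borel_measurable_times borel_measurable_add W borel_measurable_const)
        fix \<omega>
        have "1 + c * W \<omega> \<le> 1 + c * K"
          using c K[of \<omega>] by (intro add_left_mono mult_left_mono) auto
        then show "\<bar>indicator S (?f \<omega>) * (1 + c * W \<omega>)\<bar> \<le> 1 + c * K"
          using pos[of \<omega>] by (auto simp: indicator_def)
      qed
    qed (auto simp: pos)
    finally show ?thesis .
  qed
  have int: "integrable M (\<lambda>\<omega>. indicator S (?f \<omega>) * W \<omega>)" "integrable M (\<lambda>\<omega>. indicator S (?f \<omega>) :: real)"
    if [measurable]: "S \<in> sets ?P" for S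
  proof -
    have ind: "(\<lambda>\<omega>. indicator S (?f \<omega>) :: real) \<in> borel_measurable M"
      using measurable_compose[OF fm borel_measurable_indicator[OF that]] .
    show "integrable M (\<lambda>\<omega>. indicator S (?f \<omega>) * W \<omega>)"
      by (rule integrable_bounded[OF borel_measurable_times[OF ind W], where K = K])
         (auto simp: indicator_def K \<open>0 \<le> K\<close>)
    show "integrable M (\<lambda>\<omega>. indicator S (?f \<omega>) :: real)"
      by (rule integrable_bounded[OF ind, where K = 1]) (auto simp: indicator_def)
  qed
  have expand: "expectation (\<lambda>\<omega>. indicator S (?f \<omega>) * (1 + c * W \<omega>)) =
      expectation (\<lambda>\<omega>. indicator S (?f \<omega>)) + c * expectation (\<lambda>\<omega>. indicator S (?f \<omega>) * W \<omega>)"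
    if S: "S \<in> sets ?P" for S
  proof -
    have "expectation (\<lambda>\<omega>. indicator S (?f \<omega>) * (1 + c * W \<omega>)) =
      expectation (\<lambda>\<omega>. indicator S (?f \<omega>) + c * (indicator S (?f \<omega>) * W \<omega>))"
      by (simp add: algebra_simps)
    also have "\<dots> = expectation (\<lambda>\<omega>. indicator S (?f \<omega>)) + c * expectation (\<lambda>\<omega>. indicator S (?f \<omega>) * W \<omega>)"
      using int[OF S] by (subst Bochner_Integration.integral_add) auto
    finally show ?thesis .
  qed
  have em': "emeasure (distr M ?P ?f) S = ennreal (expectation (\<lambda>\<omega>. indicator S (?f \<omega>)))"
    if S[measurable]: "S \<in> sets ?P" for S
  proof -
    have "emeasure (distr M ?P ?f) S = (\<integral>\<^sup>+\<omega>. indicator (?f -` S \<inter> space M) \<omega> \<partial>M)"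
      by (subst emeasure_distr) auto
    also have "\<dots> = (\<integral>\<^sup>+\<omega>. ennreal (indicator S (?f \<omega>)) \<partial>M)"
      by (intro nn_integral_cong) (auto simp: indicator_def)
    also have "\<dots> = ennreal (expectation (\<lambda>\<omega>. indicator S (?f \<omega>)))"
      by (intro nn_integral_eq_integral int S) auto
    finally show ?thesis .
  qed
  have eq: "distr M ?P ?f = distr D ?P ?f"
  proof (rule measure_eqI_PiM_infinite)
    fix J S assume J: "finite J" "J \<subseteq> A" and S: "\<And>i. i \<in> J \<Longrightarrow> S i \<in> sets (borel :: real measure)"
    let ?S = "prod_emb A (\<lambda>_. borel :: real measure) J (Pi\<^sub>E J S)"
    have Sm: "?S \<in> sets ?P" using J S by (intro sets_PiM_I) auto
    \<comment> \<open>A cylinder over the finite set J becomes the product of indicators of the box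
      lemma.\<close>
    have ind: "indicator ?S (?f \<omega>) = (\<Prod>b\<in>J. indicator (S b) (X b \<omega>) :: real)" for \<omega>
    proof (cases "\<forall>b\<in>J. X b \<omega> \<in> S b")
      case True
      then have "?f \<omega> \<in> ?S" using J by (auto simp: prod_emb_iff PiE_iff extensional_def)
      then show ?thesis using True by simp
    next
      case False
      then have "?f \<omega> \<notin> ?S" using J by (auto simp: prod_emb_iff PiE_iff)
      moreover have "(\<Prod>b\<in>J. indicator (S b) (X b \<omega>) :: real) = 0"
        using J False by (intro prod_zero) (auto simp: indicator_def)
      ultimately show ?thesis by simp
    qed
    have "expectation (\<lambda>\<omega>. (\<Prod>b\<in>J. indicator (S b) (X b \<omega>)) * W \<omega>) = 0"
    proof (rule cos_orthogonal_imp_box_orthogonal[OF J(1) _ _ W K])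
      show "X b \<in> borel_measurable M" if "b \<in> J" for b using XA J that by auto
      show "expectation (\<lambda>\<omega>. cos ((\<Sum>b\<in>J. t b * X b \<omega>) + \<theta>) * W \<omega>) = 0" for t \<theta>
        using orth[OF J, of t \<theta>] by (simp add: lincomb_def)
    qed (rule S)
    then show "emeasure (distr M ?P ?f) ?S = emeasure (distr D ?P ?f) ?S"
      unfolding em[OF Sm] em'[OF Sm] expand[OF Sm] by (simp add: ind)
  qed (auto intro!: finite_measure_distr fm)
  have nn: "0 \<le> expectation (\<lambda>\<omega>. indicator B (?f \<omega>) * (1 + c * W \<omega>))"
    by (rule Bochner_Integration.integral_nonneg) (simp add: pos)
  have nn': "0 \<le> expectation (\<lambda>\<omega>. indicator B (?f \<omega>) :: real)"
    by (rule Bochner_Integration.integral_nonneg) simp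
  have "ennreal (expectation (\<lambda>\<omega>. indicator B (?f \<omega>) * (1 + c * W \<omega>))) = ennreal (expectation (\<lambda>\<omega>. indicator B (?f \<omega>)))"
    using arg_cong[OF eq, of "\<lambda>N. emeasure N B"] unfolding em[OF B] em'[OF B] by simp
  with nn nn' have "expectation (\<lambda>\<omega>. indicator B (?f \<omega>) * (1 + c * W \<omega>)) = expectation (\<lambda>\<omega>. indicator B (?f \<omega>))"
    by simp
  then have "expectation (\<lambda>\<omega>. indicator B (?f \<omega>) * W \<omega>) = 0"
    unfolding expand[OF B] using c by simp
  moreover have "expectation (\<lambda>\<omega>. indicator B (?f \<omega>) * W \<omega>) = expectation (\<lambda>\<omega>. indicator E \<omega> * W \<omega>)"
    unfolding EB by (intro Bochner_Integration.integral_cong) (auto simp: indicator_def)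
  ultimately show "expectation (\<lambda>\<omega>. indicator E \<omega> * W \<omega>) = 0" by simp
qed

end

section \<open>Conditional independence in a Gaussian family\<close>

context gaussian_family
begin

text \<open>Product-to-sum reduces this to \<open>cspan_cos\<close>. With both phases equal to
  \<open>- pi / 2\<close> the right-hand side compares the variances of V - S and V + S, which is
  how covariances are recovered from bounded functions.\<close>

lemma expectation_cos_cos:
  assumes S: "S \<in> cspan {1..}" and V: "V \<in> cspan {1..}"
  shows "expectation (\<lambda>\<omega>. cos (S \<omega> + \<phi>) * cos (V \<omega> + \<theta>)) =
    (cos (\<theta> + \<phi>) * exp (- ip M (\<lambda>\<omega>. V \<omega> + S \<omega>) (\<lambda>\<omega>. V \<omega> + S \<omega>) / 2)
     + cos (\<theta> - \<phi>) * exp (- ip M (\<lambda>\<omega>. V \<omega> - S \<omega>) (\<lambda>\<omega>. V \<omega> - S \<omega>) / 2)) / 2"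
proof -
  have [measurable]: "S \<in> borel_measurable M" "V \<in> borel_measurable M"
    using S V cspan_borel by auto
  have int: "integrable M (\<lambda>\<omega>. cos (V \<omega> + S \<omega> + (\<theta> + \<phi>)))" "integrable M (\<lambda>\<omega>. cos (V \<omega> - S \<omega> + (\<theta> - \<phi>)))"
    by (auto intro!: integrable_bounded[where K = 1])
  have "cos x * cos y = (cos (y + x) + cos (y - x)) / 2" for x y :: real
    by (simp add: cos_add cos_diff)
  from this[of "S \<omega> + \<phi>" "V \<omega> + \<theta>" for \<omega>]
  have "cos (S \<omega> + \<phi>) * cos (V \<omega> + \<theta>) = (cos (V \<omega> + S \<omega> + (\<theta> + \<phi>)) + cos (V \<omega> - S \<omega> + (\<theta> - \<phi>))) / 2" for \<omega>
    by (simp add: algebra_simps)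
  then have "expectation (\<lambda>\<omega>. cos (S \<omega> + \<phi>) * cos (V \<omega> + \<theta>)) =
     (expectation (\<lambda>\<omega>. cos (V \<omega> + S \<omega> + (\<theta> + \<phi>))) + expectation (\<lambda>\<omega>. cos (V \<omega> - S \<omega> + (\<theta> - \<phi>)))) / 2"
    using int by (simp only: integral_divide_zero Bochner_Integration.integral_add)
  also have "expectation (\<lambda>\<omega>. cos (V \<omega> + S \<omega> + (\<theta> + \<phi>))) =
      cos (\<theta> + \<phi>) * exp (- ip M (\<lambda>\<omega>. V \<omega> + S \<omega>) (\<lambda>\<omega>. V \<omega> + S \<omega>) / 2)"
    by (rule cspan_cos[OF cspan_add[OF V S]]) auto
  also have "expectation (\<lambda>\<omega>. cos (V \<omega> - S \<omega> + (\<theta> - \<phi>))) =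
      cos (\<theta> - \<phi>) * exp (- ip M (\<lambda>\<omega>. V \<omega> - S \<omega>) (\<lambda>\<omega>. V \<omega> - S \<omega>) / 2)"
    by (rule cspan_cos[OF cspan_diff[OF V S]]) auto
  finally show ?thesis .
qed

text \<open>Conditioning on \<open>\<sigma>(X\<^sub>D)\<close> replaces \<open>Y\<close> by its projection \<open>Z\<close>; the residual \<open>Y - Z\<close>, being
  independent of \<open>\<sigma>(X\<^sub>D)\<close>, only contributes the factor \<open>exp (- E (Y - Z)\<^sup>2 / 2)\<close>.\<close>

lemma expectation_cos_projection:
  assumes D: "D \<subseteq> {1..}" and Y: "Y \<in> cspan {1..}" and Z: "Z \<in> cspan D"
    and perp: "\<And>d. d \<in> D \<Longrightarrow> ip M (\<lambda>\<omega>. Y \<omega> - Z \<omega>) (X d) = 0"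
    and f: "f \<in> borel_measurable (sigma_gen M X D)" and L: "\<And>\<omega>. \<bar>f \<omega>\<bar> \<le> L"
  shows "expectation (\<lambda>\<omega>. f \<omega> * cos (Y \<omega> + \<theta>)) =
    exp (- sqdist M Y Z / 2) * expectation (\<lambda>\<omega>. f \<omega> * cos (Z \<omega> + \<theta>))"
proof -
  define c where "c = exp (- sqdist M Y Z / 2)"
  \<comment> \<open>The claim is that W is orthogonal to f; it suffices to test W against cosines of
    finite combinations over D.\<close>
  define W where "W \<omega> = cos (Y \<omega> + \<theta>) - c * cos (Z \<omega> + \<theta>)" for \<omega>
  have c: "0 < c" by (simp add: c_def)
  have Z1: "Z \<in> cspan {1..}" using Z cspan_mono[OF D] by auto
  have [measurable]: "Y \<in> borel_measurable M" "Z \<in> borel_measurable M"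
    using Y Z cspan_borel by auto
  have [measurable]: "f \<in> borel_measurable M" using f D by (rule sigma_gen_borel_M)
  have W[measurable]: "W \<in> borel_measurable M" unfolding W_def[abs_def] by measurable
  have bW: "\<bar>W \<omega>\<bar> \<le> 1 + c" for \<omega>
  proof -
    have "\<bar>W \<omega>\<bar> \<le> \<bar>cos (Y \<omega> + \<theta>)\<bar> + \<bar>c * cos (Z \<omega> + \<theta>)\<bar>" unfolding W_def by (rule abs_triangle_ineq4)
    also have "\<dots> \<le> 1 + c * 1" unfolding abs_mult using c by (intro add_mono mult_mono) auto
    finally show ?thesis by simp
  qed
  have "expectation (\<lambda>\<omega>. f \<omega> * W \<omega>) = 0"
  proof (rule cos_orthogonal_imp_sigma_gen_orthogonal[OF D W bW _ f L])
    fix F t \<phi> assume F: "finite F" "F \<subseteq> D"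
    define S where "S = lincomb t F"
    have SD: "S \<in> cspan D" unfolding S_def using F D by (rule lincomb_cspan)
    then have S: "S \<in> cspan {1..}" using cspan_mono[OF D] by auto
    have [measurable]: "S \<in> borel_measurable M" using S by (rule cspan_borel)
    \<comment> \<open>Pythagoras: Y - Z is orthogonal to Z + s S, so replacing Y by Z lowers the
      variance by the same amount for s = 1 and s = -1. After exponentiation this amount is the
      common factor c.\<close>
    have split: "ip M (\<lambda>\<omega>. Y \<omega> + s * S \<omega>) (\<lambda>\<omega>. Y \<omega> + s * S \<omega>) =
      sqdist M Y Z + ip M (\<lambda>\<omega>. Z \<omega> + s * S \<omega>) (\<lambda>\<omega>. Z \<omega> + s * S \<omega>)" for s
    proof -
      have T: "(\<lambda>\<omega>. Z \<omega> + s * S \<omega>) \<in> cspan D"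
        by (intro cspan_add[OF Z] cspan_cmult[OF SD] D)
      have YZ: "(\<lambda>\<omega>. Y \<omega> - Z \<omega>) \<in> L2 M"
        by (intro L2_diff cspan_L2[OF Y] cspan_L2[OF Z])
      have "ip M (\<lambda>\<omega>. Y \<omega> - Z \<omega>) (\<lambda>\<omega>. Z \<omega> + s * S \<omega>) = 0"
        by (rule perp_cspan[OF YZ D perp T])
      with ip_add_self[OF YZ cspan_L2[OF T]] show ?thesis by simp
    qed
    have sp1: "ip M (\<lambda>\<omega>. Y \<omega> + S \<omega>) (\<lambda>\<omega>. Y \<omega> + S \<omega>) = sqdist M Y Z + ip M (\<lambda>\<omega>. Z \<omega> + S \<omega>) (\<lambda>\<omega>. Z \<omega> + S \<omega>)"
      using split[of 1] by simp
    have sp2: "sqdist M Y S = sqdist M Y Z + sqdist M Z S"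
      using split[of "-1"] by simp
    have ex: "exp (- (a + b) / 2) = exp (- a / 2) * exp (- b / 2)" for a b :: real
      by (simp add: exp_add[symmetric] add_divide_distrib diff_divide_distrib)
    have int: "integrable M (\<lambda>\<omega>. cos (S \<omega> + \<phi>) * cos (T \<omega> + \<theta>))" if [measurable]: "T \<in> borel_measurable M" for T
    proof (rule integrable_bounded)
      show "\<bar>cos (S \<omega> + \<phi>) * cos (T \<omega> + \<theta>)\<bar> \<le> 1 * 1" for \<omega>
        unfolding abs_mult by (intro mult_mono) auto
    qed measurable
    have "expectation (\<lambda>\<omega>. cos (S \<omega> + \<phi>) * W \<omega>) =
      expectation (\<lambda>\<omega>. cos (S \<omega> + \<phi>) * cos (Y \<omega> + \<theta>) - c * (cos (S \<omega> + \<phi>) * cos (Z \<omega> + \<theta>)))"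
      by (simp add: W_def algebra_simps)
    also have "\<dots> = expectation (\<lambda>\<omega>. cos (S \<omega> + \<phi>) * cos (Y \<omega> + \<theta>)) - c * expectation (\<lambda>\<omega>. cos (S \<omega> + \<phi>) * cos (Z \<omega> + \<theta>))"
      by (subst Bochner_Integration.integral_diff) (auto intro: int)
    also have "\<dots> = 0"
      unfolding expectation_cos_cos[OF S Y] expectation_cos_cos[OF S Z1] sp1 sp2 ex c_def
      by (simp add: field_simps)
    finally show "expectation (\<lambda>\<omega>. cos (lincomb t F \<omega> + \<phi>) * W \<omega>) = 0" by (simp add: S_def)
  qed
  moreover have int: "integrable M (\<lambda>\<omega>. f \<omega> * cos (T \<omega> + \<theta>))" if [measurable]: "T \<in> borel_measurable M" for T
  proof (rule integrable_bounded)
    show "\<bar>f \<omega> * cos (T \<omega> + \<theta>)\<bar> \<le> L * 1" for \<omega>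
      unfolding abs_mult by (rule mult_mono[OF L _ order_trans[OF abs_ge_zero L]]) auto
  qed measurable
  have "expectation (\<lambda>\<omega>. f \<omega> * W \<omega>) = expectation (\<lambda>\<omega>. f \<omega> * cos (Y \<omega> + \<theta>) - c * (f \<omega> * cos (Z \<omega> + \<theta>)))"
    by (simp add: W_def algebra_simps)
  also have "\<dots> = expectation (\<lambda>\<omega>. f \<omega> * cos (Y \<omega> + \<theta>)) - c * expectation (\<lambda>\<omega>. f \<omega> * cos (Z \<omega> + \<theta>))"
    by (subst Bochner_Integration.integral_diff) (auto intro: int)
  ultimately show ?thesis by (simp add: c_def)
qed

text \<open>Clipping to \<open>[0, 1]\<close> changes the conditional expectation on a null set only.\<close>

definition cprob :: "nat set \<Rightarrow> 'a set \<Rightarrow> 'a \<Rightarrow> real" where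
  "cprob C E \<omega> = max 0 (min 1 (real_cond_exp M (sigma_gen M X C) (indicator E) \<omega>))"

lemma cprob_measurable: "cprob C E \<in> borel_measurable (sigma_gen M X C)"
  unfolding cprob_def[abs_def] by measurable

lemma cprob_bounds: "0 \<le> cprob C E \<omega>" "cprob C E \<omega> \<le> 1"
  by (auto simp: cprob_def)

lemma abs_indicator_diff_cprob: "\<bar>indicator E' \<omega> - cprob C E \<omega>\<bar> \<le> 1"
  using cprob_bounds[of C E \<omega>] by (auto simp: indicator_def)

lemma cprob_AE:
  assumes C: "C \<subseteq> {1..}" and E[measurable]: "E \<in> sets M"
  shows "AE \<omega> in M. real_cond_exp M (sigma_gen M X C) (indicator E) \<omega> = cprob C E \<omega>"
proof -
  interpret finite_measure_subalgebra M "sigma_gen M X C"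
    by unfold_locales (rule subalgebra_sigma_gen[OF C])
  have int: "integrable M (indicator E :: _ \<Rightarrow> real)" by (rule integrable_bounded[where K = 1]) (auto simp: indicator_def)
  have "AE \<omega> in M. 0 \<le> real_cond_exp M (sigma_gen M X C) (indicator E) \<omega>"
    by (rule real_cond_exp_ge_c[OF int]) auto
  moreover have "AE \<omega> in M. real_cond_exp M (sigma_gen M X C) (indicator E) \<omega> \<le> 1"
    by (rule real_cond_exp_le_c[OF int]) (auto simp: indicator_def)
  ultimately show ?thesis by eventually_elim (simp add: cprob_def)
qed

lemma sigma_gen_sets_M: "C \<subseteq> {1..} \<Longrightarrow> E \<in> sets (sigma_gen M X C) \<Longrightarrow> E \<in> sets M"
  using subalgebra_sigma_gen by (auto simp: subalgebra_def)

lemma expectation_cprob: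
  assumes C: "C \<subseteq> {1..}" and E[measurable]: "E \<in> sets M"
    and f: "f \<in> borel_measurable (sigma_gen M X C)" and L: "\<And>\<omega>. \<bar>f \<omega>\<bar> \<le> L"
  shows "expectation (\<lambda>\<omega>. f \<omega> * cprob C E \<omega>) = expectation (\<lambda>\<omega>. f \<omega> * indicator E \<omega>)"
    and "expectation (\<lambda>\<omega>. f \<omega> * (indicator E \<omega> - cprob C E \<omega>)) = 0"
proof -
  interpret finite_measure_subalgebra M "sigma_gen M X C"
    by unfold_locales (rule subalgebra_sigma_gen[OF C])
  have [measurable]: "f \<in> borel_measurable M" "cprob C E \<in> borel_measurable M"
    using sigma_gen_borel_M[OF f C] sigma_gen_borel_M[OF cprob_measurable C] by auto
  have "0 \<le> L" using abs_ge_zero L by (rule order_trans)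
  have int: "integrable M (\<lambda>\<omega>. f \<omega> * indicator E \<omega>)"
    by (rule integrable_bounded[where K = L]) (auto simp: indicator_def L \<open>0 \<le> L\<close>)
  have int2: "integrable M (\<lambda>\<omega>. f \<omega> * cprob C E \<omega>)"
  proof (rule integrable_bounded)
    show "\<bar>f \<omega> * cprob C E \<omega>\<bar> \<le> L * 1" for \<omega>
      unfolding abs_mult using cprob_bounds[of C E \<omega>] by (intro mult_mono L) (auto simp: \<open>0 \<le> L\<close>)
  qed measurable
  have "expectation (\<lambda>\<omega>. f \<omega> * cprob C E \<omega>) = expectation (\<lambda>\<omega>. f \<omega> * real_cond_exp M (sigma_gen M X C) (indicator E) \<omega>)"
    by (rule integral_cong_AE) (use cprob_AE[OF C E] in auto)
  also have "\<dots> = expectation (\<lambda>\<omega>. f \<omega> * indicator E \<omega>)"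
    by (rule real_cond_exp_intg(2)[OF int f]) simp
  finally show *: "expectation (\<lambda>\<omega>. f \<omega> * cprob C E \<omega>) = expectation (\<lambda>\<omega>. f \<omega> * indicator E \<omega>)" .
  have "expectation (\<lambda>\<omega>. f \<omega> * (indicator E \<omega> - cprob C E \<omega>)) =
    expectation (\<lambda>\<omega>. f \<omega> * indicator E \<omega>) - expectation (\<lambda>\<omega>. f \<omega> * cprob C E \<omega>)"
    unfolding right_diff_distrib by (rule Bochner_Integration.integral_diff[OF int int2])
  then show "expectation (\<lambda>\<omega>. f \<omega> * (indicator E \<omega> - cprob C E \<omega>)) = 0" by (simp add: *)
qed

text \<open>The almost sure identity is integrated over events G of \<sigma>(X_C). This makes
  conditional independence a family of orthogonality relations, the shape in which indicators can be
  exchanged for trigonometric functions.\<close>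

lemma cond_indep_iff_orthogonal:
  assumes A: "A \<subseteq> {1..}" and B: "B \<subseteq> {1..}" and C: "C \<subseteq> {1..}"
  shows "cond_indep M X A B C \<longleftrightarrow>
    (\<forall>E1\<in>sets (sigma_gen M X A). \<forall>E2\<in>sets (sigma_gen M X B). \<forall>G\<in>sets (sigma_gen M X C).
      expectation (\<lambda>\<omega>. indicator G \<omega> * (indicator E1 \<omega> * (indicator E2 \<omega> - cprob C E2 \<omega>))) = 0)"
proof -
  interpret finite_measure_subalgebra M "sigma_gen M X C"
    by unfold_locales (rule subalgebra_sigma_gen[OF C])
  have "(AE \<omega> in M. real_cond_exp M (sigma_gen M X C) (indicator E1) \<omega> * real_cond_exp M (sigma_gen M X C) (indicator E2) \<omega>
       = real_cond_exp M (sigma_gen M X C) (indicator (E1 \<inter> E2)) \<omega>) \<longleftrightarrow>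
    (\<forall>G\<in>sets (sigma_gen M X C).
      expectation (\<lambda>\<omega>. indicator G \<omega> * (indicator E1 \<omega> * (indicator E2 \<omega> - cprob C E2 \<omega>))) = 0)"
    if E1: "E1 \<in> sets (sigma_gen M X A)" and E2: "E2 \<in> sets (sigma_gen M X B)" for E1 E2
  proof -
    have [measurable]: "E1 \<in> sets M" "E2 \<in> sets M"
      using E1 E2 A B sigma_gen_sets_M by auto
    then have E12[measurable]: "E1 \<inter> E2 \<in> sets M" by simp
    have [measurable]: "cprob C E \<in> borel_measurable M" for E
      using cprob_measurable C by (rule sigma_gen_borel_M)
    have V12: "(\<lambda>\<omega>. cprob C E1 \<omega> * cprob C E2 \<omega>) \<in> borel_measurable (sigma_gen M X C)"
      using cprob_measurable by (intro borel_measurable_times)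
    have bV: "\<bar>cprob C E \<omega>\<bar> \<le> 1" for E \<omega> using cprob_bounds[of C E \<omega>] by simp
    have bV12: "\<bar>cprob C E1 \<omega> * cprob C E2 \<omega>\<bar> \<le> 1" for \<omega>
      using mult_mono[OF bV[of E1 \<omega>] bV[of E2 \<omega>]] by (simp add: abs_mult)
    have step: "expectation (\<lambda>\<omega>. indicator G \<omega> * (indicator E1 \<omega> * (indicator E2 \<omega> - cprob C E2 \<omega>))) =
      expectation (\<lambda>\<omega>. indicator G \<omega> * indicator (E1 \<inter> E2) \<omega>) - expectation (\<lambda>\<omega>. indicator G \<omega> * (cprob C E1 \<omega> * cprob C E2 \<omega>))"
      if G: "G \<in> sets (sigma_gen M X C)" for G
    proof -
      have [measurable]: "G \<in> sets M" using C G by (rule sigma_gen_sets_M)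
      have i1: "integrable M (\<lambda>\<omega>. indicator G \<omega> * indicator (E1 \<inter> E2) \<omega> :: real)"
        by (rule integrable_bounded[where K = 1]) (auto simp: indicator_def)
      have i2: "integrable M (\<lambda>\<omega>. (indicator G \<omega> * cprob C E2 \<omega>) * indicator E1 \<omega>)"
        by (rule integrable_bounded[where K = 1]) (auto simp: indicator_def bV)
      have "expectation (\<lambda>\<omega>. indicator G \<omega> * (indicator E1 \<omega> * (indicator E2 \<omega> - cprob C E2 \<omega>))) =
        expectation (\<lambda>\<omega>. indicator G \<omega> * indicator (E1 \<inter> E2) \<omega> - (indicator G \<omega> * cprob C E2 \<omega>) * indicator E1 \<omega>)"
        by (intro Bochner_Integration.integral_cong) (auto simp: indicator_def)
      also have "\<dots> = expectation (\<lambda>\<omega>. indicator G \<omega> * indicator (E1 \<inter> E2) \<omega>)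
          - expectation (\<lambda>\<omega>. (indicator G \<omega> * cprob C E2 \<omega>) * indicator E1 \<omega>)"
        by (rule Bochner_Integration.integral_diff[OF i1 i2])
      \<comment> \<open>The weight in parentheses is \<sigma>(X_C)-measurable, so the indicator of
        E1 may be replaced by its conditional probability.\<close>
      also have "expectation (\<lambda>\<omega>. (indicator G \<omega> * cprob C E2 \<omega>) * indicator E1 \<omega>) =
         expectation (\<lambda>\<omega>. (indicator G \<omega> * cprob C E2 \<omega>) * cprob C E1 \<omega>)"
      proof (rule expectation_cprob(1)[OF C _ borel_measurable_times, symmetric])
        show "\<bar>indicator G \<omega> * cprob C E2 \<omega>\<bar> \<le> 1" for \<omega>
          using bV by (auto simp: indicator_def)
      qed (auto intro: cprob_measurable borel_measurable_indicator G)
      finally show ?thesis by (simp add: mult_ac)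
    qed
    have AE12: "AE \<omega> in M. real_cond_exp M (sigma_gen M X C) (indicator E1) \<omega> * real_cond_exp M (sigma_gen M X C) (indicator E2) \<omega>
       = cprob C E1 \<omega> * cprob C E2 \<omega>"
      using cprob_AE[OF C, of E1] cprob_AE[OF C, of E2] by (auto elim: AE_mp)
    show ?thesis
    proof
      assume AE: "AE \<omega> in M. real_cond_exp M (sigma_gen M X C) (indicator E1) \<omega> * real_cond_exp M (sigma_gen M X C) (indicator E2) \<omega>
       = real_cond_exp M (sigma_gen M X C) (indicator (E1 \<inter> E2)) \<omega>"
      show "\<forall>G\<in>sets (sigma_gen M X C).
        expectation (\<lambda>\<omega>. indicator G \<omega> * (indicator E1 \<omega> * (indicator E2 \<omega> - cprob C E2 \<omega>))) = 0"
      proof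
        fix G assume G: "G \<in> sets (sigma_gen M X C)"
        then have [measurable]: "G \<in> sets M" using C by (intro sigma_gen_sets_M)
        have "AE \<omega> in M. cprob C E1 \<omega> * cprob C E2 \<omega> = cprob C (E1 \<inter> E2) \<omega>"
          using AE AE12 cprob_AE[OF C E12] by eventually_elim simp
        then have "expectation (\<lambda>\<omega>. indicator G \<omega> * (cprob C E1 \<omega> * cprob C E2 \<omega>)) = expectation (\<lambda>\<omega>. indicator G \<omega> * cprob C (E1 \<inter> E2) \<omega>)"
          by (intro integral_cong_AE) auto
        also have "\<dots> = expectation (\<lambda>\<omega>. indicator G \<omega> * indicator (E1 \<inter> E2) \<omega>)"
          by (rule expectation_cprob(1)[OF C E12 borel_measurable_indicator[OF G] indicator_abs_le_1])
        finally show "expectation (\<lambda>\<omega>. indicator G \<omega> * (indicator E1 \<omega> * (indicator E2 \<omega> - cprob C E2 \<omega>))) = 0"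
          unfolding step[OF G] by simp
      qed
    next
      assume orth: "\<forall>G\<in>sets (sigma_gen M X C).
        expectation (\<lambda>\<omega>. indicator G \<omega> * (indicator E1 \<omega> * (indicator E2 \<omega> - cprob C E2 \<omega>))) = 0"
      \<comment> \<open>The product of the two conditional probabilities is \<sigma>(X_C)-measurable
        and has the integrals that characterise the conditional expectation of the
        intersection.\<close>
      have "AE \<omega> in M. real_cond_exp M (sigma_gen M X C) (indicator (E1 \<inter> E2)) \<omega> = cprob C E1 \<omega> * cprob C E2 \<omega>"
      proof (rule real_cond_exp_charact[OF _ _ _ V12])
        fix G assume G: "G \<in> sets (sigma_gen M X C)"
        show "(\<integral>\<omega>\<in>G. indicator (E1 \<inter> E2) \<omega> \<partial>M) = (\<integral>\<omega>\<in>G. (cprob C E1 \<omega> * cprob C E2 \<omega>) \<partial>M)"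
          using orth[rule_format, OF G] unfolding step[OF G] by (simp add: set_lebesgue_integral_def)
      next
        show "integrable M (indicator (E1 \<inter> E2) :: _ \<Rightarrow> real)"
          by (rule integrable_bounded[OF _ indicator_abs_le_1]) measurable
        show "integrable M (\<lambda>\<omega>. cprob C E1 \<omega> * cprob C E2 \<omega>)"
          by (rule integrable_bounded[OF _ bV12]) measurable
      qed
      with AE12 show "AE \<omega> in M. real_cond_exp M (sigma_gen M X C) (indicator E1) \<omega> * real_cond_exp M (sigma_gen M X C) (indicator E2) \<omega>
       = real_cond_exp M (sigma_gen M X C) (indicator (E1 \<inter> E2)) \<omega>"
        by eventually_elim simp
    qed
  qed
  then show ?thesis unfolding cond_indep_def by simp
qed

text \<open>Let U be the residual of X_a after projection onto the closed span of C. Conditional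
  independence splits off 1_E - P(E | X_C) for E in \<sigma>(X_B), and U is independent of
  \<sigma>(X_C) and symmetric; together these give E[1_E sin U] = 0. Then 1_E may be replaced by sin
  X_b, and a vanishing E[sin X_b sin U] forces U and X_b to be uncorrelated. Sines are used because
  X_b and U themselves are unbounded.\<close>

lemma cond_indep_imp_projection:
  assumes A: "A \<subseteq> {1..}" and B: "B \<subseteq> {1..}" and C: "C \<subseteq> {1..}"
    and ci: "cond_indep M X A B C" and a: "a \<in> A"
  obtains Z where "Z \<in> cspan C" "\<And>d. d \<in> B \<union> C \<Longrightarrow> ip M (\<lambda>\<omega>. X a \<omega> - Z \<omega>) (X d) = 0"
proof -
  have a1: "a \<ge> 1" using a A by auto
  obtain Z where Z: "Z \<in> cspan C" and perp: "\<And>V. V \<in> cspan C \<Longrightarrow> ip M (\<lambda>\<omega>. X a \<omega> - Z \<omega>) V = 0"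
    using cspan_projection[OF X_L2[OF a1] C] by blast
  obtain Z' where Z': "Z' \<in> borel_measurable (sigma_gen M X C)" and ZZ': "AE \<omega> in M. Z \<omega> = Z' \<omega>"
    using cspan_sigma_gen_version[OF Z C] by blast
  define U where "U = (\<lambda>\<omega>. X a \<omega> - Z \<omega>)"
  have Xa: "X a \<in> cspan {1..}" using a1 by (intro X_cspan) auto
  have Z1: "Z \<in> cspan {1..}" using Z cspan_mono[OF C] by auto
  have U1: "U \<in> cspan {1..}" unfolding U_def by (rule cspan_diff[OF Xa Z1]) simp
  have [measurable]: "X a \<in> borel_measurable M" "Z \<in> borel_measurable M" "U \<in> borel_measurable M" "Z' \<in> borel_measurable M"
    using Xa Z1 U1 cspan_borel sigma_gen_borel_M[OF Z' C] by auto
  \<comment> \<open>Subtracting 0 fits the form of \<open>expectation_cos_projection\<close>: the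
    projection of U onto the closed span of C is 0.\<close>
  have perpC: "ip M (\<lambda>\<omega>. U \<omega> - 0) (X d) = 0" if "d \<in> C" for d
    using perp[OF X_cspan[OF that C]] by (simp add: U_def)
  have sinb: "\<bar>sin x * w\<bar> \<le> 1" "\<bar>cos x * w\<bar> \<le> 1" if "\<bar>w\<bar> \<le> 1" for x w :: real
    using that mult_mono[OF abs_sin_le_one[of x] that] mult_mono[OF abs_cos_le_one[of x] that] by (simp_all add: abs_mult)
  have sinU: "expectation (\<lambda>\<omega>. indicator E \<omega> * sin (U \<omega>)) = 0" if E: "E \<in> sets (sigma_gen M X B)" for E
  proof -
    have [measurable]: "E \<in> sets M" using B E by (rule sigma_gen_sets_M)
    have [measurable]: "cprob C E \<in> borel_measurable M" using cprob_measurable C by (rule sigma_gen_borel_M)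
    define W where "W \<omega> = indicator E \<omega> - cprob C E \<omega>" for \<omega>
    have [measurable]: "W \<in> borel_measurable M" unfolding W_def[abs_def] by measurable
    have bW: "\<bar>W \<omega>\<bar> \<le> 1" for \<omega> unfolding W_def by (rule abs_indicator_diff_cprob)
    \<comment> \<open>From events to bounded functions, once for \<sigma>(X_A) and once for
      \<sigma>(X_C).\<close>
    have fgW: "expectation (\<lambda>\<omega>. g \<omega> * (f \<omega> * W \<omega>)) = 0"
      if f: "f \<in> borel_measurable (sigma_gen M X A)" "\<And>\<omega>. \<bar>f \<omega>\<bar> \<le> 1"
        and g: "g \<in> borel_measurable (sigma_gen M X C)" "\<And>\<omega>. \<bar>g \<omega>\<bar> \<le> 1" for f g
    proof (rule orthogonal_to_bounded[OF subalgebra_sigma_gen[OF C] _ _ _ g])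
      have [measurable]: "f \<in> borel_measurable M" using f(1) A by (rule sigma_gen_borel_M)
      show "(\<lambda>\<omega>. f \<omega> * W \<omega>) \<in> borel_measurable M" by measurable
      show "\<bar>f \<omega> * W \<omega>\<bar> \<le> 1" for \<omega>
        using mult_mono[OF f(2)[of \<omega>] bW[of \<omega>]] by (simp add: abs_mult)
      fix G assume G: "G \<in> sets (sigma_gen M X C)"
      then have [measurable]: "G \<in> sets M" using C by (intro sigma_gen_sets_M)
      have "expectation (\<lambda>\<omega>. f \<omega> * (indicator G \<omega> * W \<omega>)) = 0"
      proof (rule orthogonal_to_bounded[OF subalgebra_sigma_gen[OF A] _ _ _ f])
        show "\<bar>indicator G \<omega> * W \<omega>\<bar> \<le> 1" for \<omega> using bW by (auto simp: indicator_def)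
        fix E1 assume E1: "E1 \<in> sets (sigma_gen M X A)"
        show "expectation (\<lambda>\<omega>. indicator E1 \<omega> * (indicator G \<omega> * W \<omega>)) = 0"
          using ci E1 E G unfolding cond_indep_iff_orthogonal[OF A B C] W_def by (simp add: mult.left_commute)
      qed measurable
      then show "expectation (\<lambda>\<omega>. indicator G \<omega> * (f \<omega> * W \<omega>)) = 0" by (simp add: mult.left_commute)
    qed
    have mX: "X a \<in> borel_measurable (sigma_gen M X A)" by (rule sigma_gen_component[OF a])
    have i1: "integrable M (\<lambda>\<omega>. cos (Z' \<omega>) * (sin (X a \<omega>) * W \<omega>))"
      by (rule integrable_bounded[where K = 1]) (measurable, auto intro!: sinb bW)
    have i2: "integrable M (\<lambda>\<omega>. sin (Z' \<omega>) * (cos (X a \<omega>) * W \<omega>))"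
      by (rule integrable_bounded[where K = 1]) (measurable, auto intro!: sinb bW)
    \<comment> \<open>The addition formula separates X_a from the projection; the version Z' makes
      the second factor \<sigma>(X_C)-measurable.\<close>
    have "expectation (\<lambda>\<omega>. sin (U \<omega>) * W \<omega>) = expectation (\<lambda>\<omega>. sin (X a \<omega> - Z' \<omega>) * W \<omega>)"
      by (rule integral_cong_AE) (use ZZ' in \<open>auto simp: U_def\<close>)
    also have "\<dots> = expectation (\<lambda>\<omega>. cos (Z' \<omega>) * (sin (X a \<omega>) * W \<omega>) - sin (Z' \<omega>) * (cos (X a \<omega>) * W \<omega>))"
      by (simp add: sin_diff algebra_simps)
    also have "\<dots> = 0"
      using i1 i2 fgW[of "\<lambda>\<omega>. sin (X a \<omega>)" "\<lambda>\<omega>. cos (Z' \<omega>)"] fgW[of "\<lambda>\<omega>. cos (X a \<omega>)" "\<lambda>\<omega>. sin (Z' \<omega>)"] mX Z'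
      by simp
    finally have 1: "expectation (\<lambda>\<omega>. sin (U \<omega>) * W \<omega>) = 0" .
    \<comment> \<open>After projection the cosine is the constant \<open>cos (- pi / 2)\<close>,
      which is 0.\<close>
    have "expectation (\<lambda>\<omega>. cprob C E \<omega> * cos (U \<omega> + - pi / 2)) =
       exp (- sqdist M U (\<lambda>\<omega>. 0) / 2) * expectation (\<lambda>\<omega>. cprob C E \<omega> * cos (0 + - pi / 2))"
      by (rule expectation_cos_projection[OF C U1 cspan_zero perpC cprob_measurable, where L = 1])
         (use cprob_bounds[of C E] in auto)
    then have 2: "expectation (\<lambda>\<omega>. cprob C E \<omega> * sin (U \<omega>)) = 0" by (simp add: cos_diff)
    have i3: "integrable M (\<lambda>\<omega>. sin (U \<omega>) * W \<omega>)"
      by (rule integrable_bounded[where K = 1]) (measurable, auto intro!: sinb bW)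
    have i4: "integrable M (\<lambda>\<omega>. cprob C E \<omega> * sin (U \<omega>))"
      by (subst mult.commute, rule integrable_bounded[where K = 1])
         (measurable, use cprob_bounds[of C E] in \<open>auto intro!: sinb\<close>)
    have "expectation (\<lambda>\<omega>. indicator E \<omega> * sin (U \<omega>)) = expectation (\<lambda>\<omega>. sin (U \<omega>) * W \<omega> + cprob C E \<omega> * sin (U \<omega>))"
      by (simp add: W_def algebra_simps)
    also have "\<dots> = 0" using 1 2 i3 i4 by simp
    finally show ?thesis .
  qed
  have "ip M U (X b) = 0" if b: "b \<in> B" for b
  proof -
    have b1: "X b \<in> cspan {1..}" using b B by (intro X_cspan) auto
    have mb: "(\<lambda>\<omega>. sin (X b \<omega>)) \<in> borel_measurable (sigma_gen M X B)"
      using sigma_gen_component[OF b] by measurable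
    have "expectation (\<lambda>\<omega>. sin (X b \<omega>) * sin (U \<omega>)) = 0"
      by (rule orthogonal_to_bounded[OF subalgebra_sigma_gen[OF B] _ _ sinU mb, where L = 1 and K = 1]) auto
    then have "expectation (\<lambda>\<omega>. cos (X b \<omega> + - pi / 2) * cos (U \<omega> + - pi / 2)) = 0"
      by (simp add: cos_diff)
    \<comment> \<open>The exponentials occur with opposite signs, so their exponents
      coincide.\<close>
    then have "ip M (\<lambda>\<omega>. U \<omega> - X b \<omega>) (\<lambda>\<omega>. U \<omega> - X b \<omega>) = ip M (\<lambda>\<omega>. U \<omega> + X b \<omega>) (\<lambda>\<omega>. U \<omega> + X b \<omega>)"
      unfolding expectation_cos_cos[OF b1 U1] by simp
    then show ?thesis
      unfolding ip_diff_self[OF cspan_L2[OF U1] cspan_L2[OF b1]] ip_add_self[OF cspan_L2[OF U1] cspan_L2[OF b1]]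
      by simp
  qed
  then show ?thesis using that[OF Z] perpC unfolding U_def by auto
qed

text \<open>The weight W = 1_G (1_E2 - P(E2 | X_C)) is measurable for \<sigma>(X_B, X_C). Against W,
  a combination of X_A may therefore be replaced by its projection onto the closed span of B
  \<union> C. By hypothesis this lies in the closed span of C, and W is orthogonal to everything
  \<sigma>(X_C)-measurable.\<close>

lemma projection_imp_cond_indep:
  assumes A: "A \<subseteq> {1..}" and B: "B \<subseteq> {1..}" and C: "C \<subseteq> {1..}"
    and proj: "\<And>a. a \<in> A \<Longrightarrow> \<exists>Z\<in>cspan C. \<forall>d\<in>B \<union> C. ip M (\<lambda>\<omega>. X a \<omega> - Z \<omega>) (X d) = 0"
  shows "cond_indep M X A B C"
  unfolding cond_indep_iff_orthogonal[OF A B C]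
proof (intro ballI)
  fix E1 E2 G
  assume E1: "E1 \<in> sets (sigma_gen M X A)" and E2: "E2 \<in> sets (sigma_gen M X B)" and G: "G \<in> sets (sigma_gen M X C)"
  obtain P where P: "\<And>a. a \<in> A \<Longrightarrow> P a \<in> cspan C"
    and perp: "\<And>a d. a \<in> A \<Longrightarrow> d \<in> B \<union> C \<Longrightarrow> ip M (\<lambda>\<omega>. X a \<omega> - P a \<omega>) (X d) = 0"
    using proj by metis
  have BC: "B \<union> C \<subseteq> {1..}" using B C by simp
  have [measurable]: "E1 \<in> sets M" "E2 \<in> sets M" "G \<in> sets M"
    using sigma_gen_sets_M A B C E1 E2 G by auto
  have [measurable]: "cprob C E2 \<in> borel_measurable M" using cprob_measurable C by (rule sigma_gen_borel_M)
  define W where "W \<omega> = indicator G \<omega> * (indicator E2 \<omega> - cprob C E2 \<omega>)" for \<omega>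
  have WM: "W \<in> borel_measurable M" unfolding W_def[abs_def] by measurable
  have W: "W \<in> borel_measurable (sigma_gen M X (B \<union> C))"
  proof -
    have "E2 \<in> sets (sigma_gen M X (B \<union> C))" "G \<in> sets (sigma_gen M X (B \<union> C))"
      using E2 G sigma_gen_mono[of B "B \<union> C"] sigma_gen_mono[of C "B \<union> C"] by auto
    then show ?thesis unfolding W_def[abs_def]
      by (intro borel_measurable_times borel_measurable_diff borel_measurable_indicator
          sigma_gen_borel_mono[OF cprob_measurable]) auto
  qed
  have bW: "\<bar>W \<omega>\<bar> \<le> 1" for \<omega>
    unfolding W_def using abs_indicator_diff_cprob[of E2 \<omega> C E2] by (simp add: indicator_def)
  have "expectation (\<lambda>\<omega>. indicator E1 \<omega> * W \<omega>) = 0"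
  proof (rule cos_orthogonal_imp_sigma_gen_orthogonal[OF A WM bW, where L = 1])
    fix F t \<theta> assume F: "finite F" "F \<subseteq> A"
    \<comment> \<open>By linearity the projection of \<open>lincomb t F\<close>.\<close>
    define Z where "Z = (\<lambda>\<omega>. \<Sum>a\<in>F. t a * P a \<omega>)"
    have Z: "Z \<in> cspan C"
      unfolding Z_def using F P by (intro cspan_sum cspan_cmult C) auto
    then have ZBC: "Z \<in> cspan (B \<union> C)" using cspan_mono[of C "B \<union> C"] by auto
    have Y: "lincomb t F \<in> cspan {1..}" using F A by (intro lincomb_cspan) auto
    obtain Z' where Z': "Z' \<in> borel_measurable (sigma_gen M X C)" and ZZ': "AE \<omega> in M. Z \<omega> = Z' \<omega>"
      using cspan_sigma_gen_version[OF Z C] by blast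
    have [measurable]: "Z \<in> borel_measurable M" "Z' \<in> borel_measurable M"
      using cspan_borel[OF Z] sigma_gen_borel_M[OF Z' C] by auto
    have "expectation (\<lambda>\<omega>. W \<omega> * cos (lincomb t F \<omega> + \<theta>)) =
      exp (- sqdist M (lincomb t F) Z / 2) * expectation (\<lambda>\<omega>. W \<omega> * cos (Z \<omega> + \<theta>))"
    proof (rule expectation_cos_projection[OF BC Y ZBC _ W bW])
      fix d assume d: "d \<in> B \<union> C"
      have "(\<lambda>\<omega>. lincomb t F \<omega> - Z \<omega>) = (\<lambda>\<omega>. \<Sum>a\<in>F. t a * (X a \<omega> - P a \<omega>))"
        by (simp add: lincomb_def Z_def sum_subtractf right_diff_distrib fun_eq_iff)
      moreover have "ip M (\<lambda>\<omega>. \<Sum>a\<in>F. t a * (X a \<omega> - P a \<omega>)) (X d) = (\<Sum>a\<in>F. ip M (\<lambda>\<omega>. t a * (X a \<omega> - P a \<omega>)) (X d))"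
        using F A P d BC by (intro ip_sum_left L2_cmult L2_diff X_L2 cspan_L2[OF P]) auto
      moreover have "\<dots> = 0"
        using F d perp by (intro sum.neutral) (auto simp: ip_cmult_left)
      ultimately show "ip M (\<lambda>\<omega>. lincomb t F \<omega> - Z \<omega>) (X d) = 0" by simp
    qed
    also have "expectation (\<lambda>\<omega>. W \<omega> * cos (Z \<omega> + \<theta>)) = expectation (\<lambda>\<omega>. (indicator G \<omega> * cos (Z' \<omega> + \<theta>)) * (indicator E2 \<omega> - cprob C E2 \<omega>))"
      by (rule integral_cong_AE) (use ZZ' WM in \<open>auto simp: W_def mult_ac\<close>)
    also have "\<dots> = 0"
    proof (rule expectation_cprob(2)[OF C _ borel_measurable_times[OF borel_measurable_indicator[OF G]]])
      show "(\<lambda>\<omega>. cos (Z' \<omega> + \<theta>)) \<in> borel_measurable (sigma_gen M X C)"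
        using Z' by measurable
      show "\<bar>indicator G \<omega> * cos (Z' \<omega> + \<theta>)\<bar> \<le> 1" for \<omega>
        by (simp add: indicator_def)
    qed measurable
    finally show "expectation (\<lambda>\<omega>. cos (lincomb t F \<omega> + \<theta>) * W \<omega>) = 0" by (simp add: mult.commute)
  qed (rule borel_measurable_indicator[OF E1], rule indicator_abs_le_1)
  then show "expectation (\<lambda>\<omega>. indicator G \<omega> * (indicator E1 \<omega> * (indicator E2 \<omega> - cprob C E2 \<omega>))) = 0"
    by (simp add: W_def mult.left_commute)
qed

end

section \<open>Eigenvalue bounds and the Riesz property\<close>

text \<open>Vectors of length n are modelled as functions that vanish from n on. The sphere is then
  a closed subset of a product of intervals and singletons, which is compact by Tychonoff.\<close>

lemma compact_unit_sphere_lessThan: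
  "compact {t :: nat \<Rightarrow> real. (\<forall>i\<ge>n. t i = 0) \<and> (\<Sum>i<n. (t i)\<^sup>2) = 1}"
proof -
  define P where "P = PiE UNIV (\<lambda>i::nat. if i < n then {-1..1::real} else {0})"
  have "compactin (product_topology (\<lambda>_. euclidean) UNIV) P"
    unfolding P_def by (subst compactin_PiE) auto
  then have "compact P" by (simp add: euclidean_product_topology)
  moreover have "closed {t :: nat \<Rightarrow> real. (\<Sum>i<n. (t i)\<^sup>2) = 1}"
    by (intro closed_Collect_eq continuous_intros continuous_on_product_coordinates)
  ultimately have "compact (P \<inter> {t. (\<Sum>i<n. (t i)\<^sup>2) = 1})" by (rule compact_Int_closed)
  also have "P \<inter> {t. (\<Sum>i<n. (t i)\<^sup>2) = 1} = {t. (\<forall>i\<ge>n. t i = 0) \<and> (\<Sum>i<n. (t i)\<^sup>2) = 1}"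
  proof -
    have "\<bar>t i\<bar> \<le> 1" if "(\<Sum>i<n. (t i)\<^sup>2) = 1" "i < n" for t :: "nat \<Rightarrow> real" and i
    proof -
      have "(t i)\<^sup>2 \<le> (\<Sum>i<n. (t i)\<^sup>2)" using that by (intro member_le_sum) auto
      then show ?thesis using that by (simp add: abs_square_le_1)
    qed
    then show ?thesis unfolding P_def by (fastforce simp: PiE_iff abs_le_iff split: if_splits)
  qed
  finally show ?thesis .
qed

text \<open>Rayleigh's principle: k is the minimum of the form on the unit sphere, homogeneity
  extends the bound to all t, and the first variation at the minimiser v is the eigenvector
  equation.\<close>

lemma quadratic_form_minimum_eigenvector:
  fixes B :: "nat \<Rightarrow> nat \<Rightarrow> real"
  assumes n: "n > 0" and sym: "\<And>i j. i < n \<Longrightarrow> j < n \<Longrightarrow> B i j = B j i"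
  obtains v k where "(\<Sum>i<n. (v i)\<^sup>2) = 1" "\<And>i. i < n \<Longrightarrow> (\<Sum>j<n. B i j * v j) = k * v i"
    "\<And>t. k * (\<Sum>i<n. (t i)\<^sup>2) \<le> (\<Sum>i<n. \<Sum>j<n. t i * B i j * t j)"
proof -
  define q where "q t = (\<Sum>i<n. \<Sum>j<n. t i * B i j * t j)" for t :: "nat \<Rightarrow> real"
  define b where "b t w = (\<Sum>i<n. \<Sum>j<n. t i * B i j * w j)" for t w :: "nat \<Rightarrow> real"
  define S where "S = {t :: nat \<Rightarrow> real. (\<forall>i\<ge>n. t i = 0) \<and> (\<Sum>i<n. (t i)\<^sup>2) = 1}"
  have "compact S" unfolding S_def by (rule compact_unit_sphere_lessThan)
  moreover have "S \<noteq> {}"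
  proof -
    have "(\<Sum>i<n. (if i = 0 then 1 else 0 :: real)\<^sup>2) = (\<Sum>i<n. if i = 0 then 1 else 0)"
      by (intro sum.cong) auto
    then have "(\<lambda>i. if i = 0 then 1 else 0) \<in> S" unfolding S_def using n by auto
    then show ?thesis by auto
  qed
  moreover have "continuous_on S q"
    unfolding q_def
    by (intro continuous_intros continuous_on_subset[OF continuous_on_product_coordinates]) auto
  ultimately obtain v where v: "v \<in> S" "\<And>t. t \<in> S \<Longrightarrow> q v \<le> q t"
    using continuous_attains_inf by metis
  define k where "k = q v"
  have nv: "(\<Sum>i<n. (v i)\<^sup>2) = 1" using v by (simp add: S_def)
  have lower: "k * (\<Sum>i<n. (t i)\<^sup>2) \<le> q t" for t
  proof (cases "(\<Sum>i<n. (t i)\<^sup>2) = 0")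
    case True
    then have "\<forall>i<n. t i = 0" by (simp add: sum_nonneg_eq_0_iff)
    then have "q t = 0" unfolding q_def by simp
    with True show ?thesis by simp
  next
    case False
    define s where "s = (\<Sum>i<n. (t i)\<^sup>2)"
    have "s > 0" using False unfolding s_def by (simp add: less_le sum_nonneg)
    define r where "r = 1 / sqrt s"
    have r: "r\<^sup>2 * s = 1" using \<open>s > 0\<close> by (simp add: r_def power_divide)
    have "(\<lambda>i. if i < n then r * t i else 0) \<in> S"
      unfolding S_def using r by (simp add: power_mult_distrib s_def sum_distrib_left)
    then have "k \<le> q (\<lambda>i. if i < n then r * t i else 0)" unfolding k_def by (rule v)
    also have "\<dots> = (\<Sum>i<n. \<Sum>j<n. r\<^sup>2 * (t i * B i j * t j))"
      unfolding q_def by (intro sum.cong refl) (simp add: power2_eq_square)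
    also have "\<dots> = r\<^sup>2 * q t"
      unfolding q_def by (simp only: sum_distrib_left)
    finally have "k * s \<le> (r\<^sup>2 * q t) * s" using \<open>s > 0\<close> by (intro mult_right_mono) auto
    also have "\<dots> = q t" using r by (simp add: mult_ac)
    finally show ?thesis unfolding s_def .
  qed
  have b_sym: "b t w = b w t" for t w
    unfolding b_def by (subst sum.swap, intro sum.cong refl) (simp add: sym mult_ac)
  have expand: "q (\<lambda>i. v i + s * w i) = q v + 2 * s * b w v + s\<^sup>2 * q w" for s w
  proof -
    have "q (\<lambda>i. v i + s * w i) = q v + s * b v w + s * b w v + s\<^sup>2 * q w"
      unfolding q_def b_def sum_distrib_left sum.distrib[symmetric]
      by (intro sum.cong refl) (simp add: power2_eq_square algebra_simps)
    then show ?thesis by (simp add: b_sym[of v])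
  qed
  have crit: "b w v = k * (\<Sum>i<n. w i * v i)" for w
  proof -
    have "b w v - k * (\<Sum>i<n. w i * v i) = 0"
    proof (rule linear_coeff_zero_if_quadratic_nonneg[where a = "q w - k * (\<Sum>i<n. (w i)\<^sup>2)"])
      fix s
      have "(\<Sum>i<n. (v i + s * w i)\<^sup>2) = (\<Sum>i<n. (v i)\<^sup>2) + 2 * s * (\<Sum>i<n. w i * v i) + s\<^sup>2 * (\<Sum>i<n. (w i)\<^sup>2)"
        unfolding sum_distrib_left sum.distrib[symmetric]
        by (intro sum.cong refl) (simp add: power2_eq_square algebra_simps)
      with lower[of "\<lambda>i. v i + s * w i"] show
        "0 \<le> s\<^sup>2 * (q w - k * (\<Sum>i<n. (w i)\<^sup>2)) + 2 * s * (b w v - k * (\<Sum>i<n. w i * v i))"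
        unfolding expand nv k_def by (simp add: algebra_simps)
    qed
    then show ?thesis by simp
  qed
  have "(\<Sum>j<n. B i j * v j) = k * v i" if "i < n" for i
  proof -
    \<comment> \<open>Testing with the i-th unit vector isolates the i-th row.\<close>
    have "b (\<lambda>l. if l = i then 1 else 0) v = (\<Sum>l<n. if l = i then \<Sum>j<n. B i j * v j else 0)"
      unfolding b_def by (intro sum.cong refl) auto
    moreover have "(\<Sum>l<n. (if l = i then 1 else 0) * v l) = (\<Sum>l<n. if l = i then v i else 0)"
      by (intro sum.cong refl) auto
    ultimately show ?thesis using crit[of "\<lambda>l. if l = i then 1 else 0"] that by simp
  qed
  with nv lower that show ?thesis unfolding q_def by blast
qed

lemma eigenvalue_eq_nth_eigenvalue:
  assumes B: "B \<in> carrier_mat n n" and k: "eigenvalue B k"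
  shows "\<exists>i\<in>{1..n}. nth_eigenvalue i B = k"
proof -
  define xs where "xs = rev (sorted_list_of_multiset (proots (char_poly B)))"
  have "k \<in> set xs" using set_proots_char_poly[OF B] k by (simp add: xs_def)
  then obtain i where i: "i < length xs" "xs ! i = k" by (auto simp: in_set_conv_nth)
  have "length xs = size (proots (char_poly B))"
    by (metis xs_def length_rev size_mset mset_sorted_list_of_multiset)
  also have "\<dots> \<le> n" using size_proots_le[of "char_poly B"] degree_monic_char_poly[OF B] by simp
  \<comment> \<open>\<open>Suc i\<close>, because \<open>nth_eigenvalue\<close> counts from 1 and
    lists from 0.\<close>
  finally show ?thesis using i by (intro bexI[of _ "Suc i"]) (auto simp: nth_eigenvalue_def xs_def)
qed

lemma eigenvalue_matI:
  fixes B :: "nat \<Rightarrow> nat \<Rightarrow> real"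
  assumes "(\<Sum>i<n. (v i)\<^sup>2) = 1" "\<And>i. i < n \<Longrightarrow> (\<Sum>j<n. B i j * v j) = k * v i"
  shows "eigenvalue (Matrix.mat n n (\<lambda>(i, j). B i j)) k"
  unfolding eigenvalue_def eigenvector_def
proof (intro exI[of _ "Matrix.vec n v"] conjI)
  have "\<exists>i<n. v i \<noteq> 0"
  proof (rule ccontr)
    assume "\<not> (\<exists>i<n. v i \<noteq> 0)"
    then have "(\<Sum>i<n. (v i)\<^sup>2) = 0" by simp
    with assms(1) show False by simp
  qed
  then obtain i where "i < n" "v i \<noteq> 0" by blast
  then show "Matrix.vec n v \<noteq> 0\<^sub>v (dim_row (Matrix.mat n n (\<lambda>(i, j). B i j)))"
    by (metis dim_row_mat(1) index_vec index_zero_vec(1))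
  show "Matrix.mat n n (\<lambda>(i, j). B i j) *\<^sub>v Matrix.vec n v = k \<cdot>\<^sub>v Matrix.vec n v"
    by (rule eq_vecI) (simp_all add: scalar_prod_def assms(2) lessThan_atLeast0[symmetric])
qed simp

text \<open>The minimum of the form is an eigenvalue and hence above c; the upper bound is the same
  argument for the negated matrix.\<close>

lemma quadratic_form_bounds:
  fixes B :: "nat \<Rightarrow> nat \<Rightarrow> real"
  assumes sym: "\<And>i j. i < n \<Longrightarrow> j < n \<Longrightarrow> B i j = B j i"
    and ev: "\<And>i. i \<in> {1..n} \<Longrightarrow> c < nth_eigenvalue i (Matrix.mat n n (\<lambda>(i, j). B i j)) \<and>
       nth_eigenvalue i (Matrix.mat n n (\<lambda>(i, j). B i j)) < C"
  shows "c * (\<Sum>i<n. (t i)\<^sup>2) \<le> (\<Sum>i<n. \<Sum>j<n. t i * B i j * t j)"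
    and "(\<Sum>i<n. \<Sum>j<n. t i * B i j * t j) \<le> C * (\<Sum>i<n. (t i)\<^sup>2)"
proof -
  have bounds: "c < k \<and> k < C" if "eigenvalue (Matrix.mat n n (\<lambda>(i, j). B i j)) k" for k
    using eigenvalue_eq_nth_eigenvalue[OF mat_carrier that] ev by blast
  have sq: "0 \<le> (\<Sum>i<n. (t i)\<^sup>2)" by (simp add: sum_nonneg)
  show "c * (\<Sum>i<n. (t i)\<^sup>2) \<le> (\<Sum>i<n. \<Sum>j<n. t i * B i j * t j)"
  proof (cases "n = 0")
    case False
    then obtain v k where v: "(\<Sum>i<n. (v i)\<^sup>2) = 1" "\<And>i. i < n \<Longrightarrow> (\<Sum>j<n. B i j * v j) = k * v i"
      and low: "\<And>t. k * (\<Sum>i<n. (t i)\<^sup>2) \<le> (\<Sum>i<n. \<Sum>j<n. t i * B i j * t j)"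
      using quadratic_form_minimum_eigenvector[of n B] sym by blast
    have "c < k" using bounds[OF eigenvalue_matI[OF v]] by simp
    then have "c * (\<Sum>i<n. (t i)\<^sup>2) \<le> k * (\<Sum>i<n. (t i)\<^sup>2)" using sq by (intro mult_right_mono) auto
    then show ?thesis using low[of t] by linarith
  qed simp
  show "(\<Sum>i<n. \<Sum>j<n. t i * B i j * t j) \<le> C * (\<Sum>i<n. (t i)\<^sup>2)"
  proof (cases "n = 0")
    case False
    then obtain v k where v: "(\<Sum>i<n. (v i)\<^sup>2) = 1" "\<And>i. i < n \<Longrightarrow> (\<Sum>j<n. - B i j * v j) = k * v i"
      and low: "\<And>t. k * (\<Sum>i<n. (t i)\<^sup>2) \<le> (\<Sum>i<n. \<Sum>j<n. t i * - B i j * t j)"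
      using quadratic_form_minimum_eigenvector[of n "\<lambda>i j. - B i j"] sym by auto
    have "(\<Sum>j<n. B i j * v j) = (- k) * v i" if "i < n" for i
      using v(2)[OF that] by (simp add: sum_negf)
    then have "- k < C" using bounds[OF eigenvalue_matI[OF v(1)]] by blast
    then have "(- k) * (\<Sum>i<n. (t i)\<^sup>2) \<le> C * (\<Sum>i<n. (t i)\<^sup>2)" using sq by (intro mult_right_mono) auto
    moreover have "(\<Sum>i<n. \<Sum>j<n. t i * - B i j * t j) = - (\<Sum>i<n. \<Sum>j<n. t i * B i j * t j)"
      by (simp add: sum_negf)
    ultimately show ?thesis using low[of t] by linarith
  qed simp
qed

section \<open>Variances of finite combinations as quadratic forms\<close>

context gaussian_family
begin

lemma covariance_eq_ip: "i \<ge> 1 \<Longrightarrow> j \<ge> 1 \<Longrightarrow> covariance M (X i) (X j) = ip M (X i) (X j)"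
  by (simp add: covariance_def ip_def centered)

text \<open>The form of the covariance matrix at t is the variance of \<open>lincomb t F\<close>;
  the sorted enumeration of F translates between matrix positions and indices.\<close>

lemma ip_lincomb_bounds:
  assumes F: "finite F" "F \<subseteq> {1..}"
    and ev: "\<And>i. i \<in> {1..card F} \<Longrightarrow> c < nth_eigenvalue i (cov_matrix M X F) \<and> nth_eigenvalue i (cov_matrix M X F) < C"
  shows "c * (\<Sum>a\<in>F. (t a)\<^sup>2) \<le> ip M (lincomb t F) (lincomb t F)"
    and "ip M (lincomb t F) (lincomb t F) \<le> C * (\<Sum>a\<in>F. (t a)\<^sup>2)"
proof -
  define x where "x i = sorted_list_of_set F ! i" for i
  define n where "n = card F"
  have bij: "bij_betw x {..<n} F"
    using bij_betw_nth[of "sorted_list_of_set F" "{..<n}" F] F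
    by (simp add: x_def[abs_def] n_def)
  have x1: "x i \<ge> 1" if "i < n" for i using bij that F(2) by (auto simp: bij_betw_def)
  define B where "B i j = covariance M (X (x i)) (X (x j))" for i j
  have B: "B i j = ip M (X (x i)) (X (x j))" if "i < n" "j < n" for i j
    unfolding B_def using that x1 by (intro covariance_eq_ip) auto
  have mat: "cov_matrix M X F = Matrix.mat n n (\<lambda>(i, j). B i j)"
    by (simp add: cov_matrix_def B_def x_def n_def)
  have sumsq: "(\<Sum>a\<in>F. (t a)\<^sup>2) = (\<Sum>i<n. (t (x i))\<^sup>2)"
    using sum.reindex_bij_betw[OF bij, of "\<lambda>a. (t a)\<^sup>2"] by simp
  have "lincomb t F = (\<lambda>\<omega>. \<Sum>i<n. t (x i) * X (x i) \<omega>)"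
    using sum.reindex_bij_betw[OF bij, of "\<lambda>a. t a * X a \<omega>" for \<omega>] by (simp add: lincomb_def fun_eq_iff)
  moreover have tX: "(\<lambda>\<omega>. t (x i) * X (x i) \<omega>) \<in> L2 M" if "i < n" for i
    using x1[OF that] by (intro L2_cmult X_L2)
  ultimately have "ip M (lincomb t F) (lincomb t F) =
    (\<Sum>i<n. ip M (\<lambda>\<omega>. t (x i) * X (x i) \<omega>) (\<lambda>\<omega>. \<Sum>j<n. t (x j) * X (x j) \<omega>))"
    by (simp only:) (intro ip_sum_left L2_sum, auto)
  also have "\<dots> = (\<Sum>i<n. \<Sum>j<n. t (x i) * B i j * t (x j))"
  proof (rule sum.cong[OF refl])
    fix i assume i: "i \<in> {..<n}"
    have "ip M (\<lambda>\<omega>. t (x i) * X (x i) \<omega>) (\<lambda>\<omega>. \<Sum>j<n. t (x j) * X (x j) \<omega>) =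
      (\<Sum>j<n. ip M (\<lambda>\<omega>. t (x j) * X (x j) \<omega>) (\<lambda>\<omega>. t (x i) * X (x i) \<omega>))"
      using i tX by (subst ip_commute) (intro ip_sum_left, auto)
    also have "\<dots> = (\<Sum>j<n. t (x i) * B i j * t (x j))"
      using i by (intro sum.cong refl) (simp add: B ip_cmult_left ip_cmult_right ip_commute)
    finally show "ip M (\<lambda>\<omega>. t (x i) * X (x i) \<omega>) (\<lambda>\<omega>. \<Sum>j<n. t (x j) * X (x j) \<omega>) = (\<Sum>j<n. t (x i) * B i j * t (x j))" .
  qed
  finally have form: "ip M (lincomb t F) (lincomb t F) = (\<Sum>i<n. \<Sum>j<n. t (x i) * B i j * t (x j))" .
  have sym: "B i j = B j i" if "i < n" "j < n" for i j using that by (simp add: B ip_commute)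
  note bd = quadratic_form_bounds[of n B c C "\<lambda>i. t (x i)", OF sym]
  show "c * (\<Sum>a\<in>F. (t a)\<^sup>2) \<le> ip M (lincomb t F) (lincomb t F)"
    unfolding form sumsq by (rule bd(1)) (use ev in \<open>auto simp: mat n_def\<close>)
  show "ip M (lincomb t F) (lincomb t F) \<le> C * (\<Sum>a\<in>F. (t a)\<^sup>2)"
    unfolding form sumsq by (rule bd(2)) (use ev in \<open>auto simp: mat n_def\<close>)
qed

end

section \<open>Unconditional expansions and intersections of closed spans\<close>

locale riesz_gaussian_family = gaussian_family +
  fixes c C :: real
  assumes c_pos: "c > 0"
    and lower: "\<And>F t. finite F \<Longrightarrow> F \<subseteq> {1..} \<Longrightarrow> c * (\<Sum>a\<in>F. (t a)\<^sup>2) \<le> ip M (lincomb t F) (lincomb t F)"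
    and upper: "\<And>F t. finite F \<Longrightarrow> F \<subseteq> {1..} \<Longrightarrow> ip M (lincomb t F) (lincomb t F) \<le> C * (\<Sum>a\<in>F. (t a)\<^sup>2)"
begin

lemma C_pos: "C > 0"
  using lower[of "{1}" "\<lambda>_. 1"] upper[of "{1}" "\<lambda>_. 1"] c_pos by simp

lemma sqdist_lincomb:
  "finite F \<Longrightarrow> sqdist M (lincomb t F) (lincomb s F) = ip M (lincomb (\<lambda>a. t a - s a) F) (lincomb (\<lambda>a. t a - s a) F)"
  by (simp add: lincomb_diff)

text \<open>Convergence along the net of finite index sets, that is, unconditional convergence. Any
  further index may be added to a good set F0, which makes coefficients comparable one by
  one.\<close>

definition series_limit :: "(nat \<Rightarrow> real) \<Rightarrow> ('a \<Rightarrow> real) \<Rightarrow> bool" where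
  "series_limit t Z \<longleftrightarrow> (\<forall>e>0. \<exists>F0. finite F0 \<and> F0 \<subseteq> {1..} \<and>
       (\<forall>F. finite F \<and> F0 \<subseteq> F \<and> F \<subseteq> {1..} \<longrightarrow> sqdist M Z (lincomb t F) < e))"

lemma series_limitD:
  assumes "series_limit t Z" "e > 0"
  obtains F0 where "finite F0" "F0 \<subseteq> {1..}"
    "\<And>F. finite F \<Longrightarrow> F0 \<subseteq> F \<Longrightarrow> F \<subseteq> {1..} \<Longrightarrow> sqdist M Z (lincomb t F) < e"
  using assms unfolding series_limit_def by metis

text \<open>The lower bound makes the coefficients of approximating combinations Cauchy, uniformly
  over finite index sets; the upper bound carries the limit coefficients back to mean-square
  convergence.\<close>

lemma cspan_series:
  assumes Z: "Z \<in> cspan A" and A: "A \<subseteq> {1..}"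
  obtains t where "\<And>a. a \<notin> A \<Longrightarrow> t a = 0" "series_limit t Z"
proof -
  obtain F s where F: "\<And>n. finite (F n)" "\<And>n. F n \<subseteq> A" and
    app: "\<And>n. sqdist M Z (lincomb (s n) (F n)) < (1/4)^(Suc n)"
    using cspan_approx[OF Z A] by blast
  have F1: "F n \<subseteq> {1..}" for n using F(2) A by (rule order_trans)
  \<comment> \<open>Padding by zeros lets combinations over different finite sets be compared on any
    common superset.\<close>
  define u where "u n a = (if a \<in> F n then s n a else 0)" for n a
  have lu: "lincomb (u n) G = lincomb (s n) (F n)" if "finite G" "F n \<subseteq> G" for n G
    using lincomb_expand[OF that, of "s n"] by (simp add: u_def[abs_def])
  have Z2: "Z \<in> L2 M" using Z by (rule cspan_L2)
  have cauchy: "(\<Sum>a\<in>G. (u m a - u n a)\<^sup>2) \<le> (1/c) * (1/4)^N"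
    if G: "finite G" "G \<subseteq> {1..}" and mn: "N \<le> m" "N \<le> n" for G m n N
  proof -
    define H where "H = G \<union> F m \<union> F n"
    have H: "finite H" "H \<subseteq> {1..}" "F m \<subseteq> H" "F n \<subseteq> H" "G \<subseteq> H"
      using G F(1) F1 by (auto simp: H_def)
    have "c * (\<Sum>a\<in>G. (u m a - u n a)\<^sup>2) \<le> c * (\<Sum>a\<in>H. (u m a - u n a)\<^sup>2)"
      using H c_pos by (intro mult_left_mono sum_mono2) auto
    also have "\<dots> \<le> sqdist M (lincomb (s m) (F m)) (lincomb (s n) (F n))"
      using lower[OF H(1,2), of "\<lambda>a. u m a - u n a"]
      unfolding sqdist_lincomb[OF H(1), symmetric] lu[OF H(1,3)] lu[OF H(1,4)] .
    also have "\<dots> \<le> 2 * (sqdist M (lincomb (s m) (F m)) Z + sqdist M Z (lincomb (s n) (F n)))"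
      by (rule ip_triangle[OF lincomb_L2[OF F1] Z2 lincomb_L2[OF F1]])
    also have "\<dots> \<le> 2 * ((1/4)^(Suc N) + (1/4)^(Suc N))"
    proof -
      have "sqdist M Z (lincomb (s k) (F k)) \<le> (1/4)^(Suc N)" if "N \<le> k" for k
      proof -
        have "(1/4::real)^(Suc k) \<le> (1/4)^(Suc N)" using that by (intro power_decreasing) auto
        with app[of k] show ?thesis by linarith
      qed
      from this[OF mn(1)] this[OF mn(2)] show ?thesis
        by (subst ip_diff_swap[of M _ Z]) (intro mult_left_mono add_mono, auto)
    qed
    also have "\<dots> = (1/4)^N" by simp
    finally show ?thesis using c_pos by (simp add: field_simps)
  qed
  have tends0: "(\<lambda>N. (1/c) * (1/4)^N) \<longlonglongrightarrow> 0" by (rule quarter_power_tendsto)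
  define t where "t a = lim (\<lambda>n. u n a)" for a
  have conv: "(\<lambda>n. u n a) \<longlonglongrightarrow> t a" for a
  proof (cases "a \<ge> 1")
    case False
    then have "u n a = 0" for n using F1[of n] by (auto simp: u_def)
    then show ?thesis by (simp add: t_def)
  next
    case True
    have "Cauchy (\<lambda>n. u n a)"
    proof (rule metric_CauchyI)
      fix e :: real assume "e > 0"
      then have "\<forall>\<^sub>F N in sequentially. (1/c) * (1/4)^N < e\<^sup>2"
        by (intro order_tendstoD(2)[OF tends0]) simp
      then obtain N where N: "(1/c) * (1/4)^N < e\<^sup>2" by (auto simp: eventually_sequentially)
      have "dist (u m a) (u n a) < e" if "m \<ge> N" "n \<ge> N" for m n
      proof -
        have "(u m a - u n a)\<^sup>2 < e\<^sup>2"
          using cauchy[of "{a}" N m n] that N True by simp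
        then have "\<bar>u m a - u n a\<bar> < e"
          using power_less_imp_less_base[of "\<bar>u m a - u n a\<bar>" 2 e] \<open>e > 0\<close> by simp
        then show ?thesis by (simp add: dist_real_def)
      qed
      then show "\<exists>N. \<forall>m\<ge>N. \<forall>n\<ge>N. dist (u m a) (u n a) < e" by blast
    qed
    then show ?thesis unfolding t_def by (simp add: Cauchy_convergent_iff convergent_LIMSEQ_iff)
  qed
  have t0: "t a = 0" if "a \<notin> A" for a
  proof -
    have "u n a = 0" for n using that F(2)[of n] by (auto simp: u_def)
    then show ?thesis by (simp add: t_def)
  qed
  \<comment> \<open>The limit over m of the Cauchy estimate; the bound does not depend on G.\<close>
  have lim_bound: "(\<Sum>a\<in>G. (t a - u n a)\<^sup>2) \<le> (1/c) * (1/4)^n" if G: "finite G" "G \<subseteq> {1..}" for G n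
  proof (rule LIMSEQ_le_const2)
    show "(\<lambda>m. \<Sum>a\<in>G. (u m a - u n a)\<^sup>2) \<longlonglongrightarrow> (\<Sum>a\<in>G. (t a - u n a)\<^sup>2)"
      by (intro tendsto_intros conv)
    show "\<exists>N. \<forall>m\<ge>N. (\<Sum>a\<in>G. (u m a - u n a)\<^sup>2) \<le> (1/c) * (1/4)^n"
      using cauchy[OF G, of n _ n] by blast
  qed
  \<comment> \<open>Collects 1/4 from the n-th approximation and C / c from the exchange of its
    coefficients for the limits, doubled by \<open>ip_triangle\<close>.\<close>
  define K where "K = 2 * (1/4 + C / c)"
  have main: "sqdist M Z (lincomb t G) \<le> K * (1/4)^n" if G: "finite G" "F n \<subseteq> G" "G \<subseteq> {1..}" for G n
  proof -
    have "sqdist M (lincomb (s n) (F n)) (lincomb t G) = sqdist M (lincomb t G) (lincomb (u n) G)"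
      unfolding lu[OF G(1,2)] by (rule ip_diff_swap)
    also have "\<dots> \<le> C * (\<Sum>a\<in>G. (t a - u n a)\<^sup>2)"
      unfolding sqdist_lincomb[OF G(1)] by (rule upper[OF G(1,3)])
    also have "\<dots> \<le> C * ((1/c) * (1/4)^n)"
      using C_pos lim_bound[OF G(1,3)] by (intro mult_left_mono) auto
    finally have 1: "sqdist M (lincomb (s n) (F n)) (lincomb t G) \<le> C * ((1/c) * (1/4)^n)" .
    have "sqdist M Z (lincomb t G) \<le> 2 * (sqdist M Z (lincomb (s n) (F n)) + sqdist M (lincomb (s n) (F n)) (lincomb t G))"
      by (rule ip_triangle[OF Z2 lincomb_L2[OF F1] lincomb_L2[OF G(3)]])
    also have "\<dots> \<le> 2 * ((1/4)^(Suc n) + C * ((1/c) * (1/4)^n))"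
      using app[of n] 1 by (intro mult_left_mono add_mono) auto
    also have "\<dots> = K * (1/4)^n" by (simp add: K_def algebra_simps)
    finally show ?thesis .
  qed
  have "\<exists>F0. finite F0 \<and> F0 \<subseteq> {1..} \<and>
       (\<forall>G. finite G \<and> F0 \<subseteq> G \<and> G \<subseteq> {1..} \<longrightarrow> sqdist M Z (lincomb t G) < e)" if "e > 0" for e
  proof -
    have "\<forall>\<^sub>F n in sequentially. K * (1/4)^n < e"
      by (rule order_tendstoD(2)[OF quarter_power_tendsto that])
    then obtain n where n: "K * (1/4)^n < e" by (auto simp: eventually_sequentially)
    show ?thesis
      using F(1)[of n] F1[of n] main[of _ n] n by (intro exI[of _ "F n"] conjI allI impI) (auto intro: order.strict_trans1)
  qed
  then have "series_limit t Z" unfolding series_limit_def by simp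
  with t0 that show ?thesis by blast
qed

text \<open>Expansions of Z over two sets of the family have the same coefficients by the lower
  bound. Those obtained from A0 thus vanish off every A, and the expansion lives on the
  intersection. The family may be infinite.\<close>

lemma cspan_Inter:
  assumes ne: "\<A> \<noteq> {}" and sub: "\<And>A. A \<in> \<A> \<Longrightarrow> A \<subseteq> {1..}" and Z: "\<And>A. A \<in> \<A> \<Longrightarrow> Z \<in> cspan A"
  shows "Z \<in> cspan (\<Inter>\<A>)"
proof -
  obtain A0 where A0: "A0 \<in> \<A>" using ne by blast
  have Z2: "Z \<in> L2 M" using Z[OF A0] by (rule cspan_L2)
  obtain t where t0: "\<And>a. a \<notin> A0 \<Longrightarrow> t a = 0" and t: "series_limit t Z"
    using cspan_series[OF Z[OF A0] sub[OF A0]] by blast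
  have off: "t a = 0" if A: "A \<in> \<A>" and a: "a \<notin> A" for A a
  proof (cases "a \<ge> 1")
    case False
    then show ?thesis using t0[of a] sub[OF A0] by auto
  next
    case True
    obtain s where s0: "\<And>a. a \<notin> A \<Longrightarrow> s a = 0" and s: "series_limit s Z"
      using cspan_series[OF Z[OF A] sub[OF A]] by blast
    have "c * (t a - s a)\<^sup>2 \<le> 0"
    \<comment> \<open>Both series are within e / 4 of Z on a common finite set containing a, so
      their difference there has variance at most e, which dominates the contribution of the index
      a.\<close>
    proof (rule field_le_epsilon)
      fix e :: real assume "e > 0"
      then have e4: "e / 4 > 0" by simp
      obtain F where F: "finite F" "F \<subseteq> {1..}"
        "\<And>H. finite H \<Longrightarrow> F \<subseteq> H \<Longrightarrow> H \<subseteq> {1..} \<Longrightarrow> sqdist M Z (lincomb t H) < e / 4"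
        using series_limitD[OF t e4] by metis
      obtain G where G: "finite G" "G \<subseteq> {1..}"
        "\<And>H. finite H \<Longrightarrow> G \<subseteq> H \<Longrightarrow> H \<subseteq> {1..} \<Longrightarrow> sqdist M Z (lincomb s H) < e / 4"
        using series_limitD[OF s e4] by metis
      define H where "H = F \<union> G \<union> {a}"
      have H: "finite H" "H \<subseteq> {1..}" "F \<subseteq> H" "G \<subseteq> H" "a \<in> H"
        using F G True by (auto simp: H_def)
      have "c * (t a - s a)\<^sup>2 \<le> c * (\<Sum>a\<in>H. (t a - s a)\<^sup>2)"
        using H c_pos by (intro mult_left_mono member_le_sum) auto
      also have "\<dots> \<le> sqdist M (lincomb t H) (lincomb s H)"
        unfolding sqdist_lincomb[OF H(1)] by (rule lower[OF H(1,2)])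
      also have "\<dots> \<le> 2 * (sqdist M (lincomb t H) Z + sqdist M Z (lincomb s H))"
        by (rule ip_triangle[OF lincomb_L2[OF H(2)] Z2 lincomb_L2[OF H(2)]])
      also have "\<dots> \<le> 2 * (e / 4 + e / 4)"
      proof -
        have "sqdist M (lincomb t H) Z < e / 4" using F(3)[OF H(1,3,2)] by (subst ip_diff_swap)
        moreover have "sqdist M Z (lincomb s H) < e / 4" using G(3)[OF H(1,4,2)] .
        ultimately show ?thesis by (intro mult_left_mono add_mono) auto
      qed
      finally show "c * (t a - s a)\<^sup>2 \<le> 0 + e" by simp
    qed
    then have "t a = s a" using c_pos by (simp add: mult_le_0_iff)
    then show ?thesis using s0[OF a] by simp
  qed
  show ?thesis unfolding cspan_def
  proof (intro CollectI conjI Z2 allI impI)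
    fix e :: real assume "e > 0"
    with t obtain F where F: "finite F" "F \<subseteq> {1..}" "sqdist M Z (lincomb t F) < e"
      by (metis series_limitD order_refl)
    have "lincomb t F = lincomb t (F \<inter> \<Inter>\<A>)"
      unfolding lincomb_def using F(1) off by (intro ext sum.mono_neutral_right) auto
    with F show "\<exists>F t. finite F \<and> F \<subseteq> \<Inter>\<A> \<and> sqdist M Z (lincomb t F) < e"
      by (intro exI[of _ "F \<inter> \<Inter>\<A>"] exI[of _ t]) auto
  qed
qed

end

section \<open>Intersection properties and decorrelation\<close>

lemma cond_indep_sym:
  assumes "cond_indep M X A B C"
  shows "cond_indep M X B A C"
  unfolding cond_indep_def
proof (intro ballI)
  fix E1 E2 assume "E1 \<in> sets (sigma_gen M X B)" "E2 \<in> sets (sigma_gen M X A)"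
  with assms show "AE \<omega> in M. real_cond_exp M (sigma_gen M X C) (indicator E1) \<omega> *
      real_cond_exp M (sigma_gen M X C) (indicator E2) \<omega> =
      real_cond_exp M (sigma_gen M X C) (indicator (E1 \<inter> E2)) \<omega>"
    unfolding cond_indep_def by (subst mult.commute, subst Int_commute) blast
qed

context riesz_gaussian_family
begin

text \<open>Z1 - Z2 lies in the span and is the difference of two residuals orthogonal to it, hence
  orthogonal to itself.\<close>

lemma residual_unique:
  assumes D: "D \<subseteq> {1..}" and Y: "Y \<in> L2 M" and Z: "Z1 \<in> cspan D" "Z2 \<in> cspan D"
    and perp: "\<And>d. d \<in> D \<Longrightarrow> ip M (\<lambda>\<omega>. Y \<omega> - Z1 \<omega>) (X d) = 0" "\<And>d. d \<in> D \<Longrightarrow> ip M (\<lambda>\<omega>. Y \<omega> - Z2 \<omega>) (X d) = 0"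
  shows "sqdist M Z1 Z2 = 0"
proof -
  have T: "(\<lambda>\<omega>. Z1 \<omega> - Z2 \<omega>) \<in> cspan D" by (rule cspan_diff[OF Z D])
  have L: "(\<lambda>\<omega>. Y \<omega> - Z1 \<omega>) \<in> L2 M" "(\<lambda>\<omega>. Y \<omega> - Z2 \<omega>) \<in> L2 M"
    by (rule L2_diff[OF Y cspan_L2[OF Z(1)]], rule L2_diff[OF Y cspan_L2[OF Z(2)]])
  have "ip M (\<lambda>\<omega>. Y \<omega> - Z1 \<omega>) (\<lambda>\<omega>. Z1 \<omega> - Z2 \<omega>) = 0" by (rule perp_cspan[OF L(1) D perp(1) T])
  moreover have "ip M (\<lambda>\<omega>. Y \<omega> - Z2 \<omega>) (\<lambda>\<omega>. Z1 \<omega> - Z2 \<omega>) = 0" by (rule perp_cspan[OF L(2) D perp(2) T])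
  ultimately show ?thesis
    using ip_diff_left[OF L(2,1) cspan_L2[OF T]] by simp
qed

lemma cspan_if_sqdist_zero:
  assumes "A \<subseteq> {1..}" "Z \<in> cspan A" "Y \<in> L2 M" "sqdist M Y Z = 0"
  shows "Y \<in> cspan A"
  by (rule cspan_closed[OF assms(3,1) bexI[OF _ assms(2)]]) (simp add: assms(4))

text \<open>The common projection onto \<open>cspan S\<close> lies in each \<open>cspan\<close> of the family, hence in the
  \<open>cspan\<close> of the intersection.\<close>

lemma projection_Inter:
  assumes S: "S \<subseteq> {1..}" and Y: "Y \<in> L2 M" and ne: "\<A> \<noteq> {}" and sub: "\<And>A. A \<in> \<A> \<Longrightarrow> A \<subseteq> S"
    and proj: "\<And>A. A \<in> \<A> \<Longrightarrow> \<exists>Z\<in>cspan A. \<forall>d\<in>S. ip M (\<lambda>\<omega>. Y \<omega> - Z \<omega>) (X d) = 0"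
  shows "\<exists>Z\<in>cspan (\<Inter>\<A>). \<forall>d\<in>S. ip M (\<lambda>\<omega>. Y \<omega> - Z \<omega>) (X d) = 0"
proof -
  obtain A0 where A0: "A0 \<in> \<A>" using ne by blast
  obtain Z where Z: "Z \<in> cspan A0" "\<forall>d\<in>S. ip M (\<lambda>\<omega>. Y \<omega> - Z \<omega>) (X d) = 0"
    using proj[OF A0] by blast
  have "Z \<in> cspan A" if A: "A \<in> \<A>" for A
  proof -
    obtain V where V: "V \<in> cspan A" "\<forall>d\<in>S. ip M (\<lambda>\<omega>. Y \<omega> - V \<omega>) (X d) = 0"
      using proj[OF A] by blast
    have "sqdist M Z V = 0"
      using Z V cspan_mono[OF sub[OF A]] cspan_mono[OF sub[OF A0]]
      by (intro residual_unique[OF S Y]) auto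
    then show ?thesis
      using sub[OF A] S by (intro cspan_if_sqdist_zero[OF _ V(1) cspan_L2[OF Z(1)]]) auto
  qed
  then have "Z \<in> cspan (\<Inter>\<A>)" using ne sub S by (intro cspan_Inter) auto
  with Z show ?thesis by blast
qed


text \<open>Both premises concern the same projection, that of X_a onto the closed span of B
  \<union> C \<union> D: it lies in the closed spans of C \<union> D and of B \<union> D. These
  index sets meet in D because B and C are disjoint.\<close>

lemma IIP: "IIP M X"
  unfolding IIP_def
proof (intro allI impI, elim conjE)
  fix D A B C :: "nat set"
  assume D: "D \<subseteq> {1..}" and sub: "A \<subseteq> {1..} - D" "B \<subseteq> {1..} - D" "C \<subseteq> {1..} - D" and disj: "B \<inter> C = {}"
    and ci1: "cond_indep M X A B (C \<union> D)" and ci2: "cond_indep M X A C (B \<union> D)"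
  have A: "A \<subseteq> {1..}" and B: "B \<subseteq> {1..}" and C: "C \<subseteq> {1..}" using sub by auto
  have CD: "C \<union> D \<subseteq> {1..}" and BD: "B \<union> D \<subseteq> {1..}" and BC: "B \<union> C \<subseteq> {1..}" and BCD: "B \<union> C \<union> D \<subseteq> {1..}"
    using B C D by auto
  show "cond_indep M X A (B \<union> C) D"
  proof (rule projection_imp_cond_indep[OF A BC D])
    fix a assume a: "a \<in> A"
    have Xa: "X a \<in> L2 M" using a A by (intro X_L2) auto
    have "\<exists>Z\<in>cspan (\<Inter>{C \<union> D, B \<union> D}). \<forall>d\<in>B \<union> C \<union> D. ip M (\<lambda>\<omega>. X a \<omega> - Z \<omega>) (X d) = 0"
    proof (rule projection_Inter[OF BCD Xa])
      fix I assume "I \<in> {C \<union> D, B \<union> D}"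
      then consider "I = C \<union> D" | "I = B \<union> D" by blast
      then show "\<exists>Z\<in>cspan I. \<forall>d\<in>B \<union> C \<union> D. ip M (\<lambda>\<omega>. X a \<omega> - Z \<omega>) (X d) = 0"
      proof cases
        case 1
        obtain Z where "Z \<in> cspan (C \<union> D)" "\<And>d. d \<in> B \<union> (C \<union> D) \<Longrightarrow> ip M (\<lambda>\<omega>. X a \<omega> - Z \<omega>) (X d) = 0"
          using cond_indep_imp_projection[OF A B CD ci1 a] by blast
        with 1 show ?thesis by (metis Un_assoc)
      next
        case 2
        obtain Z where "Z \<in> cspan (B \<union> D)" "\<And>d. d \<in> C \<union> (B \<union> D) \<Longrightarrow> ip M (\<lambda>\<omega>. X a \<omega> - Z \<omega>) (X d) = 0"
          using cond_indep_imp_projection[OF A C BD ci2 a] by blast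
        with 2 show ?thesis by (metis Un_assoc Un_left_commute)
      qed
    qed auto
    moreover have "\<Inter>{C \<union> D, B \<union> D} = D" using disj by auto
    ultimately show "\<exists>Z\<in>cspan D. \<forall>d\<in>B \<union> C \<union> D. ip M (\<lambda>\<omega>. X a \<omega> - Z \<omega>) (X d) = 0" by simp
  qed
qed

text \<open>The relation is first reversed. With X_b, b in T, as the projected variable, the target
  is the closed span of S \<union> Z for every block K; with the blocks on the left it would change
  with K.\<close>

lemma P5star: "P5star (cond_indep M X)"
  unfolding P5star_def
proof (intro allI impI, elim conjE)
  fix S T Z :: "nat set" and P :: "nat set set"
  assume S: "S \<subseteq> {1..}" and T: "T \<subseteq> {1..}" and Z: "Z \<subseteq> {1..}" and P: "partition_on S P"
    and ci: "\<forall>K\<in>P. cond_indep M X K T (Z \<union> \<Union>(P - {K}))"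
  have SP: "S = \<Union>P" using partition_onD1[OF P] .
  have SZ: "S \<union> Z \<subseteq> {1..}" using S Z by simp
  have "cond_indep M X T S Z"
  proof (rule projection_imp_cond_indep[OF T S Z])
    fix b assume b: "b \<in> T"
    have Xb: "X b \<in> L2 M" using b T by (intro X_L2) auto
    show "\<exists>V\<in>cspan Z. \<forall>d\<in>S \<union> Z. ip M (\<lambda>\<omega>. X b \<omega> - V \<omega>) (X d) = 0"
    proof (cases "P = {}")
      \<comment> \<open>The intersection of an empty family would be \<open>UNIV\<close>; here S is
        empty, and any projection onto the closed span of Z serves.\<close>
      case True
      then have "S = {}" using SP by simp
      obtain V where "V \<in> cspan Z" "\<And>W. W \<in> cspan Z \<Longrightarrow> ip M (\<lambda>\<omega>. X b \<omega> - V \<omega>) W = 0"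
        using cspan_projection[OF Xb Z] by blast
      then show ?thesis using X_cspan[OF _ Z] \<open>S = {}\<close> by auto
    next
      case False
      define \<A> where "\<A> = (\<lambda>K. Z \<union> \<Union>(P - {K})) ` P"
      have "\<exists>V\<in>cspan (\<Inter>\<A>). \<forall>d\<in>S \<union> Z. ip M (\<lambda>\<omega>. X b \<omega> - V \<omega>) (X d) = 0"
      proof (rule projection_Inter[OF SZ Xb])
        show "\<A> \<noteq> {}" using False by (simp add: \<A>_def)
        show "I \<subseteq> S \<union> Z" if "I \<in> \<A>" for I using that unfolding \<A>_def SP by auto
        fix I assume "I \<in> \<A>"
        then obtain K where K: "K \<in> P" and I: "I = Z \<union> \<Union>(P - {K})" unfolding \<A>_def by blast
        have K1: "K \<subseteq> {1..}" and I1: "I \<subseteq> {1..}" using K I S Z unfolding SP by auto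
        have "cond_indep M X T K I" using ci K unfolding I by (metis cond_indep_sym)
        from cond_indep_imp_projection[OF T K1 I1 this b]
        obtain V where V: "V \<in> cspan I" "\<And>d. d \<in> K \<union> I \<Longrightarrow> ip M (\<lambda>\<omega>. X b \<omega> - V \<omega>) (X d) = 0"
          by blast
        moreover have "K \<union> I = S \<union> Z" using K unfolding I SP by auto
        ultimately show "\<exists>V\<in>cspan I. \<forall>d\<in>S \<union> Z. ip M (\<lambda>\<omega>. X b \<omega> - V \<omega>) (X d) = 0" by auto
      qed
      \<comment> \<open>An index of S lies in exactly one block K, so the member of the family that
        omits K contains it only if it is in Z.\<close>
      moreover have "\<Inter>\<A> = Z"
      proof
        show "Z \<subseteq> \<Inter>\<A>" unfolding \<A>_def by auto
        show "\<Inter>\<A> \<subseteq> Z"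
        proof
          fix x assume x: "x \<in> \<Inter>\<A>"
          show "x \<in> Z"
          proof (rule ccontr)
            assume "x \<notin> Z"
            obtain K0 where "K0 \<in> P" using False by blast
            with x \<open>x \<notin> Z\<close> obtain K where K: "K \<in> P" "x \<in> K" unfolding \<A>_def by auto
            with x \<open>x \<notin> Z\<close> obtain K' where K': "K' \<in> P" "x \<in> K'" "K' \<noteq> K" unfolding \<A>_def by auto
            then have "K \<inter> K' = {}" using partition_onD2[OF P] K by (auto simp: disjoint_def)
            with K K' show False by blast
          qed
        qed
      qed
      ultimately show ?thesis by simp
    qed
  qed
  then show "cond_indep M X S T Z" by (rule cond_indep_sym)
qed

text \<open>The squared distances from Y to its projections increase and are bounded by
  \<open>ip M Y Y\<close>. By Pythagoras their increments are the squared distances between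
  projections, which makes these Cauchy. The subsequence r provides the geometric rate needed for
  completeness.\<close>

lemma decreasing_projections_converge:
  assumes D: "\<And>n. D n \<subseteq> {1..}" and dec: "decseq D" and Y: "Y \<in> L2 M"
  obtains Z r L where "\<And>n. Z n \<in> cspan (D n)"
    "\<And>n d. d \<in> D n \<Longrightarrow> ip M (\<lambda>\<omega>. Y \<omega> - Z n \<omega>) (X d) = 0"
    "L \<in> cspan (\<Inter>n. D n)" "(\<lambda>n. sqdist M (Z (r n)) L) \<longlonglongrightarrow> 0"
proof -
  have "\<exists>Z. Z \<in> cspan (D n) \<and> (\<forall>V\<in>cspan (D n). ip M (\<lambda>\<omega>. Y \<omega> - Z \<omega>) V = 0)" for n
  proof -
    obtain V where "V \<in> cspan (D n)" "\<And>W. W \<in> cspan (D n) \<Longrightarrow> ip M (\<lambda>\<omega>. Y \<omega> - V \<omega>) W = 0"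
      using cspan_projection[OF Y D[of n]] by blast
    then show ?thesis by blast
  qed
  from choice[OF allI[OF this]] obtain Z
    where Zall: "\<forall>n. Z n \<in> cspan (D n) \<and> (\<forall>V\<in>cspan (D n). ip M (\<lambda>\<omega>. Y \<omega> - Z n \<omega>) V = 0)"
    by (rule exE)
  have Z: "Z n \<in> cspan (D n)" for n using Zall by simp
  have perp: "ip M (\<lambda>\<omega>. Y \<omega> - Z n \<omega>) V = 0" if "V \<in> cspan (D n)" for n V
    using Zall that by simp
  have Z2: "Z n \<in> L2 M" for n using Z by (rule cspan_L2)
  have mono: "cspan (D n) \<subseteq> cspan (D m)" if "m \<le> n" for m n
    using dec that by (intro cspan_mono) (auto simp: decseq_def)
  define e where "e n = sqdist M Y (Z n)" for n
  have pyth: "e n = e m + sqdist M (Z m) (Z n)" if "m \<le> n" for m n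
  proof -
    have ZZ: "(\<lambda>\<omega>. Z m \<omega> - Z n \<omega>) \<in> cspan (D m)"
      using Z[of m] Z[of n] mono[OF that] by (intro cspan_diff D) auto
    show ?thesis
      using ip_add_self[OF L2_diff[OF Y Z2[of m]] cspan_L2[OF ZZ]] perp[OF ZZ] by (simp add: e_def)
  qed
  have e_le: "e n \<le> ip M Y Y" for n
  proof -
    have "ip M Y Y = e n + ip M (Z n) (Z n)"
      using ip_add_self[OF L2_diff[OF Y Z2[of n]] Z2[of n]] perp[OF Z] by (simp add: e_def)
    then show ?thesis using ip_self_nonneg[of M "Z n"] by simp
  qed
  have "incseq e"
  proof (rule incseq_SucI)
    show "e n \<le> e (Suc n)" for n
      using pyth[of n "Suc n"] ip_self_nonneg[of M "\<lambda>\<omega>. Z n \<omega> - Z (Suc n) \<omega>"] by simp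
  qed
  then obtain l where l: "e \<longlonglongrightarrow> l" "\<And>n. e n \<le> l"
    using incseq_convergent[of e "ip M Y Y"] e_le by blast
  have "\<exists>N. l - e N < (1/4)^n" for n
  proof -
    have "\<forall>\<^sub>F k in sequentially. l - (1/4)^n < e k" by (rule order_tendstoD(1)[OF l(1)]) simp
    then obtain k where "l - (1/4)^n < e k" by (auto simp: eventually_sequentially)
    then show ?thesis by (intro exI[of _ k]) simp
  qed
  then obtain N where N: "\<And>n. l - e (N n) < (1/4)^n" by metis
  \<comment> \<open>The sum makes r monotone and at least \<open>N n\<close>; the summand n ensures
    that \<open>Z (r n)\<close> eventually lies in each \<open>cspan (D m)\<close>.\<close>
  define r where "r n = n + (\<Sum>k\<le>n. N k)" for n
  have r: "r n \<ge> n" "r n \<ge> N n" "r n \<le> r (Suc n)" for n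
    by (auto simp: r_def intro: order_trans[OF member_le_sum[of n "{..n}" N]])
  have er: "l - e (r n) < (1/4)^n" for n
    using N[of n] incseqD[OF \<open>incseq e\<close> r(2), of n] by linarith
  have rapid: "sqdist M (Z (r (Suc n))) (Z (r n)) \<le> (1/4)^n" for n
  proof -
    have "sqdist M (Z (r (Suc n))) (Z (r n)) = e (r (Suc n)) - e (r n)"
      using pyth[OF r(3), of n] by (subst ip_diff_swap) simp
    also have "\<dots> \<le> (1/4)^n" using er[of n] l(2)[of "r (Suc n)"] by linarith
    finally show ?thesis .
  qed
  define L where "L = (\<lambda>\<omega>. lim (\<lambda>n. Z (r n) \<omega>))"
  have L: "L \<in> L2 M" "\<And>n. sqdist M (Z (r n)) L \<le> 4 * (1/4)^n"
    unfolding L_def using L2_rapid_limit[of "\<lambda>n. Z (r n)", OF Z2 rapid] by auto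
  have lim: "(\<lambda>n. sqdist M (Z (r n)) L) \<longlonglongrightarrow> 0"
    by (rule sqdist_tendsto_if_geometric[OF L(2)])
  have "L \<in> cspan (D m)" for m
  proof (rule cspan_limit[OF D _ L(1) LIMSEQ_ignore_initial_segment[OF lim, of m]])
    fix n
    have "m \<le> r (n + m)" using r(1)[of "n + m"] by linarith
    then show "Z (r (n + m)) \<in> cspan (D m)" using Z mono by blast
  qed
  then have "L \<in> cspan (\<Inter>(range D))" using D by (intro cspan_Inter) auto
  moreover have "ip M (\<lambda>\<omega>. Y \<omega> - Z n \<omega>) (X d) = 0" if "d \<in> D n" for n d
    by (rule perp[OF X_cspan[OF that D]])
  ultimately show ?thesis using that[OF Z _ _ lim] by simp
qed

lemma DCP: "DCP M X"
  unfolding DCP_def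
proof (intro allI impI, elim conjE)
  fix D E assume D: "D \<subseteq> {1..}" and E: "E \<in> (\<Inter>n\<in>{1..}. sets (sigma_gen M X (D \<union> {n..})))"
  \<comment> \<open>Shifted by one, so that the sequence starts with \<open>D \<union> {1..}\<close>
    at n = 0.\<close>
  define Dn where "Dn n = D \<union> {Suc n..}" for n
  have Dn: "Dn n \<subseteq> {1..}" for n using D by (auto simp: Dn_def)
  have EDn: "E \<in> sets (sigma_gen M X (Dn n))" for n using E by (auto simp: Dn_def)
  have dec: "decseq Dn" by (auto simp: Dn_def decseq_def)
  have Inter: "(\<Inter>n. Dn n) = D"
  proof
    show "(\<Inter>n. Dn n) \<subseteq> D"
    proof
      fix x assume "x \<in> (\<Inter>n. Dn n)"
      then have "x \<in> Dn x" by blast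
      then show "x \<in> D" by (auto simp: Dn_def)
    qed
  qed (auto simp: Dn_def)
  have EM[measurable]: "E \<in> sets M" using Dn EDn by (rule sigma_gen_sets_M)
  have cm[measurable]: "cprob D E \<in> borel_measurable M" using cprob_measurable D by (rule sigma_gen_borel_M)
  define W where "W \<omega> = indicator E \<omega> - cprob D E \<omega>" for \<omega>
  have W[measurable]: "W \<in> borel_measurable M" unfolding W_def[abs_def] by measurable
  have bW: "\<bar>W \<omega>\<bar> \<le> 1" for \<omega> unfolding W_def by (rule abs_indicator_diff_cprob)
  have bV: "\<bar>cprob D E \<omega>\<bar> \<le> 1" for \<omega> using cprob_bounds[of D E \<omega>] by simp
  have W1: "W \<in> borel_measurable (sigma_gen M X {1..})"
  proof -
    have "E \<in> sets (sigma_gen M X {1..})" using EDn[of 0] sigma_gen_mono[OF Dn, of 0] by blast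
    then show ?thesis unfolding W_def[abs_def]
      by (intro borel_measurable_diff borel_measurable_indicator sigma_gen_borel_mono[OF cprob_measurable D])
  qed
  have intb: "integrable M (\<lambda>\<omega>. cos (T \<omega> + \<theta>) * f \<omega> :: real)"
    if [measurable]: "T \<in> borel_measurable M" "f \<in> borel_measurable M" and f: "\<And>\<omega>. \<bar>f \<omega>\<bar> \<le> 1" for T f \<theta>
  proof (rule integrable_bounded)
    show "\<bar>cos (T \<omega> + \<theta>) * f \<omega>\<bar> \<le> 1 * 1" for \<omega>
      unfolding abs_mult by (intro mult_mono f) auto
  qed measurable
  \<comment> \<open>Once W is orthogonal to all cosines of finite combinations, it is orthogonal to
    every bounded \<sigma>(X)-measurable function, in particular to itself.\<close>
  have "expectation (\<lambda>\<omega>. W \<omega> * W \<omega>) = 0"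
  proof (rule cos_orthogonal_imp_sigma_gen_orthogonal[OF order_refl W bW _ W1 bW])
    fix F :: "nat set" and t \<theta> assume F: "finite F" "F \<subseteq> {1..}"
    define Y where "Y = lincomb t F"
    have Y1: "Y \<in> cspan {1..}" unfolding Y_def using F by (rule lincomb_cspan) simp
    have Y2: "Y \<in> L2 M" using Y1 by (rule cspan_L2)
    obtain Z r L where Z: "\<And>n. Z n \<in> cspan (Dn n)"
      and perp: "\<And>n d. d \<in> Dn n \<Longrightarrow> ip M (\<lambda>\<omega>. Y \<omega> - Z n \<omega>) (X d) = 0"
      and L0: "L \<in> cspan (\<Inter>n. Dn n)" and lim: "(\<lambda>n. sqdist M (Z (r n)) L) \<longlonglongrightarrow> 0"
      by (rule decreasing_projections_converge[OF Dn dec Y2]) blast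
    have L: "L \<in> cspan D" using L0 Inter by simp
    have Z2: "Z n \<in> L2 M" and L2: "L \<in> L2 M" for n using Z L cspan_L2 by auto
    have [measurable]: "Y \<in> borel_measurable M" "L \<in> borel_measurable M"
      using Y1 L cspan_borel by auto
    have limY: "(\<lambda>n. sqdist M (\<lambda>\<omega>. Y \<omega> - Z (r n) \<omega>) (\<lambda>\<omega>. Y \<omega> - L \<omega>)) \<longlonglongrightarrow> 0"
      using lim by (subst (asm) ip_diff_swap) simp
    have YZ2: "(\<lambda>\<omega>. Y \<omega> - Z (r n) \<omega>) \<in> L2 M" and YL2: "(\<lambda>\<omega>. Y \<omega> - L \<omega>) \<in> L2 M" for n
      using Y2 Z2 L2 by (auto intro: L2_diff)
    have perpL: "ip M (\<lambda>\<omega>. Y \<omega> - L \<omega>) (X d) = 0" if d: "d \<in> D" for d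
    proof -
      have "X d \<in> L2 M" using d D by (intro X_L2) auto
      from ip_tendsto_left[OF YZ2 YL2 this limY]
      have "(\<lambda>n. ip M (\<lambda>\<omega>. Y \<omega> - Z (r n) \<omega>) (X d)) \<longlonglongrightarrow> ip M (\<lambda>\<omega>. Y \<omega> - L \<omega>) (X d)" .
      moreover have "ip M (\<lambda>\<omega>. Y \<omega> - Z (r n) \<omega>) (X d) = 0" for n
        using d by (intro perp) (simp add: Dn_def)
      ultimately show ?thesis by (simp add: LIMSEQ_const_iff)
    qed
    define c where "c = exp (- sqdist M Y L / 2)"
    \<comment> \<open>The event E belongs to the \<sigma>-algebra of every \<open>Dn n\<close>, so
      the left side can be computed with the n-th projection for each n; it is constant while the
      projections converge to L.\<close>
    have "expectation (\<lambda>\<omega>. indicator E \<omega> * cos (Y \<omega> + \<theta>)) = c * expectation (\<lambda>\<omega>. cos (L \<omega> + \<theta>) * indicator E \<omega>)"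
    proof (rule LIMSEQ_unique)
      have "expectation (\<lambda>\<omega>. indicator E \<omega> * cos (Y \<omega> + \<theta>)) =
        exp (- sqdist M Y (Z (r n)) / 2) * expectation (\<lambda>\<omega>. cos (Z (r n) \<omega> + \<theta>) * indicator E \<omega>)" for n
        using expectation_cos_projection[OF Dn Y1 Z perp borel_measurable_indicator[OF EDn] indicator_abs_le_1]
        by (simp add: mult.commute)
      moreover have "(\<lambda>n. exp (- sqdist M Y (Z (r n)) / 2) * expectation (\<lambda>\<omega>. cos (Z (r n) \<omega> + \<theta>) * indicator E \<omega>))
        \<longlonglongrightarrow> c * expectation (\<lambda>\<omega>. cos (L \<omega> + \<theta>) * indicator E \<omega>)"
        unfolding c_def
        by (intro tendsto_mult tendsto_exp tendsto_divide tendsto_minus tendsto_const ip_self_tendsto[OF YZ2 YL2 limY]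
            expectation_cos_tendsto[OF Z2 L2 lim _ indicator_abs_le_1]) auto
      ultimately show "(\<lambda>n. expectation (\<lambda>\<omega>. indicator E \<omega> * cos (Y \<omega> + \<theta>)))
        \<longlonglongrightarrow> c * expectation (\<lambda>\<omega>. cos (L \<omega> + \<theta>) * indicator E \<omega>)" by (simp only:)
    qed (rule tendsto_const)
    moreover have "expectation (\<lambda>\<omega>. cprob D E \<omega> * cos (Y \<omega> + \<theta>)) = c * expectation (\<lambda>\<omega>. cprob D E \<omega> * cos (L \<omega> + \<theta>))"
      unfolding c_def by (rule expectation_cos_projection[OF D Y1 L perpL cprob_measurable bV])
    \<comment> \<open>L has a \<sigma>(X_D)-measurable version, against which E and its conditional
      probability have the same integral.\<close>
    moreover have "expectation (\<lambda>\<omega>. cos (L \<omega> + \<theta>) * indicator E \<omega>) = expectation (\<lambda>\<omega>. cos (L \<omega> + \<theta>) * cprob D E \<omega>)"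
    proof -
      obtain L' where L': "L' \<in> borel_measurable (sigma_gen M X D)" and LL': "AE \<omega> in M. L \<omega> = L' \<omega>"
        using cspan_sigma_gen_version[OF L D] by blast
      have [measurable]: "L' \<in> borel_measurable M" using L' D by (rule sigma_gen_borel_M)
      have "expectation (\<lambda>\<omega>. cos (L \<omega> + \<theta>) * indicator E \<omega>) = expectation (\<lambda>\<omega>. cos (L' \<omega> + \<theta>) * indicator E \<omega>)"
        by (rule integral_cong_AE) (use LL' in auto)
      also have "\<dots> = expectation (\<lambda>\<omega>. cos (L' \<omega> + \<theta>) * cprob D E \<omega>)"
      proof (rule expectation_cprob(1)[OF D EM, symmetric])
        show "(\<lambda>\<omega>. cos (L' \<omega> + \<theta>)) \<in> borel_measurable (sigma_gen M X D)" using L' by measurable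
      qed (rule abs_cos_le_one)
      also have "\<dots> = expectation (\<lambda>\<omega>. cos (L \<omega> + \<theta>) * cprob D E \<omega>)"
        by (rule integral_cong_AE) (use LL' in auto)
      finally show ?thesis .
    qed
    ultimately have eq: "expectation (\<lambda>\<omega>. cos (Y \<omega> + \<theta>) * indicator E \<omega>) = expectation (\<lambda>\<omega>. cos (Y \<omega> + \<theta>) * cprob D E \<omega>)"
      by (simp add: mult.commute)
    have "expectation (\<lambda>\<omega>. cos (Y \<omega> + \<theta>) * W \<omega>) =
      expectation (\<lambda>\<omega>. cos (Y \<omega> + \<theta>) * indicator E \<omega>) - expectation (\<lambda>\<omega>. cos (Y \<omega> + \<theta>) * cprob D E \<omega>)"
      unfolding W_def right_diff_distrib
      by (intro Bochner_Integration.integral_diff intb bV indicator_abs_le_1) measurable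
    then show "expectation (\<lambda>\<omega>. cos (lincomb t F \<omega> + \<theta>) * W \<omega>) = 0" unfolding eq by (simp add: Y_def)
  qed
  moreover have "integrable M (\<lambda>\<omega>. W \<omega> * W \<omega>)"
  proof (rule integrable_bounded)
    show "\<bar>W \<omega> * W \<omega>\<bar> \<le> 1 * 1" for \<omega>
      unfolding abs_mult by (intro mult_mono bW) auto
  qed measurable
  ultimately have "AE \<omega> in M. W \<omega> * W \<omega> = 0"
    using integral_nonneg_eq_0_iff_AE[of M "\<lambda>\<omega>. W \<omega> * W \<omega>"] by simp
  then have AE: "AE \<omega> in M. indicator E \<omega> = cprob D E \<omega>"
    by eventually_elim (simp add: W_def)
  \<comment> \<open>Since the indicator of E agrees almost surely with the conditional probability,
    the level set at 1 is a \<sigma>(X_D)-measurable version of E.\<close>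
  define E' where "E' = {\<omega> \<in> space (sigma_gen M X D). cprob D E \<omega> = 1}"
  have E': "E' \<in> sets (sigma_gen M X D)"
    unfolding E'_def using cprob_measurable[of D E] by measurable
  have "E' \<in> sets M" using D E' by (rule sigma_gen_sets_M)
  have "AE \<omega> in M. \<omega> \<notin> sym_diff E E'"
    using AE AE_space by eventually_elim (auto simp: E'_def indicator_def split: if_splits)
  then have "measure M (sym_diff E E') = 0"
    using \<open>E' \<in> sets M\<close> EM by (subst (asm) AE_iff_null_sets[symmetric]) (auto intro: measure_eq_0_null_sets)
  with E' show "\<exists>E'\<in>sets (sigma_gen M X D). measure M (sym_diff E E') = 0" by blast
qed

end

theorem theorem2p5:
  fixes M :: "'a measure" and X :: "nat \<Rightarrow> 'a \<Rightarrow> real"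
  assumes "centered_gaussian_process M X"
    and "\<exists>c C :: real. 0 < c \<and>
           (\<forall>A. finite A \<and> A \<subseteq> {1..} \<longrightarrow>
              (\<forall>i\<in>{1..card A}. c < nth_eigenvalue i (cov_matrix M X A) \<and>
                               nth_eigenvalue i (cov_matrix M X A) < C))"
    and "\<exists>g0 :: nat \<Rightarrow> nat \<Rightarrow> ennreal.
           (\<forall>i\<ge>1. \<forall>j\<ge>1. ennreal \<bar>covariance M (X i) (X j)\<bar> \<le> g0 i j) \<and>
           (\<forall>n\<le>4. \<forall>i\<ge>1. \<forall>j\<ge>1. iterated_bound g0 n i j < \<infinity>) \<and>
           (\<exists>\<epsilon>::real. \<epsilon> > 0 \<and>
              (\<forall>n\<le>4. \<forall>i\<ge>1.
                 (\<Sum>k. iterated_bound g0 n i (Suc k) * ennreal (real (Suc k) powr \<epsilon>)) < \<infinity>))"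
  shows "IIP M X \<and> DCP M X \<and> P5star (cond_indep M X)"
proof -
  have gp: "prob_space M" "\<And>F. finite F \<Longrightarrow> F \<subseteq> {1..} \<Longrightarrow> multivariate_normal M F X"
    "\<And>n. n \<ge> 1 \<Longrightarrow> integral\<^sup>L M (X n) = 0"
    using assms(1) by (auto simp: centered_gaussian_process_def)
  interpret prob_space M by (rule gp(1))
  interpret gaussian_family M X
  proof
    show "X n \<in> borel_measurable M" if "n \<ge> 1" for n
      using gp(2)[of "{n}"] that by (simp add: multivariate_normal_def)
    show "normal_rv M (\<lambda>\<omega>. \<Sum>a\<in>F. t a * X a \<omega>)" if "finite F" "F \<subseteq> {1..}" for F t
      using gp(2)[OF that] by (simp add: multivariate_normal_def)
  qed (rule gp(3))
  obtain c C :: real where cC: "0 < c \<and> (\<forall>A. finite A \<and> A \<subseteq> {1..} \<longrightarrow>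
      (\<forall>i\<in>{1..card A}. c < nth_eigenvalue i (cov_matrix M X A) \<and>
                       nth_eigenvalue i (cov_matrix M X A) < C))"
    using assms(2) by (elim exE)
  interpret riesz_gaussian_family M X c C
  proof
    fix F :: "nat set" and t assume F: "finite F" "F \<subseteq> {1..}"
    note ev = cC[THEN conjunct2, rule_format, OF conjI[OF F]]
    show "c * (\<Sum>a\<in>F. (t a)\<^sup>2) \<le> ip M (lincomb t F) (lincomb t F)"
      by (rule ip_lincomb_bounds(1)[OF F ev])
    show "ip M (lincomb t F) (lincomb t F) \<le> C * (\<Sum>a\<in>F. (t a)\<^sup>2)"
      by (rule ip_lincomb_bounds(2)[OF F ev])
  qed (rule cC[THEN conjunct1])
  show ?thesis by (intro conjI IIP DCP P5star)
qed

end
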